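(* Let $\alpha,c,\delta>0$. Then: (a) For each $\tau>0$ the operator $\mathcal A^\tau$ generates a $C_0$-group $T^\tau(t)$ on $\mathbb H_1$. (b) Consider the family $\mathcal F_1=\{T^\tau(t)\}_{\tau>0}$ of groups generated by $\mathcal A^\tau$ on $\mathbb H_1$, and assume that there is a constant $\gamma_0>0$ such that $\gamma^\tau\equiv\alpha-c^2\tau(b^\tau)^{-1}>\gamma_0$ for all $\tau>0$. Then there exist $\tau_0>0$ and constants $\overline M_1=\overline M_1(\tau_0)>0$, $\overline\omega_1=\overline\omega_1(\tau_0)>0$, both independent of $\tau$, such that $$\|T^\tau(t)\|_{\mathcal L(\mathbb H_1^\tau)}\le\overline M_1e^{-\overline\omega_1t}\quad\text{for all }\tau\in(0,\tau_0]\text{ and all }t\ge0.$$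
   Context: Let $\Omega\subset\mathbb R^n$ ($n=2,3$) be a bounded domain with $C^2$ boundary and let $A=-\Delta$ on $L^2(\Omega)$ with $\mathcal D(A)=H_0^1(\Omega)\cap H^2(\Omega)$ (a positive self-adjoint operator with compact resolvent); $\|\cdot\|_2$ is the $L^2(\Omega)$ norm and $\|u\|_{\mathcal D(A^{s})}=\|A^{s}u\|_2$. For $\tau>0$ put $b^\tau=\delta+\tau c^2$. The space is $\mathbb H_1=\mathcal D(A)\times\mathcal D(A^{1/2})\times L^2(\Omega)$, and $\mathbb H_1^\tau$ denotes the same set equipped with the norm $\|(u,v,w)\|_{\tau,1}^2=\|Au\|_2^2+\|A^{1/2}v\|_2^2+\tau\|w\|_2^2$. $\mathcal L(\mathbb H_1^\tau)$ carries the operator norm induced by $\|\cdot\|_{\tau,1}$. The operator $\mathcal A^\tau$ on $\mathbb H_1$ is $$\mathcal A^\tau(u,v,w)=\big(v,\;w,\;-\tau^{-1}A(c^2u+b^\tau v)-\tau^{-1}\alpha w\big)$$ with its natural domain, i.e. all $U\in\mathbb H_1$ with $\mathcal A^\tau U\in\mathbb H_1$, which is $\mathcal D(A)\times\mathcal D(A)\times\mathcal D(A^{1/2})$. It is the first-order form, with $U=(u,u_t,u_{tt})$, of $\tau u_{ttt}+\alpha u_{tt}+c^2Au+b^\tau Au_t=0$. *)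

theory Defs
  imports "HOL-Analysis.Analysis"
begin

section \<open>The real Hilbert space of square-integrable functions on R^n\<close>

definition sq_integrable :: "(real^'n \<Rightarrow> real) \<Rightarrow> bool" where
  "sq_integrable f \<longleftrightarrow>
     f \<in> borel_measurable lebesgue \<and> integrable lebesgue (\<lambda>x. (f x)\<^sup>2)"

definition L2_eq :: "(real^'n \<Rightarrow> real) \<Rightarrow> (real^'n \<Rightarrow> real) \<Rightarrow> bool" where
  "L2_eq f g \<longleftrightarrow> sq_integrable f \<and> sq_integrable g \<and> (AE x in lebesgue. f x = g x)"

lemma sq_integrable_zero: "sq_integrable (\<lambda>x. 0)"
  by (simp add: sq_integrable_def)

lemma sq_integrable_scale: "sq_integrable f \<Longrightarrow> sq_integrable (\<lambda>x. r * f x)"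
  by (auto simp: sq_integrable_def power_mult_distrib)

lemma sq_integrable_mult:
  assumes "sq_integrable f" "sq_integrable g"
  shows "integrable lebesgue (\<lambda>x. f x * g x)"
proof (rule Bochner_Integration.integrable_bound)
  show "integrable lebesgue (\<lambda>x. (f x)\<^sup>2 + (g x)\<^sup>2)"
    using assms by (auto simp: sq_integrable_def)
  show "(\<lambda>x. f x * g x) \<in> borel_measurable lebesgue"
    using assms by (auto simp: sq_integrable_def)
  have "\<bar>a * b\<bar> \<le> a\<^sup>2 + b\<^sup>2" for a b :: real
  proof -
    have "2 * (\<bar>a\<bar> * \<bar>b\<bar>) \<le> a\<^sup>2 + b\<^sup>2"
      using sum_squares_bound[of "\<bar>a\<bar>" "\<bar>b\<bar>"] by simp
    moreover have "0 \<le> \<bar>a\<bar> * \<bar>b\<bar>" by simp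
    ultimately have "\<bar>a\<bar> * \<bar>b\<bar> \<le> a\<^sup>2 + b\<^sup>2" by linarith
    then show ?thesis by (simp only: abs_mult)
  qed
  then show "AE x in lebesgue. norm (f x * g x) \<le> norm ((f x)\<^sup>2 + (g x)\<^sup>2)"
    by (auto intro!: AE_I2)
qed

lemma sq_integrable_add:
  assumes "sq_integrable f" "sq_integrable g"
  shows "sq_integrable (\<lambda>x. f x + g x)"
  using assms sq_integrable_mult[OF assms]
  by (auto simp: sq_integrable_def power2_sum mult.assoc)

quotient_type 'n L2 = "real^('n::finite) \<Rightarrow> real" / partial: L2_eq
proof (rule part_equivpI)
  show "\<exists>f::real^'n \<Rightarrow> real. L2_eq f f"
    using sq_integrable_zero by (auto simp: L2_eq_def)
  show "symp (L2_eq :: (real^'n \<Rightarrow> real) \<Rightarrow> _)"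
    by (auto simp: symp_def L2_eq_def)
  show "transp (L2_eq :: (real^'n \<Rightarrow> real) \<Rightarrow> _)"
  proof (rule transpI)
    fix f g h :: "real^'n \<Rightarrow> real"
    assume fg: "L2_eq f g" and gh: "L2_eq g h"
    have "AE x in lebesgue. f x = g x" "AE x in lebesgue. g x = h x"
      using fg gh by (auto simp: L2_eq_def)
    then have "AE x in lebesgue. f x = h x"
      by eventually_elim simp
    then show "L2_eq f h" using fg gh by (auto simp: L2_eq_def)
  qed
qed

instantiation L2 :: (finite) real_inner
begin

lift_definition zero_L2 :: "'a L2" is "\<lambda>x. 0"
  by (simp add: L2_eq_def sq_integrable_zero)

lift_definition plus_L2 :: "'a L2 \<Rightarrow> 'a L2 \<Rightarrow> 'a L2" is "\<lambda>f g x. f x + g x"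
proof -
  fix f f' g g' :: "real^'a \<Rightarrow> real"
  assume a: "L2_eq f f'" "L2_eq g g'"
  then have "AE x in lebesgue. f x = f' x" "AE x in lebesgue. g x = g' x"
    by (auto simp: L2_eq_def)
  then have "AE x in lebesgue. f x + g x = f' x + g' x"
    by eventually_elim simp
  then show "L2_eq (\<lambda>x. f x + g x) (\<lambda>x. f' x + g' x)"
    using a by (auto simp: L2_eq_def sq_integrable_add)
qed

lift_definition scaleR_L2 :: "real \<Rightarrow> 'a L2 \<Rightarrow> 'a L2" is "\<lambda>r f x. r * f x"
  by (auto simp: L2_eq_def sq_integrable_scale)

definition uminus_L2 :: "'a L2 \<Rightarrow> 'a L2" where "uminus_L2 f = (-1) *\<^sub>R f"

definition minus_L2 :: "'a L2 \<Rightarrow> 'a L2 \<Rightarrow> 'a L2" where "minus_L2 f g = f + (- g)"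

lift_definition inner_L2 :: "'a L2 \<Rightarrow> 'a L2 \<Rightarrow> real"
  is "\<lambda>f g. \<integral>x. f x * g x \<partial>lebesgue"
proof -
  fix f f' g g' :: "real^'a \<Rightarrow> real"
  assume a: "L2_eq f f'" "L2_eq g g'"
  then have "AE x in lebesgue. f x = f' x" "AE x in lebesgue. g x = g' x"
    by (auto simp: L2_eq_def)
  then have "AE x in lebesgue. f x * g x = f' x * g' x"
    by eventually_elim simp
  then show "(\<integral>x. f x * g x \<partial>lebesgue) = (\<integral>x. f' x * g' x \<partial>lebesgue)"
    using a by (intro integral_cong_AE) (auto simp: L2_eq_def sq_integrable_def)
qed

definition norm_L2 :: "'a L2 \<Rightarrow> real" where "norm_L2 f = sqrt (inner f f)"

definition sgn_L2 :: "'a L2 \<Rightarrow> 'a L2" where "sgn_L2 f = inverse (norm f) *\<^sub>R f"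

definition dist_L2 :: "'a L2 \<Rightarrow> 'a L2 \<Rightarrow> real" where "dist_L2 f g = norm (f - g)"

definition uniformity_L2 :: "('a L2 \<times> 'a L2) filter" where
  "uniformity_L2 = (INF e\<in>{0<..}. principal {(f, g). dist f g < e})"

definition open_L2 :: "'a L2 set \<Rightarrow> bool" where
  "open_L2 U \<longleftrightarrow> (\<forall>f\<in>U. \<forall>\<^sub>F (f', g) in uniformity. f' = f \<longrightarrow> g \<in> U)"

instance
proof
  fix f g h :: "'a L2" and r s :: real and U :: "'a L2 set"
  show "f + g + h = f + (g + h)"
    by transfer (auto simp: L2_eq_def add.assoc intro!: sq_integrable_add)
  show "f + g = g + f"
    by transfer (auto simp: L2_eq_def add.commute intro!: sq_integrable_add)
  show "0 + f = f"
    by transfer (auto simp: L2_eq_def)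
  show "- f + f = 0"
    unfolding uminus_L2_def by transfer (auto simp: L2_eq_def sq_integrable_zero)
  show "f - g = f + - g" by (rule minus_L2_def)
  show "r *\<^sub>R (f + g) = r *\<^sub>R f + r *\<^sub>R g"
    by transfer (auto simp: L2_eq_def distrib_left intro!: sq_integrable_add sq_integrable_scale)
  show "(r + s) *\<^sub>R f = r *\<^sub>R f + s *\<^sub>R f"
    by transfer (auto simp: L2_eq_def distrib_right intro!: sq_integrable_add sq_integrable_scale)
  show "r *\<^sub>R s *\<^sub>R f = (r * s) *\<^sub>R f"
    by transfer (auto simp: L2_eq_def mult.assoc intro!: sq_integrable_scale)
  show "1 *\<^sub>R f = f"
    by transfer (auto simp: L2_eq_def)
  show "dist f g = norm (f - g)" by (rule dist_L2_def)
  show "sgn f = inverse (norm f) *\<^sub>R f" by (rule sgn_L2_def)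
  show "uniformity = (INF e\<in>{0<..}. principal {(f::'a L2, g). dist f g < e})"
    by (rule uniformity_L2_def)
  show "open U \<longleftrightarrow> (\<forall>f\<in>U. \<forall>\<^sub>F (f', g) in uniformity. f' = f \<longrightarrow> g \<in> U)"
    by (rule open_L2_def)
  show "f \<bullet> g = g \<bullet> f"
    by transfer (simp add: mult.commute)
  show "(f + g) \<bullet> h = f \<bullet> h + g \<bullet> h"
    by transfer (auto simp: L2_eq_def distrib_right sq_integrable_mult
        intro!: Bochner_Integration.integral_add)
  show "(r *\<^sub>R f) \<bullet> g = r * (f \<bullet> g)"
    by transfer (simp add: mult.assoc)
  show "0 \<le> f \<bullet> f"
    by transfer simp
  show "f \<bullet> f = 0 \<longleftrightarrow> f = 0"
  proof (transfer, goal_cases)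
    case (1 f)
    then have f: "sq_integrable f" by (simp add: L2_eq_def)
    have "(\<integral>x. f x * f x \<partial>lebesgue) = 0 \<longleftrightarrow> (AE x in lebesgue. f x * f x = 0)"
      using sq_integrable_mult[OF f f] by (intro integral_nonneg_eq_0_iff_AE) auto
    then show ?case using f by (auto simp: L2_eq_def sq_integrable_zero)
  qed
  show "norm f = sqrt (f \<bullet> f)" by (rule norm_L2_def)
qed

end

text \<open>
  \<^term>\<open>L2_on \<Omega>\<close> is the space L2(\<open>\<Omega>\<close>), realised isometrically as the closed subspace of those
  classes on the whole space that vanish almost everywhere outside \<open>\<Omega>\<close> (extension by zero).
\<close>

definition L2_on :: "(real^'n) set \<Rightarrow> 'n L2 set" where
  "L2_on \<Omega> = {u. AE x in lebesgue. x \<notin> \<Omega> \<longrightarrow> rep_L2 u x = 0}"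


section \<open>Smooth functions and domains of class C2\<close>

definition pd :: "'n \<Rightarrow> (real^'n \<Rightarrow> real) \<Rightarrow> real^'n \<Rightarrow> real" where
  "pd i f x = frechet_derivative f (at x) (axis i 1)"

primrec Ck :: "nat \<Rightarrow> (real^'n \<Rightarrow> real) \<Rightarrow> bool" where
  "Ck 0 f \<longleftrightarrow> continuous_on UNIV f"
| "Ck (Suc k) f \<longleftrightarrow> f differentiable_on UNIV \<and> (\<forall>i. Ck k (pd i f))"

definition test_fun :: "(real^'n) set \<Rightarrow> (real^'n \<Rightarrow> real) \<Rightarrow> bool" where
  "test_fun \<Omega> \<phi> \<longleftrightarrow>
     (\<forall>k. Ck k \<phi>) \<and> compact (closure {x. \<phi> x \<noteq> 0}) \<and> closure {x. \<phi> x \<noteq> 0} \<subseteq> \<Omega>"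

text \<open>
  Near each boundary point, after relabelling and reorienting the coordinate axes, \<open>\<Omega>\<close> lies above
  the graph of a C2 function of the remaining coordinates. The graph function \<open>g\<close> is written
  as a function on the whole space that does not depend on the distinguished coordinate \<open>i\<close>.
\<close>

definition C2_boundary :: "(real^'n) set \<Rightarrow> bool" where
  "C2_boundary \<Omega> \<longleftrightarrow>
     (\<forall>p\<in>frontier \<Omega>. \<exists>r>0. \<exists>i. \<exists>\<sigma>\<in>{1, -1::real}. \<exists>g.
        Ck 2 g \<and> (\<forall>x h. g (x + h *\<^sub>R axis i 1) = g x) \<and>
        \<Omega> \<inter> ball p r = {x \<in> ball p r. g x < \<sigma> * x $ i})"


section \<open>Sobolev spaces and the Dirichlet Laplacian\<close>

definition L2_of :: "(real^'n \<Rightarrow> real) \<Rightarrow> 'n L2" where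
  "L2_of f = abs_L2 f"

text \<open>\<open>g \<in> L2(\<Omega>)\<close> is the weak partial derivative of \<open>u \<in> L2(\<Omega>)\<close> in the open set \<open>\<Omega>\<close>.\<close>

definition has_weak_pd :: "(real^'n) set \<Rightarrow> 'n \<Rightarrow> 'n L2 \<Rightarrow> 'n L2 \<Rightarrow> bool" where
  "has_weak_pd \<Omega> i u g \<longleftrightarrow> u \<in> L2_on \<Omega> \<and> g \<in> L2_on \<Omega> \<and>
     (\<forall>\<phi>. test_fun \<Omega> \<phi> \<longrightarrow> u \<bullet> L2_of (pd i \<phi>) = - (g \<bullet> L2_of \<phi>))"

definition weak_pd :: "(real^'n) set \<Rightarrow> 'n \<Rightarrow> 'n L2 \<Rightarrow> 'n L2" where
  "weak_pd \<Omega> i u = (THE g. has_weak_pd \<Omega> i u g)"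

definition Sobolev_H1 :: "(real^'n) set \<Rightarrow> 'n L2 set" where
  "Sobolev_H1 \<Omega> = {u \<in> L2_on \<Omega>. \<forall>i. \<exists>g. has_weak_pd \<Omega> i u g}"

definition Sobolev_H2 :: "(real^'n) set \<Rightarrow> 'n L2 set" where
  "Sobolev_H2 \<Omega> = {u \<in> Sobolev_H1 \<Omega>. \<forall>i. weak_pd \<Omega> i u \<in> Sobolev_H1 \<Omega>}"

definition H1_norm :: "(real^'n) set \<Rightarrow> 'n L2 \<Rightarrow> real" where
  "H1_norm \<Omega> u = sqrt ((norm u)\<^sup>2 + (\<Sum>i\<in>UNIV. (norm (weak_pd \<Omega> i u))\<^sup>2))"

definition Sobolev_H10 :: "(real^'n) set \<Rightarrow> 'n L2 set" where
  "Sobolev_H10 \<Omega> =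
     {u \<in> Sobolev_H1 \<Omega>. \<forall>\<epsilon>>0. \<exists>\<phi>. test_fun \<Omega> \<phi> \<and> H1_norm \<Omega> (u - L2_of \<phi>) < \<epsilon>}"

text \<open>
  A (possibly unbounded) operator is its domain together with its action; the values of the
  action outside the domain are irrelevant.
\<close>

type_synonym 'h lop = "'h set \<times> ('h \<Rightarrow> 'h)"

abbreviation dom_op :: "'h lop \<Rightarrow> 'h set" where "dom_op A \<equiv> fst A"
abbreviation app_op :: "'h lop \<Rightarrow> 'h \<Rightarrow> 'h" where "app_op A \<equiv> snd A"

definition dirichlet_laplacian :: "(real^'n) set \<Rightarrow> 'n L2 lop" where
  "dirichlet_laplacian \<Omega> =
     (Sobolev_H10 \<Omega> \<inter> Sobolev_H2 \<Omega>, \<lambda>u. - (\<Sum>i\<in>UNIV. weak_pd \<Omega> i (weak_pd \<Omega> i u)))"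


section \<open>Self-adjoint operators on a subspace X of an inner product space\<close>

definition linear_op_on :: "'h::real_inner set \<Rightarrow> 'h lop \<Rightarrow> bool" where
  "linear_op_on X A \<longleftrightarrow> subspace (dom_op A) \<and> dom_op A \<subseteq> X \<and> app_op A ` dom_op A \<subseteq> X \<and>
     (\<forall>x\<in>dom_op A. \<forall>y\<in>dom_op A. app_op A (x + y) = app_op A x + app_op A y) \<and>
     (\<forall>r. \<forall>x\<in>dom_op A. app_op A (r *\<^sub>R x) = r *\<^sub>R app_op A x)"

text \<open>Densely defined and equal to its adjoint, including equality of the domains.\<close>

definition self_adjoint_on :: "'h::real_inner set \<Rightarrow> 'h lop \<Rightarrow> bool" where
  "self_adjoint_on X A \<longleftrightarrow> linear_op_on X A \<and> X \<subseteq> closure (dom_op A) \<and>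
     (\<forall>y\<in>X. \<forall>z\<in>X. (\<forall>x\<in>dom_op A. app_op A x \<bullet> y = x \<bullet> z) \<longleftrightarrow> (y \<in> dom_op A \<and> z = app_op A y))"

definition positive_op :: "'h::real_inner lop \<Rightarrow> bool" where
  "positive_op A \<longleftrightarrow> (\<forall>x\<in>dom_op A. x \<noteq> 0 \<longrightarrow> 0 < app_op A x \<bullet> x)"

definition compact_resolvent_on :: "'h::real_inner set \<Rightarrow> 'h lop \<Rightarrow> bool" where
  "compact_resolvent_on X A \<longleftrightarrow> (\<exists>\<mu>::real.
     bij_betw (\<lambda>x. app_op A x - \<mu> *\<^sub>R x) (dom_op A) X \<and>
     (\<forall>B. B \<subseteq> X \<and> bounded B \<longrightarrow>
        compact (closure (inv_into (dom_op A) (\<lambda>x. app_op A x - \<mu> *\<^sub>R x) ` B))))"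

text \<open>
  The square root of a positive self-adjoint \<open>A\<close>: the (unique) positive self-adjoint \<open>S\<close> with
  \<open>S \<circ> S = A\<close>, where \<open>D(S \<circ> S) = {x \<in> D(S). S x \<in> D(S)}\<close>. Uniqueness is that of the domain and
  of the action on the domain.
\<close>

definition op_sqrt :: "'h::real_inner set \<Rightarrow> 'h lop \<Rightarrow> 'h lop" where
  "op_sqrt X A = (SOME S. self_adjoint_on X S \<and> positive_op S \<and>
     dom_op A = {x \<in> dom_op S. app_op S x \<in> dom_op S} \<and>
     (\<forall>x\<in>dom_op A. app_op S (app_op S x) = app_op A x))"


section \<open>C0-groups and their generators\<close>

text \<open>
  Here \<open>X\<close> is a linear subspace of the ambient type, carrying its own norm \<open>N\<close>, which need not be
  the norm of the type. All limits are taken with respect to \<open>N\<close>.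
\<close>

definition C0_group_on :: "'v::real_vector set \<Rightarrow> ('v \<Rightarrow> real) \<Rightarrow> (real \<Rightarrow> 'v \<Rightarrow> 'v) \<Rightarrow> bool" where
  "C0_group_on X N T \<longleftrightarrow>
     (\<forall>t. T t ` X \<subseteq> X \<and>
        (\<forall>x\<in>X. \<forall>y\<in>X. T t (x + y) = T t x + T t y) \<and>
        (\<forall>r. \<forall>x\<in>X. T t (r *\<^sub>R x) = r *\<^sub>R T t x) \<and>
        (\<exists>K. \<forall>x\<in>X. N (T t x) \<le> K * N x)) \<and>
     (\<forall>x\<in>X. T 0 x = x) \<and>
     (\<forall>s t. \<forall>x\<in>X. T (s + t) x = T s (T t x)) \<and>
     (\<forall>x\<in>X. ((\<lambda>t. N (T t x - x)) \<longlongrightarrow> 0) (at 0))"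

definition generates_C0_group ::
  "'v::real_vector set \<Rightarrow> ('v \<Rightarrow> real) \<Rightarrow> 'v lop \<Rightarrow> (real \<Rightarrow> 'v \<Rightarrow> 'v) \<Rightarrow> bool" where
  "generates_C0_group X N G T \<longleftrightarrow> C0_group_on X N T \<and>
     dom_op G \<subseteq> X \<and> app_op G ` dom_op G \<subseteq> X \<and>
     (\<forall>x\<in>X. \<forall>y\<in>X. ((\<lambda>h. N ((1 / h) *\<^sub>R (T h x - x) - y)) \<longlongrightarrow> 0) (at 0) \<longleftrightarrow>
        (x \<in> dom_op G \<and> y = app_op G x))"

text \<open>The analogue of \<^const>\<open>onorm\<close> for \<open>(X, N)\<close>; meaningful for operators bounded w.r.t. \<open>N\<close>.\<close>

definition opnorm_on :: "'v set \<Rightarrow> ('v \<Rightarrow> real) \<Rightarrow> ('v \<Rightarrow> 'v) \<Rightarrow> real" where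
  "opnorm_on X N f = (SUP x\<in>X. N (f x) / N x)"


section \<open>The third-order equation as a first-order system\<close>

definition b_coeff :: "real \<Rightarrow> real \<Rightarrow> real \<Rightarrow> real" where
  "b_coeff c \<delta> \<tau> = \<delta> + \<tau> * c\<^sup>2"

definition gamma_coeff :: "real \<Rightarrow> real \<Rightarrow> real \<Rightarrow> real \<Rightarrow> real" where
  "gamma_coeff \<alpha> c \<delta> \<tau> = \<alpha> - c\<^sup>2 * \<tau> * inverse (b_coeff c \<delta> \<tau>)"

definition phase_space :: "'h::real_inner set \<Rightarrow> 'h lop \<Rightarrow> ('h \<times> 'h \<times> 'h) set" where
  "phase_space X A = dom_op A \<times> dom_op (op_sqrt X A) \<times> X"

definition phase_norm_tau :: "'h::real_inner set \<Rightarrow> 'h lop \<Rightarrow> real \<Rightarrow> 'h \<times> 'h \<times> 'h \<Rightarrow> real" where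
  "phase_norm_tau X A \<tau> = (\<lambda>(u, v, w).
     sqrt ((norm (app_op A u))\<^sup>2 + (norm (app_op (op_sqrt X A) v))\<^sup>2 + \<tau> * (norm w)\<^sup>2))"

definition phase_norm :: "'h::real_inner set \<Rightarrow> 'h lop \<Rightarrow> 'h \<times> 'h \<times> 'h \<Rightarrow> real" where
  "phase_norm X A = (\<lambda>(u, v, w).
     sqrt ((norm (app_op A u))\<^sup>2 + (norm (app_op (op_sqrt X A) v))\<^sup>2 + (norm w)\<^sup>2))"

definition MGT_op ::
  "'h::real_inner set \<Rightarrow> 'h lop \<Rightarrow> real \<Rightarrow> real \<Rightarrow> real \<Rightarrow> real \<Rightarrow> ('h \<times> 'h \<times> 'h) lop" where
  "MGT_op X A \<alpha> c \<delta> \<tau> =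
     (dom_op A \<times> dom_op A \<times> dom_op (op_sqrt X A),
      \<lambda>(u, v, w). (v, w,
        - ((1 / \<tau>) *\<^sub>R app_op A (c\<^sup>2 *\<^sub>R u + b_coeff c \<delta> \<tau> *\<^sub>R v)) - (1 / \<tau>) *\<^sub>R \<alpha> *\<^sub>R w))"

end

theory Submission
  imports Defs
begin

text \<open>
  Since \<open>A\<close> has compact resolvent, it has an orthonormal basis of eigenvectors with eigenvalues bounded
  away from zero, and its positive square root is diagonal in the same basis. The first-order system
  thus splits into independent linear systems in dimension three, one for each eigenvalue \<open>s\<^sup>2\<close>, and the
  phase space is the square-summable direct sum of these. The generator acts on a mode as \<open>s\<close> times a matrix
  that is skew for a norm independent of \<open>s\<close>, plus a bounded matrix independent of \<open>s\<close>; hence the matrix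
  exponentials are bounded uniformly in \<open>s\<close> on bounded time intervals, and they assemble to a group.
  Conversely, the coordinates of any group with this generator solve the mode equations, so the
  decay follows from a quadratic Lyapunov function on each mode whose constants depend neither on \<open>s\<close>
  nor on \<open>\<tau> \<le> 1\<close>.
\<close>

section \<open>Orthonormal expansions in a closed subspace\<close>

text \<open>Two features of the statement shape the argument. Strict positivity of \<open>A\<close>
  gives no lower bound on its spectrum, while a uniform rate needs one: the gap is extracted from
  the compact resolvent, and it bounds \<open>1 / s\<close> in the Lyapunov function and makes the
  mode coordinates fill all square-summable families. Moreover, decay is claimed for every family of
  groups with the given generators, so one well-behaved construction is not enough: the generator
  has to determine the coordinates of the group. The two estimates on a mode cannot replace each
  other. The growth estimate covers both time directions, with constants uniform in \<open>s\<close>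
  for fixed \<open>\<tau>\<close> that blow up as \<open>\<tau>\<close> tends to 0; it yields
  existence and uniqueness. The decay estimate covers \<open>t \<ge> 0\<close>, with constants drawn
  from \<open>\<delta>\<close>, from \<open>b \<le> \<delta> + c\<^sup>2\<close> for
  \<open>\<tau> \<le> 1\<close>, from the spectral gap and from \<open>\<gamma>0\<close>. The square
  root of \<open>A\<close> enters only through a choice, so its action on the eigenvectors has to be
  derived as well.\<close>

definition orthonormal :: "'h::real_inner set \<Rightarrow> bool" where
  "orthonormal E \<longleftrightarrow> (\<forall>e\<in>E. norm e = 1) \<and> pairwise orthogonal E"

text \<open>Totality is tested inside \<open>X\<close> only, because the ambient type is larger:
  classes of functions on the whole space against those vanishing outside a domain.\<close>

definition orthonormal_basis_of :: "'h::real_inner set \<Rightarrow> 'h set \<Rightarrow> bool" where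
  "orthonormal_basis_of X E \<longleftrightarrow> orthonormal E \<and> E \<subseteq> X \<and> (\<forall>x\<in>X. (\<forall>e\<in>E. x \<bullet> e = 0) \<longrightarrow> x = 0)"

lemma orthonormal_inner:
  assumes "orthonormal E" "e \<in> E" "f \<in> E"
  shows "e \<bullet> f = (if e = f then 1 else 0)"
  using assms by (auto simp: orthonormal_def pairwise_def orthogonal_def norm_eq_1)

lemma inner_orthonormal_sum:
  assumes "orthonormal E" "finite F" "F \<subseteq> E" "e \<in> E"
  shows "(\<Sum>f\<in>F. a f *\<^sub>R f) \<bullet> e = (if e \<in> F then a e else 0)"
proof -
  have "(\<Sum>f\<in>F. a f *\<^sub>R f) \<bullet> e = (\<Sum>f\<in>F. if f = e then a f else 0)"
    unfolding inner_sum_left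
    by (intro sum.cong refl) (use assms orthonormal_inner in \<open>force simp: subset_iff\<close>)
  then show ?thesis using assms by simp
qed

lemma norm_orthonormal_sum:
  assumes "orthonormal E" "finite F" "F \<subseteq> E"
  shows "(norm (\<Sum>e\<in>F. a e *\<^sub>R e))\<^sup>2 = (\<Sum>e\<in>F. (a e)\<^sup>2)"
proof -
  have "(norm (\<Sum>e\<in>F. a e *\<^sub>R e))\<^sup>2 = (\<Sum>e\<in>F. (\<Sum>f\<in>F. a f *\<^sub>R f) \<bullet> (a e *\<^sub>R e))"
    by (simp add: power2_norm_eq_inner inner_sum_right)
  also have "\<dots> = (\<Sum>e\<in>F. (a e)\<^sup>2)"
    by (intro sum.cong refl)
      (use assms in \<open>auto simp: inner_orthonormal_sum[OF assms] power2_eq_square subset_iff\<close>)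
  finally show ?thesis .
qed

text \<open>By Pythagoras the squared distance between partial sums over nested finite sets is a
  finite sum of the \<open>(a e)\<^sup>2\<close>, so the net of finite partial sums is Cauchy. The
  tolerance is therefore squared in \<open>d\<close>.\<close>

lemma orthonormal_summable:
  fixes E :: "'h::{real_inner,banach} set"
  assumes E: "orthonormal E" and a: "(\<lambda>e. (a e)\<^sup>2) summable_on E"
  shows "(\<lambda>e. a e *\<^sub>R e) summable_on E"
proof -
  let ?s = "\<lambda>F. \<Sum>e\<in>F. a e *\<^sub>R e"
  obtain L where L: "((\<lambda>e. (a e)\<^sup>2) has_sum L) E"
    using a by (auto simp: summable_on_def)
  have "\<exists>P. eventually P (finite_subsets_at_top E) \<and>
          (\<forall>F F'. P F \<and> P F' \<longrightarrow> dist (?s F) (?s F') < \<epsilon>)" if "\<epsilon> > 0" for \<epsilon>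
  proof -
    define d where "d = (\<epsilon> / 2)\<^sup>2"
    have d: "d > 0" using that by (simp add: d_def)
    then have "\<forall>\<^sub>F F in finite_subsets_at_top E. dist (\<Sum>e\<in>F. (a e)\<^sup>2) L < d / 2"
      using L unfolding has_sum_def tendsto_iff by (meson half_gt_zero)
    then obtain F0 where F0: "finite F0" "F0 \<subseteq> E"
      and near: "\<forall>F. finite F \<and> F0 \<subseteq> F \<and> F \<subseteq> E \<longrightarrow> dist (\<Sum>e\<in>F. (a e)\<^sup>2) L < d / 2"
      unfolding eventually_finite_subsets_at_top by auto
    define P where "P F \<longleftrightarrow> finite F \<and> F0 \<subseteq> F \<and> F \<subseteq> E" for F
    have "eventually P (finite_subsets_at_top E)"
      unfolding eventually_finite_subsets_at_top P_def using F0 by blast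
    moreover have close: "dist (?s F) (?s F0) < \<epsilon> / 2" if "P F" for F
    proof -
      have F: "finite F" "F0 \<subseteq> F" "F \<subseteq> E" using that by (auto simp: P_def)
      have "(dist (?s F) (?s F0))\<^sup>2 = (norm (?s (F - F0)))\<^sup>2"
        unfolding dist_norm using F by (subst sum_diff) auto
      also have "\<dots> = (\<Sum>e\<in>F - F0. (a e)\<^sup>2)"
        using F by (intro norm_orthonormal_sum[OF E]) auto
      also have "\<dots> = (\<Sum>e\<in>F. (a e)\<^sup>2) - (\<Sum>e\<in>F0. (a e)\<^sup>2)"
        using F by (subst sum_diff) auto
      also have "\<dots> < d"
        using near[rule_format, OF conjI[OF F(1) conjI[OF F(2,3)]]]
          near[rule_format, OF conjI[OF F0(1) conjI[OF order_refl F0(2)]]]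
        unfolding dist_real_def by linarith
      finally show ?thesis
        unfolding d_def by (rule power_less_imp_less_base) (use \<open>\<epsilon> > 0\<close> in simp)
    qed
    moreover have "dist (?s F) (?s F') < \<epsilon>" if "P F \<and> P F'" for F F'
      using dist_triangle2[of "?s F" "?s F'" "?s F0"] close[of F] close[of F'] that by linarith
    ultimately show ?thesis by blast
  qed
  then have "cauchy_filter (filtermap ?s (finite_subsets_at_top E))"
    by (simp add: cauchy_filter_metric_filtermap)
  moreover have "complete (UNIV :: 'h set)"
    by (rule complete_UNIV)
  ultimately obtain L' where "(?s \<longlongrightarrow> L') (finite_subsets_at_top E)"
    using complete_uniform[where S=UNIV] by (force simp add: filterlim_def)
  then show ?thesis
    using summable_on_def has_sum_def by blast
qed

lemma inner_orthonormal_has_sum: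
  assumes "orthonormal E" "((\<lambda>e. a e *\<^sub>R e) has_sum x) E" "f \<in> E"
  shows "x \<bullet> f = a f"
proof -
  have "((\<lambda>e. (a e *\<^sub>R e) \<bullet> f) has_sum (x \<bullet> f)) E"
    by (rule has_sum_bounded_linear[OF bounded_linear_inner_left assms(2)])
  moreover have "((\<lambda>e. (a e *\<^sub>R e) \<bullet> f) has_sum a f) E"
  proof -
    have "((\<lambda>e. a e * (e \<bullet> f)) has_sum (\<Sum>e\<in>{f}. a e * (e \<bullet> f))) E"
      using assms by (intro has_sum_finite_neutralI[where B="{f}"]) (auto simp: orthonormal_inner)
    then show ?thesis using assms by (simp add: orthonormal_inner)
  qed
  ultimately show ?thesis using has_sum_unique by blast
qed

lemma bessel:
  assumes E: "orthonormal E"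
  shows "(\<lambda>e. (x \<bullet> e)\<^sup>2) summable_on E"
proof (rule nonneg_bdd_above_summable_on)
  have "(\<Sum>e\<in>F. (x \<bullet> e)\<^sup>2) \<le> (norm x)\<^sup>2" if F: "finite F" "F \<subseteq> E" for F
  proof -
    let ?p = "\<Sum>e\<in>F. (x \<bullet> e) *\<^sub>R e"
    have "0 \<le> (norm (x - ?p))\<^sup>2" by simp
    also have "\<dots> = (norm x)\<^sup>2 - 2 * (x \<bullet> ?p) + (norm ?p)\<^sup>2"
      by (simp add: power2_norm_eq_inner inner_diff_left inner_diff_right inner_commute)
    also have "x \<bullet> ?p = (\<Sum>e\<in>F. (x \<bullet> e)\<^sup>2)"
      by (simp add: inner_sum_right power2_eq_square)
    finally show ?thesis using norm_orthonormal_sum[OF E F] by simp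
  qed
  then show "bdd_above (sum (\<lambda>e. (x \<bullet> e)\<^sup>2) ` {F. F \<subseteq> E \<and> finite F})"
    by (intro bdd_aboveI2) auto
qed auto

section \<open>Expansions relative to a basis of a closed subspace\<close>

context
  fixes X E :: "'h::{real_inner,banach} set"
  assumes X: "subspace X" "closed X" and E: "orthonormal_basis_of X E"
begin

lemma basis_orthonormal: "orthonormal E" and basis_subset: "E \<subseteq> X"
  and basis_total: "\<And>x. x \<in> X \<Longrightarrow> (\<And>e. e \<in> E \<Longrightarrow> x \<bullet> e = 0) \<Longrightarrow> x = 0"
  using E by (auto simp: orthonormal_basis_of_def)

lemma basis_eqI:
  assumes "x \<in> X" "y \<in> X" "\<And>e. e \<in> E \<Longrightarrow> x \<bullet> e = y \<bullet> e"
  shows "x = y"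
  using basis_total[of "x - y"] X assms by (auto simp: subspace_diff inner_diff_left)

lemma has_sum_in_X:
  assumes "((\<lambda>e. a e *\<^sub>R e) has_sum x) E"
  shows "x \<in> X"
proof (rule Lim_in_closed_set[OF X(2)])
  show "((\<lambda>F. \<Sum>e\<in>F. a e *\<^sub>R e) \<longlongrightarrow> x) (finite_subsets_at_top E)"
    using assms by (simp add: has_sum_def)
  show "\<forall>\<^sub>F F in finite_subsets_at_top E. (\<Sum>e\<in>F. a e *\<^sub>R e) \<in> X"
    using basis_subset by (intro eventually_finite_subsets_at_top_weakI)
      (auto intro!: subspace_sum subspace_scale X)
qed simp

text \<open>Bessel makes the series converge to some \<open>y\<close>, which stays in the closed
  \<open>X\<close>; it has the coefficients of \<open>x\<close>, and totality identifies the
  two.\<close>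

lemma basis_has_sum:
  assumes "x \<in> X"
  shows "((\<lambda>e. (x \<bullet> e) *\<^sub>R e) has_sum x) E"
proof -
  obtain y where y: "((\<lambda>e. (x \<bullet> e) *\<^sub>R e) has_sum y) E"
    using orthonormal_summable[OF basis_orthonormal bessel[OF basis_orthonormal, of x]] by (auto simp: summable_on_def)
  have "y = x"
    using inner_orthonormal_has_sum[OF basis_orthonormal y] has_sum_in_X[OF y] assms by (intro basis_eqI) auto
  then show ?thesis using y by simp
qed

lemma parseval_inner:
  assumes "x \<in> X"
  shows "((\<lambda>e. (x \<bullet> e) * (y \<bullet> e)) has_sum (x \<bullet> y)) E"
  using has_sum_bounded_linear[OF bounded_linear_inner_left[of y] basis_has_sum[OF assms]]
  by (simp add: inner_commute)

lemma parseval: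
  assumes "x \<in> X"
  shows "((\<lambda>e. (x \<bullet> e)\<^sup>2) has_sum (norm x)\<^sup>2) E"
  using parseval_inner[OF assms, of x] unfolding power2_norm_eq_inner by (simp only: power2_eq_square)

lemma riesz_fischer:
  assumes "(\<lambda>e. (a e)\<^sup>2) summable_on E"
  shows "\<exists>x\<in>X. \<forall>e\<in>E. x \<bullet> e = a e"
proof -
  obtain x where x: "((\<lambda>e. a e *\<^sub>R e) has_sum x) E"
    using orthonormal_summable[OF basis_orthonormal assms] by (auto simp: summable_on_def)
  show ?thesis
    using has_sum_in_X[OF x] inner_orthonormal_has_sum[OF basis_orthonormal x] by blast
qed

section \<open>Diagonal operators\<close>

text \<open>The graph of multiplication by \<open>m\<close> in the basis, with maximal domain. On
  graphs, an identity between unbounded operators that includes their domains is a plain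
  equivalence.\<close>

definition diag_rel :: "('h \<Rightarrow> real) \<Rightarrow> 'h \<Rightarrow> 'h \<Rightarrow> bool" where
  "diag_rel m x y \<longleftrightarrow> x \<in> X \<and> y \<in> X \<and> (\<forall>e\<in>E. y \<bullet> e = m e * (x \<bullet> e))"

definition diag_op :: "('h \<Rightarrow> real) \<Rightarrow> 'h lop" where
  "diag_op m = ({x. \<exists>y. diag_rel m x y}, \<lambda>x. THE y. diag_rel m x y)"

lemma diag_rel_unique: "diag_rel m x y \<Longrightarrow> diag_rel m x z \<Longrightarrow> y = z"
  unfolding diag_rel_def by (intro basis_eqI) auto

lemma diag_rel_iff: "diag_rel m x y \<longleftrightarrow> x \<in> dom_op (diag_op m) \<and> y = app_op (diag_op m) x"
proof -
  have "(THE y. diag_rel m x y) = y" if "diag_rel m x y" for y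
    using that diag_rel_unique by blast
  then show ?thesis by (auto simp: diag_op_def)
qed

lemma diag_rel_iff_summable:
  "(\<exists>y. diag_rel m x y) \<longleftrightarrow> x \<in> X \<and> (\<lambda>e. (m e * (x \<bullet> e))\<^sup>2) summable_on E"
proof
  assume "\<exists>y. diag_rel m x y"
  then obtain y where y: "x \<in> X" "y \<in> X" "\<forall>e\<in>E. y \<bullet> e = m e * (x \<bullet> e)"
    by (auto simp: diag_rel_def)
  show "x \<in> X \<and> (\<lambda>e. (m e * (x \<bullet> e))\<^sup>2) summable_on E"
    using bessel[OF basis_orthonormal, of y] y by (auto cong: summable_on_cong)
next
  assume "x \<in> X \<and> (\<lambda>e. (m e * (x \<bullet> e))\<^sup>2) summable_on E"
  then show "\<exists>y. diag_rel m x y"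
    using riesz_fischer[of "\<lambda>e. m e * (x \<bullet> e)"] by (auto simp: diag_rel_def)
qed

lemma diag_rel_add: "diag_rel m x y \<Longrightarrow> diag_rel m x' y' \<Longrightarrow> diag_rel m (x + x') (y + y')"
  by (auto simp: diag_rel_def inner_add_left algebra_simps intro!: subspace_add X)

lemma diag_rel_scale: "diag_rel m x y \<Longrightarrow> diag_rel m (r *\<^sub>R x) (r *\<^sub>R y)"
  by (auto simp: diag_rel_def intro!: subspace_scale X)

lemma diag_rel_zero: "diag_rel m 0 0"
  using X by (auto simp: diag_rel_def subspace_0)

lemma diag_rel_basis: "e \<in> E \<Longrightarrow> diag_rel m e (m e *\<^sub>R e)"
  using basis_subset by (auto simp: diag_rel_def orthonormal_inner[OF basis_orthonormal] intro!: subspace_scale X)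

lemma diag_rel_symmetric:
  assumes "diag_rel m x y" "diag_rel m x' y'"
  shows "y \<bullet> x' = x \<bullet> y'"
proof -
  have "((\<lambda>e. (y \<bullet> e) * (x' \<bullet> e)) has_sum (y \<bullet> x')) E" "((\<lambda>e. (x \<bullet> e) * (y' \<bullet> e)) has_sum (x \<bullet> y')) E"
    using assms by (auto simp: diag_rel_def intro!: parseval_inner)
  moreover have "(y \<bullet> e) * (x' \<bullet> e) = (x \<bullet> e) * (y' \<bullet> e)" if "e \<in> E" for e
    using assms that by (simp add: diag_rel_def)
  ultimately show ?thesis
    by (metis (no_types, lifting) has_sum_cong has_sum_unique)
qed

text \<open>Finite combinations of basis vectors lie in the domain and are dense. Testing the
  adjoint identity with basis vectors alone already forces the coefficients of \<open>z\<close> to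
  be \<open>m e\<close> times those of \<open>y\<close>; Parseval gives the converse.\<close>

lemma self_adjoint_diag_op: "self_adjoint_on X (diag_op m)"
  unfolding self_adjoint_on_def
proof (intro conjI ballI)
  have app: "diag_rel m x (app_op (diag_op m) x)" if "x \<in> dom_op (diag_op m)" for x
    using that diag_rel_iff by blast
  have sub: "subspace (dom_op (diag_op m))"
    by (rule subspaceI) (auto simp: diag_op_def intro: diag_rel_zero diag_rel_add diag_rel_scale)
  then show "linear_op_on X (diag_op m)"
    unfolding linear_op_on_def
  proof (intro conjI ballI allI)
    show "dom_op (diag_op m) \<subseteq> X" "app_op (diag_op m) ` dom_op (diag_op m) \<subseteq> X"
      using app by (auto simp: diag_rel_def)
    show "app_op (diag_op m) (x + y) = app_op (diag_op m) x + app_op (diag_op m) y"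
      if "x \<in> dom_op (diag_op m)" "y \<in> dom_op (diag_op m)" for x y
      using diag_rel_add[OF app[OF that(1)] app[OF that(2)]] diag_rel_iff by simp
    show "app_op (diag_op m) (r *\<^sub>R x) = r *\<^sub>R app_op (diag_op m) x"
      if "x \<in> dom_op (diag_op m)" for r x
      using diag_rel_scale[OF app[OF that]] diag_rel_iff by simp
  qed
  show "X \<subseteq> closure (dom_op (diag_op m))"
  proof
    fix x assume x: "x \<in> X"
    show "x \<in> closure (dom_op (diag_op m))"
      unfolding closure_approachable
    proof (intro allI impI)
      fix \<epsilon> :: real assume "\<epsilon> > 0"
      then obtain F where F: "finite F" "F \<subseteq> E" "dist (\<Sum>e\<in>F. (x \<bullet> e) *\<^sub>R e) x \<le> \<epsilon> / 2"
        using has_sum_finite_approximation[OF basis_has_sum[OF x], of "\<epsilon> / 2"] by auto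
      have "E \<subseteq> dom_op (diag_op m)"
        using diag_rel_basis by (auto simp: diag_op_def)
      then have "(\<Sum>e\<in>F. (x \<bullet> e) *\<^sub>R e) \<in> dom_op (diag_op m)"
        using F by (intro subspace_sum[OF sub] subspace_scale[OF sub]) auto
      then show "\<exists>y\<in>dom_op (diag_op m). dist y x < \<epsilon>"
        using F \<open>\<epsilon> > 0\<close> by force
    qed
  qed
  fix y z assume yz: "y \<in> X" "z \<in> X"
  show "(\<forall>x\<in>dom_op (diag_op m). app_op (diag_op m) x \<bullet> y = x \<bullet> z) \<longleftrightarrow>
        y \<in> dom_op (diag_op m) \<and> z = app_op (diag_op m) y" (is "?l \<longleftrightarrow> ?r")
  proof
    assume ?l
    then have "\<forall>x v. diag_rel m x v \<longrightarrow> v \<bullet> y = x \<bullet> z"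
      by (simp add: diag_rel_iff)
    then have "diag_rel m y z"
      using yz diag_rel_basis unfolding diag_rel_def by (metis inner_commute inner_scaleR_left)
    then show ?r by (simp add: diag_rel_iff)
  next
    assume ?r
    then have "diag_rel m y z" by (simp add: diag_rel_iff)
    then show ?l using app diag_rel_symmetric by blast
  qed
qed

text \<open>Symmetry against the eigenvectors puts the graph of \<open>A\<close> inside that of the
  multiplication operator. The latter is symmetric too, so each of its pairs satisfies the adjoint
  identity on \<open>dom_op A\<close>, and self-adjointness puts the pair back into the graph of
  \<open>A\<close>.\<close>

lemma self_adjoint_eq_diag_rel:
  assumes A: "self_adjoint_on X A"
    and eig: "\<And>e. e \<in> E \<Longrightarrow> e \<in> dom_op A \<and> app_op A e = m e *\<^sub>R e"
  shows "x \<in> dom_op A \<and> y = app_op A x \<longleftrightarrow> diag_rel m x y"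
proof -
  have dom: "x \<in> X \<and> app_op A x \<in> X" if "x \<in> dom_op A" for x
    using A that by (auto simp: self_adjoint_on_def linear_op_on_def)
  have adj: "(\<forall>x\<in>dom_op A. app_op A x \<bullet> y = x \<bullet> z) \<longleftrightarrow> (y \<in> dom_op A \<and> z = app_op A y)"
    if "y \<in> X" "z \<in> X" for y z
    using A that by (auto simp: self_adjoint_on_def)
  have diag: "diag_rel m x (app_op A x)" if x: "x \<in> dom_op A" for x
  proof -
    have "app_op A x \<bullet> e = m e * (x \<bullet> e)" if "e \<in> E" for e
      using adj[of e "app_op A e"] dom[of e] eig[OF that] x by auto
    then show ?thesis using dom[OF x] by (auto simp: diag_rel_def)
  qed
  show ?thesis
  proof
    assume "diag_rel m x y"
    then have "\<forall>v\<in>dom_op A. app_op A v \<bullet> x = v \<bullet> y"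
      using diag diag_rel_symmetric by blast
    then show "x \<in> dom_op A \<and> y = app_op A x"
      using adj \<open>diag_rel m x y\<close> by (auto simp: diag_rel_def)
  qed (use diag in auto)
qed

text \<open>The choice in \<open>op_sqrt\<close> reveals only the defining property. Hence a witness
  is exhibited first, \<open>diag_op\<close> of the roots, and then the chosen operator is pinned
  down: every basis vector is an eigenvector of it, and eigenvectors determine its graph.\<close>

lemma op_sqrt_diag_rel:
  assumes A: "self_adjoint_on X A"
    and eig: "\<And>e. e \<in> E \<Longrightarrow> e \<in> dom_op A \<and> app_op A e = m e *\<^sub>R e"
    and m: "\<And>e. e \<in> E \<Longrightarrow> m e > 0"
  shows "x \<in> dom_op (op_sqrt X A) \<and> y = app_op (op_sqrt X A) x \<longleftrightarrow> diag_rel (\<lambda>e. sqrt (m e)) x y"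
proof -
  define P where "P S \<longleftrightarrow> self_adjoint_on X S \<and> positive_op S \<and>
     dom_op A = {x \<in> dom_op S. app_op S x \<in> dom_op S} \<and>
     (\<forall>x\<in>dom_op A. app_op S (app_op S x) = app_op A x)" for S :: "'h lop"
  let ?s = "\<lambda>e. sqrt (m e)"
  let ?S = "diag_op ?s"
  have Arel: "x \<in> dom_op A \<and> y = app_op A x \<longleftrightarrow> diag_rel m x y" for x y
    by (rule self_adjoint_eq_diag_rel[OF A eig])
  \<comment> \<open>Multiplying twice by \<open>sqrt (m e)\<close> has exactly the domain of
    multiplying by \<open>m e\<close>: the squares of the intermediate coefficients are the products
    \<open>(x \<bullet> e) * (z \<bullet> e)\<close>, summable by Parseval.\<close>
  have comp: "diag_rel m x z \<longleftrightarrow> (\<exists>y. diag_rel ?s x y \<and> diag_rel ?s y z)" for x z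
  proof
    assume xz: "diag_rel m x z"
    then have "(\<lambda>e. (x \<bullet> e) * (z \<bullet> e)) summable_on E"
      using parseval_inner by (auto simp: diag_rel_def summable_on_def)
    moreover have "(x \<bullet> e) * (z \<bullet> e) = (?s e * (x \<bullet> e))\<^sup>2" if "e \<in> E" for e
      using xz m[OF that] that by (simp add: diag_rel_def power2_eq_square algebra_simps)
    ultimately have "(\<lambda>e. (?s e * (x \<bullet> e))\<^sup>2) summable_on E"
      by (simp cong: summable_on_cong)
    then obtain y where y: "diag_rel ?s x y"
      using diag_rel_iff_summable[of ?s x] xz by (auto simp: diag_rel_def)
    have "diag_rel ?s y z"
      using xz y m by (auto simp: diag_rel_def less_imp_le simp flip: mult.assoc)
    then show "\<exists>y. diag_rel ?s x y \<and> diag_rel ?s y z" using y by blast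
  next
    assume "\<exists>y. diag_rel ?s x y \<and> diag_rel ?s y z"
    then show "diag_rel m x z"
      using m by (auto simp: diag_rel_def less_imp_le simp flip: mult.assoc)
  qed
  have "P ?S"
    unfolding P_def
  proof (intro conjI)
    show "self_adjoint_on X ?S" by (rule self_adjoint_diag_op)
    show "positive_op ?S"
      unfolding positive_op_def
    proof (intro ballI impI)
      fix x assume x: "x \<in> dom_op ?S" "x \<noteq> 0"
      let ?y = "app_op ?S x"
      have xy: "diag_rel ?s x ?y" using x diag_rel_iff by blast
      then have X': "x \<in> X" "?y \<in> X" by (auto simp: diag_rel_def)
      have "((\<lambda>e. (?y \<bullet> e) * (x \<bullet> e)) has_sum (?y \<bullet> x)) E"
        by (rule parseval_inner[OF X'(2)])
      moreover have eq: "(?y \<bullet> e) * (x \<bullet> e) = ?s e * (x \<bullet> e)\<^sup>2" if "e \<in> E" for e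
        using xy that by (simp add: diag_rel_def power2_eq_square)
      ultimately have hs: "((\<lambda>e. ?s e * (x \<bullet> e)\<^sup>2) has_sum (?y \<bullet> x)) E"
        by (simp cong: has_sum_cong)
      show "0 < ?y \<bullet> x"
      proof (rule ccontr)
        assume "\<not> 0 < ?y \<bullet> x"
        then have "?s e * (x \<bullet> e)\<^sup>2 = 0" if "e \<in> E" for e
          using nonneg_has_sum_le_0D[OF hs _ _ that] m by (simp add: less_imp_le)
        then have "x \<bullet> e = 0" if "e \<in> E" for e
          using m that by force
        then show False using basis_total X' x by blast
      qed
    qed
    have "x \<in> dom_op A \<longleftrightarrow> (\<exists>y z. diag_rel ?s x y \<and> diag_rel ?s y z)" for x
      using Arel[of x] comp[of x] by blast
    then show "dom_op A = {x \<in> dom_op ?S. app_op ?S x \<in> dom_op ?S}"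
      by (auto simp: diag_rel_iff)
    show "\<forall>x\<in>dom_op A. app_op ?S (app_op ?S x) = app_op A x"
    proof
      fix x assume "x \<in> dom_op A"
      then have "diag_rel m x (app_op A x)" by (simp flip: Arel)
      then obtain y where "diag_rel ?s x y" "diag_rel ?s y (app_op A x)" using comp by blast
      then show "app_op ?S (app_op ?S x) = app_op A x" by (simp add: diag_rel_iff)
    qed
  qed
  then have "P (op_sqrt X A)"
    unfolding op_sqrt_def P_def[symmetric] by (rule someI)
  define S where "S = op_sqrt X A"
  have S: "self_adjoint_on X S" "positive_op S" "dom_op A = {x \<in> dom_op S. app_op S x \<in> dom_op S}"
     "\<And>x. x\<in>dom_op A \<Longrightarrow> app_op S (app_op S x) = app_op A x"
    using \<open>P (op_sqrt X A)\<close> by (auto simp: P_def S_def)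
  have sub: "subspace (dom_op S)" and
    lin: "\<And>x y. x \<in> dom_op S \<Longrightarrow> y \<in> dom_op S \<Longrightarrow> app_op S (x + y) = app_op S x + app_op S y"
    "\<And>r x. x \<in> dom_op S \<Longrightarrow> app_op S (r *\<^sub>R x) = r *\<^sub>R app_op S x"
    using S(1) by (auto simp: self_adjoint_on_def linear_op_on_def)
  have "e \<in> dom_op S \<and> app_op S e = ?s e *\<^sub>R e" if e: "e \<in> E" for e
  proof -
    have eS: "e \<in> dom_op S" "app_op S e \<in> dom_op S" "app_op S (app_op S e) = m e *\<^sub>R e"
      using eig[OF e] S(3,4) by auto
    \<comment> \<open>\<open>0 = (S\<^sup>2 - m) e = (S + sqrt m) f\<close>, so \<open>S f = - sqrt m f\<close> contradicts positivity unless \<open>f = 0\<close>.\<close>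
    define f where "f = app_op S e + (- ?s e) *\<^sub>R e"
    have f: "f \<in> dom_op S"
      unfolding f_def using eS by (intro subspace_add[OF sub] subspace_scale[OF sub])
    have "app_op S f = app_op S (app_op S e) + (- ?s e) *\<^sub>R app_op S e"
      unfolding f_def using eS by (simp only: lin subspace_scale[OF sub])
    also have "\<dots> = (- ?s e) *\<^sub>R f"
      using m[OF e] eS(3) by (simp add: f_def algebra_simps)
    finally have "app_op S f \<bullet> f \<le> 0"
      using m[OF e] by (simp add: less_imp_le)
    then have "f = 0" using S(2) f by (force simp: positive_op_def)
    then show ?thesis using eS by (simp add: f_def)
  qed
  then show ?thesis
    using self_adjoint_eq_diag_rel[OF S(1), of ?s] by (simp add: S_def)
qed

end

section \<open>Self-adjoint operators with compact resolvent\<close>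

text \<open>Compactness is applied to \<open>K (K (x n))\<close> for a sequence of unit vectors
  maximising the norm of \<open>K\<close>. These images approach
  \<open>m\<^sup>2 *\<^sub>R x n\<close>, so a subsequence of \<open>x n\<close> itself converges,
  to a unit eigenvector of the square of \<open>K\<close>.\<close>

lemma compact_symmetric_eigenvector:
  fixes Y :: "'h::{real_inner,banach} set" and K :: "'h \<Rightarrow> 'h"
  assumes Y: "subspace Y" "closed Y" and KY: "K ` Y \<subseteq> Y"
    and add: "\<And>x y. x \<in> Y \<Longrightarrow> y \<in> Y \<Longrightarrow> K (x + y) = K x + K y"
    and scale: "\<And>r x. x \<in> Y \<Longrightarrow> K (r *\<^sub>R x) = r *\<^sub>R K x"
    and sym: "\<And>x y. x \<in> Y \<Longrightarrow> y \<in> Y \<Longrightarrow> K x \<bullet> y = x \<bullet> K y"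
    and comp: "\<And>B. B \<subseteq> Y \<Longrightarrow> bounded B \<Longrightarrow> compact (closure (K ` B))"
    and nz: "x0 \<in> Y" "K x0 \<noteq> 0"
  obtains x \<kappa> where "x \<in> Y" "norm x = 1" "\<kappa> \<noteq> 0" "K x = \<kappa> *\<^sub>R x"
proof -
  let ?S = "{x \<in> Y. norm x = 1}"
  define m where "m = (SUP x\<in>?S. norm (K x))"
  \<comment> \<open>Boundedness of \<open>K\<close> follows from compactness: the image of the unit
    sphere has compact closure.\<close>
  have "bounded ?S" by (rule boundedI[where B=1]) simp
  then have "bounded (K ` ?S)"
    using bounded_subset[OF compact_imp_bounded[OF comp[of ?S]] closure_subset] by blast
  then have bdd: "bdd_above ((\<lambda>x. norm (K x)) ` ?S)"
    by (force simp: bounded_iff bdd_above_def)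
  have unit: "K x = norm x *\<^sub>R K (x /\<^sub>R norm x)" if "x \<in> Y" for x
    using that scale[of "x /\<^sub>R norm x" "norm x"] scale[of x 0] Y
    by (cases "x = 0") (auto simp: subspace_scale)
  have K_le: "norm (K x) \<le> m * norm x" if "x \<in> Y" for x
  proof (cases "x = 0")
    case True
    then show ?thesis using unit[OF that] by simp
  next
    case False
    then have "x /\<^sub>R norm x \<in> ?S" using that Y by (simp add: subspace_scale)
    then have "norm (K (x /\<^sub>R norm x)) \<le> m"
      unfolding m_def by (intro cSUP_upper bdd)
    then have "norm x * norm (K (x /\<^sub>R norm x)) \<le> norm x * m"
      by (intro mult_left_mono) auto
    then show ?thesis using unit[OF that] by (metis norm_scaleR abs_norm_cancel mult.commute)
  qed
  have x0: "x0 \<noteq> 0" using unit[OF nz(1)] nz(2) by auto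
  then have "?S \<noteq> {}" using nz(1) Y by (auto intro!: exI[of _ "x0 /\<^sub>R norm x0"] simp: subspace_scale)
  have "m > 0"
    using K_le[OF nz(1)] nz x0 by (smt (verit) mult_nonpos_nonneg norm_ge_zero norm_eq_zero)
  have "\<exists>x\<in>?S. m - inverse (Suc n) < norm (K x)" for n
    using less_cSUP_iff[OF \<open>?S \<noteq> {}\<close> bdd, of "m - inverse (Suc n)"] unfolding m_def by simp
  then obtain x where x: "\<And>n. x n \<in> ?S" and xm: "\<And>n. m - inverse (Suc n) < norm (K (x n))"
    by metis
  have "x n \<in> Y" "norm (x n) = 1" for n using x[of n] by auto
  note x = this
  have Kx: "K (x n) \<in> Y" "norm (K (x n)) \<le> m" for n
    using x[of n] KY K_le[of "x n"] by auto
  have lim: "(\<lambda>n. norm (K (x n))) \<longlonglongrightarrow> m"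
  proof (rule tendsto_sandwich)
    show "(\<lambda>n. m - inverse (real (Suc n))) \<longlonglongrightarrow> m"
      using tendsto_diff[OF tendsto_const LIMSEQ_inverse_real_of_nat, of m] by simp
    show "(\<lambda>n. m) \<longlonglongrightarrow> m" by simp
  qed (use xm Kx in \<open>auto intro!: always_eventually intro: less_imp_le simp del: of_nat_Suc\<close>)
  \<comment> \<open>The maximising sequence is asymptotically an eigenvector of \<open>K\<^sup>2\<close>; this avoids
    having to show that the numerical radius is the norm.\<close>
  have sq: "(norm (K (K (x n)) - m\<^sup>2 *\<^sub>R x n))\<^sup>2 \<le> m\<^sup>2 * (m\<^sup>2 - (norm (K (x n)))\<^sup>2)" for n
  proof -
    have "(norm (K (K (x n)) - m\<^sup>2 *\<^sub>R x n))\<^sup>2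
        = (norm (K (K (x n))))\<^sup>2 - 2 * m\<^sup>2 * (K (K (x n)) \<bullet> x n) + (m\<^sup>2)\<^sup>2 * (norm (x n))\<^sup>2"
      unfolding power2_norm_eq_inner
      by (simp add: inner_diff_left inner_diff_right inner_commute power2_eq_square algebra_simps)
    also have "K (K (x n)) \<bullet> x n = (norm (K (x n)))\<^sup>2"
      using sym[OF Kx(1) x(1)] by (simp add: power2_norm_eq_inner)
    also have "(norm (K (K (x n))))\<^sup>2 \<le> (m * norm (K (x n)))\<^sup>2"
      using K_le[OF Kx(1)] by (intro power_mono) auto
    finally show ?thesis by (simp add: x power_mult_distrib algebra_simps power2_eq_square)
  qed
  have d: "(\<lambda>n. K (K (x n)) - m\<^sup>2 *\<^sub>R x n) \<longlonglongrightarrow> 0"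
  proof -
    have "(\<lambda>n. m\<^sup>2 * (m\<^sup>2 - (norm (K (x n)))\<^sup>2)) \<longlonglongrightarrow> m\<^sup>2 * (m\<^sup>2 - m\<^sup>2)"
      by (intro tendsto_intros lim)
    then have "(\<lambda>n. m\<^sup>2 * (m\<^sup>2 - (norm (K (x n)))\<^sup>2)) \<longlonglongrightarrow> 0" by simp
    then have "(\<lambda>n. (norm (K (K (x n)) - m\<^sup>2 *\<^sub>R x n))\<^sup>2) \<longlonglongrightarrow> 0"
      by (rule Lim_null_comparison[rotated]) (simp add: sq)
    then have "(\<lambda>n. sqrt ((norm (K (K (x n)) - m\<^sup>2 *\<^sub>R x n))\<^sup>2)) \<longlonglongrightarrow> sqrt 0"
      by (rule tendsto_real_sqrt)
    then show ?thesis by (simp add: tendsto_norm_zero_iff)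
  qed
  have "bounded (range (\<lambda>n. K (x n)))" using Kx by (auto simp: bounded_iff)
  then have cC: "compact (closure (K ` range (\<lambda>n. K (x n))))" (is "compact ?C")
    using Kx by (intro comp) auto
  have "K (K (x n)) \<in> ?C" for n
    using closure_subset by fast
  then obtain z \<phi> where \<phi>: "strict_mono (\<phi> :: nat \<Rightarrow> nat)"
    and "((\<lambda>n. K (K (x n))) \<circ> \<phi>) \<longlonglongrightarrow> z"
    using seq_compactE[OF compact_imp_seq_compact[OF cC], of "\<lambda>n. K (K (x n))"] by metis
  then have z: "(\<lambda>n. K (K (x (\<phi> n)))) \<longlonglongrightarrow> z" by (simp add: comp_def)
  define y where "y = z /\<^sub>R m\<^sup>2"
  have "(\<lambda>n. (K (K (x (\<phi> n))) - (K (K (x (\<phi> n))) - m\<^sup>2 *\<^sub>R x (\<phi> n))) /\<^sub>R m\<^sup>2) \<longlonglongrightarrow> (z - 0) /\<^sub>R m\<^sup>2"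
    using LIMSEQ_subseq_LIMSEQ[OF d \<phi>] by (intro tendsto_intros z) (simp_all add: comp_def)
  then have y: "(\<lambda>n. x (\<phi> n)) \<longlonglongrightarrow> y"
    using \<open>m > 0\<close> by (simp add: y_def)
  have yY: "y \<in> Y"
    using x by (intro Lim_in_closed_set[OF Y(2) _ _ y]) auto
  have ny: "norm y = 1"
    using tendsto_norm[OF y] x LIMSEQ_unique[OF _ tendsto_const] by simp
  have K_diff: "K (u - v) = K u - K v" if "u \<in> Y" "v \<in> Y" for u v
    using add[of u "(-1) *\<^sub>R v"] scale[of v "-1"] that Y by (simp add: subspace_scale subspace_neg)
  have cont: "(\<lambda>n. K (u n)) \<longlonglongrightarrow> K v" if "u \<longlonglongrightarrow> v" "\<And>n. u n \<in> Y" "v \<in> Y" for u v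
  proof -
    have "(\<lambda>n. m * norm (u n - v)) \<longlonglongrightarrow> m * norm (v - v)"
      by (intro tendsto_intros that)
    then have lim0: "(\<lambda>n. m * norm (u n - v)) \<longlonglongrightarrow> 0" by simp
    have "norm (K (u n) - K v) \<le> m * norm (u n - v)" for n
      using K_le[of "u n - v"] K_diff that Y by (simp add: subspace_diff)
    then have "(\<lambda>n. K (u n) - K v) \<longlonglongrightarrow> 0"
      by (intro Lim_null_comparison[OF _ lim0]) simp
    then show ?thesis by (simp add: LIM_zero_iff)
  qed
  have "(\<lambda>n. K (K (x (\<phi> n)))) \<longlonglongrightarrow> K (K y)"
  proof (rule cont)
    show "(\<lambda>n. K (x (\<phi> n))) \<longlonglongrightarrow> K y" by (rule cont[OF y x(1) yY])
    show "K y \<in> Y" using yY KY by blast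
  qed (rule Kx)
  then have "K (K y) = z" by (rule LIMSEQ_unique[OF _ z])
  also have "z = m\<^sup>2 *\<^sub>R y" using \<open>m > 0\<close> by (simp add: y_def)
  finally have KKy: "K (K y) = m\<^sup>2 *\<^sub>R y" .
  \<comment> \<open>\<open>(K - m) (K + m) y = 0\<close>: either \<open>v = (K + m) y\<close> is an
    eigenvector for \<open>m\<close>, or it vanishes and \<open>y\<close> is one for
    \<open>- m\<close>.\<close>
  define v where "v = K y + m *\<^sub>R y"
  have vY: "v \<in> Y" unfolding v_def using yY KY Y by (auto intro: subspace_add subspace_scale)
  have "K v = m\<^sup>2 *\<^sub>R y + m *\<^sub>R K y"
    unfolding v_def using yY KY Y KKy by (subst add) (auto simp: subspace_scale scale)
  then have Kv: "K v = m *\<^sub>R v"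
    by (simp add: v_def scaleR_add_right power2_eq_square add.commute)
  show ?thesis
  proof (cases "v = 0")
    case True
    then have "K y = (- m) *\<^sub>R y" by (simp add: v_def eq_neg_iff_add_eq_0)
    then show ?thesis using that[of y "- m"] yY ny \<open>m > 0\<close> by simp
  next
    case False
    then show ?thesis
      using that[of "v /\<^sub>R norm v" m] vY Kv Y \<open>m > 0\<close> scale[OF vY] by (simp add: subspace_scale mult.commute)
  qed
qed

section \<open>Eigenbasis and spectral gap\<close>

lemma finite_separated_compact:
  fixes S :: "'a::metric_space set"
  assumes "compact C" "S \<subseteq> C" "\<epsilon> > 0"
    and sep: "\<And>x y. x \<in> S \<Longrightarrow> y \<in> S \<Longrightarrow> x \<noteq> y \<Longrightarrow> dist x y \<ge> \<epsilon>"
  shows "finite S"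
proof (rule ccontr)
  assume "infinite S"
  then obtain z where z: "z islimpt S"
    using assms(1,2) Heine_Borel_imp_Bolzano_Weierstrass by blast
  then obtain x where x: "x \<in> S" "x \<noteq> z" "dist x z < \<epsilon> / 2"
    using islimpt_approachable \<open>\<epsilon> > 0\<close> half_gt_zero by metis
  \<comment> \<open>Taking \<open>y\<close> closer to \<open>z\<close> than \<open>x\<close> ensures
    that the two points differ.\<close>
  then obtain y where y: "y \<in> S" "y \<noteq> z" "dist y z < dist x z"
    using z islimpt_approachable by (metis zero_less_dist_iff)
  have "dist x y < \<epsilon>" "x \<noteq> y"
    using dist_triangle2[of x y z] x y by auto
  then show False using sep[OF x(1) y(1)] by simp
qed

text \<open>The inverse \<open>K\<close> of \<open>A - \<mu>\<close> is compact, symmetric and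
  injective. If a maximal orthonormal family of eigenvectors were not total, \<open>K\<close> would
  act on its orthogonal complement in \<open>X\<close> without vanishing there, hence have an
  eigenvector in it; that is an eigenvector of \<open>A\<close> too, against maximality.\<close>

theorem spectral_theorem_compact_resolvent:
  fixes X :: "'h::{real_inner,banach} set" and A :: "'h lop"
  assumes X: "subspace X" "closed X"
    and A: "self_adjoint_on X A" and pos: "positive_op A" and cr: "compact_resolvent_on X A"
  obtains E m l where "orthonormal_basis_of X E" "l > 0"
    "\<And>e. e \<in> E \<Longrightarrow> e \<in> dom_op A \<and> app_op A e = m e *\<^sub>R e" "\<And>e. e \<in> E \<Longrightarrow> m e \<ge> l"
proof -
  obtain \<mu> where bij: "bij_betw (\<lambda>x. app_op A x - \<mu> *\<^sub>R x) (dom_op A) X"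
    and cpt: "\<And>B. B \<subseteq> X \<and> bounded B \<Longrightarrow>
        compact (closure (inv_into (dom_op A) (\<lambda>x. app_op A x - \<mu> *\<^sub>R x) ` B))"
    using cr unfolding compact_resolvent_on_def by blast
  define R where "R = (\<lambda>x. app_op A x - \<mu> *\<^sub>R x)"
  define K where "K = inv_into (dom_op A) R"
  have bij: "bij_betw R (dom_op A) X" and cpt: "\<And>B. B \<subseteq> X \<Longrightarrow> bounded B \<Longrightarrow> compact (closure (K ` B))"
    using bij cpt by (auto simp: R_def K_def)
  have lin: "subspace (dom_op A)" "dom_op A \<subseteq> X" "app_op A ` dom_op A \<subseteq> X"
     "\<And>x y. x \<in> dom_op A \<Longrightarrow> y \<in> dom_op A \<Longrightarrow> app_op A (x + y) = app_op A x + app_op A y"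
     "\<And>r x. x \<in> dom_op A \<Longrightarrow> app_op A (r *\<^sub>R x) = r *\<^sub>R app_op A x"
    using A by (auto simp: self_adjoint_on_def linear_op_on_def)
  have RK: "K x \<in> dom_op A" "R (K x) = x" if "x \<in> X" for x
    using bij that unfolding K_def bij_betw_def by (auto intro: inv_into_into f_inv_into_f)
  have KI: "K x = y" if "y \<in> dom_op A" "R y = x" for x y
    using bij that unfolding K_def bij_betw_def by auto
  have K_add: "K (x + y) = K x + K y" if "x \<in> X" "y \<in> X" for x y
    using RK[OF that(1)] RK[OF that(2)] lin
    by (intro KI) (auto simp: R_def subspace_add algebra_simps)
  have K_scale: "K (r *\<^sub>R x) = r *\<^sub>R K x" if "x \<in> X" for r x
    using RK[OF that] lin by (intro KI) (auto simp: R_def subspace_scale algebra_simps)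
  have A_sym: "app_op A x \<bullet> y = x \<bullet> app_op A y" if "x \<in> dom_op A" "y \<in> dom_op A" for x y
  proof -
    have "y \<in> X" "app_op A y \<in> X" using that lin by auto
    then show ?thesis using A that unfolding self_adjoint_on_def by blast
  qed
  have K_sym: "K x \<bullet> y = x \<bullet> K y" if "x \<in> X" "y \<in> X" for x y
  proof -
    have "K x \<bullet> R (K y) = R (K x) \<bullet> K y"
      using A_sym[OF RK(1)[OF that(1)] RK(1)[OF that(2)]]
      by (simp add: R_def inner_diff_left inner_diff_right)
    then show ?thesis using RK that by simp
  qed
  define eigen where "eigen e \<longleftrightarrow> e \<in> dom_op A \<and> (\<exists>l. app_op A e = l *\<^sub>R e)" for e
  define C where "C = {E. orthonormal E \<and> (\<forall>e\<in>E. eigen e)}"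
  have "\<exists>M\<in>C. \<forall>E\<in>C. M \<subseteq> E \<longrightarrow> E = M"
  proof (rule subset_Zorn')
    fix \<C> assume \<C>: "subset.chain C \<C>"
    have "orthonormal (\<Union>\<C>)"
      unfolding orthonormal_def
    proof (intro conjI ballI pairwiseI)
      show "norm e = 1" if "e \<in> \<Union>\<C>" for e
        using that \<C> by (auto simp: subset.chain_def C_def orthonormal_def)
      fix e f assume "e \<in> \<Union>\<C>" "f \<in> \<Union>\<C>" "e \<noteq> f"
      then obtain U V where UV: "U \<in> \<C>" "e \<in> U" "V \<in> \<C>" "f \<in> V" by blast
      then have "U \<subseteq> V \<or> V \<subseteq> U" using \<C> by (auto simp: subset.chain_def)
      then obtain U where "U \<in> \<C>" "e \<in> U" "f \<in> U" using UV by blast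
      then show "orthogonal e f"
        using \<C> \<open>e \<noteq> f\<close> by (auto simp: subset.chain_def C_def orthonormal_def pairwise_def)
    qed
    then show "\<Union>\<C> \<in> C"
      using \<C> by (auto simp: C_def subset.chain_def)
  qed
  then obtain E where E: "E \<in> C" and maximal: "\<And>E'. E' \<in> C \<Longrightarrow> E \<subseteq> E' \<Longrightarrow> E' = E"
    by blast
  have on: "orthonormal E" and eig: "\<And>e. e \<in> E \<Longrightarrow> eigen e" using E by (auto simp: C_def)
  then obtain m where m: "\<And>e. e \<in> E \<Longrightarrow> app_op A e = m e *\<^sub>R e"
    unfolding eigen_def by metis
  have dom: "e \<in> dom_op A" if "e \<in> E" for e using eig[OF that] by (simp add: eigen_def)
  have EX: "E \<subseteq> X" using dom lin by blast
  have Re: "R e = (m e - \<mu>) *\<^sub>R e" if "e \<in> E" for e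
    using m[OF that] by (simp add: R_def algebra_simps)
  have Ke: "m e \<noteq> \<mu>" "K e = (1 / (m e - \<mu>)) *\<^sub>R e" if e: "e \<in> E" for e
  proof -
    have n: "norm e = 1" using on e by (simp add: orthonormal_def)
    have "R 0 = 0" "0 \<in> dom_op A" using lin(5)[of 0 0] subspace_0[OF lin(1)] by (auto simp: R_def)
    then show "m e \<noteq> \<mu>"
      using Re[OF e] bij n dom[OF e] by (auto simp: bij_betw_def dest!: inj_onD[of _ _ e 0])
    have "R ((1 / (m e - \<mu>)) *\<^sub>R e) = (1 / (m e - \<mu>)) *\<^sub>R R e"
      using lin(5)[OF dom[OF e]] by (simp add: R_def scaleR_diff_right)
    also have "\<dots> = e" using \<open>m e \<noteq> \<mu>\<close> by (simp add: Re[OF e])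
    finally show "K e = (1 / (m e - \<mu>)) *\<^sub>R e"
      using subspace_scale[OF lin(1) dom[OF e]] by (intro KI)
  qed
  have total: "x = 0" if x: "x \<in> X" "\<And>e. e \<in> E \<Longrightarrow> x \<bullet> e = 0" for x
  proof (rule ccontr)
    assume "x \<noteq> 0"
    define Y where "Y = {y \<in> X. \<forall>e\<in>E. y \<bullet> e = 0}"
    have Y: "subspace Y"
      unfolding Y_def by (rule subspaceI)
        (auto simp: subspace_0[OF X(1)] inner_add_left intro: subspace_add[OF X(1)] subspace_scale[OF X(1)])
    have "Y = X \<inter> (\<Inter>e\<in>E. {y. y \<bullet> e = 0})" by (auto simp: Y_def)
    then have Ycl: "closed Y"
      using X(2) by (auto intro!: closed_Int closed_INT closed_Collect_eq continuous_intros)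
    have YX: "Y \<subseteq> X" by (auto simp: Y_def)
    have KY: "K ` Y \<subseteq> Y"
    proof
      fix v assume "v \<in> K ` Y"
      then obtain y where y: "y \<in> Y" "v = K y" by blast
      then have "y \<in> X" by (simp add: Y_def)
      have "K y \<bullet> e = 0" if e: "e \<in> E" for e
        using K_sym[OF \<open>y \<in> X\<close>, of e] Ke[OF e] e EX y by (auto simp: Y_def)
      then show "v \<in> Y" using y RK[OF \<open>y \<in> X\<close>] lin by (auto simp: Y_def)
    qed
    have xY: "x \<in> Y" using x by (simp add: Y_def)
    have "K x \<noteq> 0"
      using RK[OF x(1)] \<open>x \<noteq> 0\<close> lin(5)[of 0 0] subspace_0[OF lin(1)] by (auto simp: R_def)
    then obtain f \<kappa> where f: "f \<in> Y" "norm f = 1" "\<kappa> \<noteq> 0" "K f = \<kappa> *\<^sub>R f"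
      using compact_symmetric_eigenvector[OF Y Ycl KY, of x]
        K_add K_scale K_sym cpt xY YX by (smt (verit) subset_iff)
    have fX: "f \<in> X" using f YX by auto
    have "f = (1 / \<kappa>) *\<^sub>R K f" using f by simp
    then have fd: "f \<in> dom_op A" using RK(1)[OF fX] lin(1) by (metis subspace_scale)
    \<comment> \<open>An eigenvalue \<open>\<kappa>\<close> of the resolvent corresponds to the
      eigenvalue \<open>\<mu> + 1 / \<kappa>\<close> of \<open>A\<close>.\<close>
    have "R (\<kappa> *\<^sub>R f) = f" using RK(2)[OF fX] f by simp
    then have "\<kappa> *\<^sub>R app_op A f = (1 + \<mu> * \<kappa>) *\<^sub>R f"
      using lin(5)[OF fd] by (simp add: R_def algebra_simps)
    then have "app_op A f = ((1 + \<mu> * \<kappa>) / \<kappa>) *\<^sub>R f"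
      using f(3) by (metis (no_types) divide_inverse_commute scaleR_scaleR scaleR_one left_inverse)
    then have "eigen f" using fd by (auto simp: eigen_def)
    moreover have "orthonormal (insert f E)"
      using on f by (auto simp: orthonormal_def pairwise_insert orthogonal_def Y_def inner_commute)
    ultimately have "f \<in> E" using maximal[of "insert f E"] eig by (auto simp: C_def)
    then show False using f by (auto simp: Y_def)
  qed
  have mpos: "m e > 0" if e: "e \<in> E" for e
  proof -
    have "norm e = 1" using on e by (simp add: orthonormal_def)
    then have "app_op A e \<bullet> e > 0" using pos dom[OF e] unfolding positive_op_def by force
    then show ?thesis using m[OF e] \<open>norm e = 1\<close> by (simp add: norm_eq_1)
  qed
  \<comment> \<open>The \<open>K e = e / (m e - \<mu>)\<close> with \<open>m e \<le> 1\<close> form a separated subset of a compact set, so the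
    eigenvalues cannot accumulate at zero.\<close>
  define E1 where "E1 = {e \<in> E. m e \<le> 1}"
  have "finite E1"
  proof -
    have bd: "bounded E1" using on by (auto simp: E1_def orthonormal_def bounded_iff)
    have "inj_on K E1"
    proof (rule inj_onI)
      fix x y assume "x \<in> E1" "y \<in> E1" "K x = K y"
      then show "x = y" using RK(2)[of x] RK(2)[of y] EX by (auto simp: E1_def)
    qed
    moreover have "finite (K ` E1)"
    proof (rule finite_separated_compact)
      show "compact (closure (K ` E1))" using EX by (intro cpt bd) (auto simp: E1_def)
      show "K ` E1 \<subseteq> closure (K ` E1)" by (rule closure_subset)
      \<comment> \<open>From \<open>0 < m e \<le> 1\<close> the distance of \<open>m e\<close> to
        \<open>\<mu>\<close> is at most \<open>1 + \<bar>\<mu>\<bar>\<close>, and pairing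
        \<open>K e - K f\<close> with \<open>e\<close> leaves \<open>1 / (m e - \<mu>)\<close>; this
        is the separation.\<close>
      show "1 / (1 + \<bar>\<mu>\<bar>) > 0" by simp
      fix u v assume "u \<in> K ` E1" "v \<in> K ` E1" "u \<noteq> v"
      then obtain e f where ef: "e \<in> E1" "f \<in> E1" "e \<noteq> f" "u = K e" "v = K f" by auto
      then have e: "e \<in> E" "m e \<le> 1" "f \<in> E" by (auto simp: E1_def)
      have "e \<bullet> e = 1" "f \<bullet> e = 0"
        using orthonormal_inner[OF on] e ef(3) by auto
      then have "(u - v) \<bullet> e = 1 / (m e - \<mu>)"
        using Ke(2) e ef by (simp add: inner_diff_left)
      moreover have "\<bar>(u - v) \<bullet> e\<bar> \<le> norm (u - v) * norm e" by (rule Cauchy_Schwarz_ineq2)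
      moreover have "norm e = 1" using on e by (simp add: orthonormal_def)
      moreover have "1 / (1 + \<bar>\<mu>\<bar>) \<le> \<bar>1 / (m e - \<mu>)\<bar>"
        using mpos[OF e(1)] e(2) Ke(1)[OF e(1)] by (simp add: field_simps)
      ultimately show "dist u v \<ge> 1 / (1 + \<bar>\<mu>\<bar>)" by (simp add: dist_norm)
    qed
    ultimately show ?thesis using finite_imageD by blast
  qed
  \<comment> \<open>The inserted 1 serves the eigenvalues outside \<open>E1\<close> and covers an
    empty \<open>E1\<close>.\<close>
  define l where "l = Min (insert 1 (m ` E1))"
  have "l > 0" using \<open>finite E1\<close> mpos by (auto simp: l_def E1_def)
  moreover have "m e \<ge> l" if "e \<in> E" for e
  proof (cases "m e \<le> 1")
    case True
    then show ?thesis using that \<open>finite E1\<close> by (auto simp: l_def E1_def intro!: Min_le)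
  next
    case False
    have "l \<le> 1" using \<open>finite E1\<close> by (simp add: l_def)
    then show ?thesis using False by simp
  qed
  moreover have "orthonormal_basis_of X E"
    using on EX total by (auto simp: orthonormal_basis_of_def)
  ultimately show ?thesis using that dom m by blast
qed

section \<open>Completeness of L2\<close>

lemma sq_integrable_rep_L2: "sq_integrable (rep_L2 u)"
  and abs_rep_L2: "abs_L2 (rep_L2 u) = u"
  using Quotient3_L2 by (metis Quotient3_rep_reflp L2_eq_def, metis Quotient3_abs_rep)

lemma rep_abs_L2:
  assumes "sq_integrable f"
  shows "AE x in lebesgue. rep_L2 (abs_L2 f) x = f x"
proof -
  have "L2_eq f f" using assms by (simp add: L2_eq_def)
  then have "L2_eq (rep_L2 (abs_L2 f)) f"
    by (rule Quotient3_rep_abs[OF Quotient3_L2])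
  then show ?thesis by (simp add: L2_eq_def)
qed

lemma rep_L2_eqI:
  assumes "u = abs_L2 f" "sq_integrable f"
  shows "AE x in lebesgue. rep_L2 u x = f x"
  using rep_abs_L2 assms by blast

lemma rep_L2_add: "AE x in lebesgue. rep_L2 (u + v) x = rep_L2 u x + rep_L2 v x"
proof (rule rep_L2_eqI)
  have "L2_eq (rep_L2 u) (rep_L2 u)" "L2_eq (rep_L2 v) (rep_L2 v)"
    by (auto simp: L2_eq_def sq_integrable_rep_L2)
  then show "u + v = abs_L2 (\<lambda>x. rep_L2 u x + rep_L2 v x)"
    using plus_L2.abs_eq by (metis abs_rep_L2)
qed (intro sq_integrable_add sq_integrable_rep_L2)

lemma rep_L2_scale: "AE x in lebesgue. rep_L2 (r *\<^sub>R u) x = r * rep_L2 u x"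
proof (rule rep_L2_eqI)
  have "L2_eq (rep_L2 u) (rep_L2 u)"
    by (auto simp: L2_eq_def sq_integrable_rep_L2)
  then show "r *\<^sub>R u = abs_L2 (\<lambda>x. r * rep_L2 u x)"
    using scaleR_L2.abs_eq by (metis abs_rep_L2)
qed (intro sq_integrable_scale sq_integrable_rep_L2)

lemma rep_L2_zero: "AE x in lebesgue. rep_L2 0 x = 0"
  by (rule rep_L2_eqI) (auto simp: zero_L2_def sq_integrable_zero)

lemma rep_L2_diff: "AE x in lebesgue. rep_L2 (u - v) x = rep_L2 u x - rep_L2 v x"
proof -
  have "u - v = u + (-1) *\<^sub>R v" by simp
  then have "AE x in lebesgue. rep_L2 (u - v) x = rep_L2 u x + rep_L2 ((-1) *\<^sub>R v) x"
    using rep_L2_add[of u "(-1) *\<^sub>R v"] by metis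
  with rep_L2_scale[of "-1" v] show ?thesis
    by eventually_elim simp
qed

lemma inner_L2_rep: "u \<bullet> v = (\<integral>x. rep_L2 u x * rep_L2 v x \<partial>lebesgue)"
proof -
  have "L2_eq (rep_L2 u) (rep_L2 u)" "L2_eq (rep_L2 v) (rep_L2 v)"
    by (auto simp: L2_eq_def sq_integrable_rep_L2)
  then show ?thesis using inner_L2.abs_eq by (metis abs_rep_L2)
qed

text \<open>The extended integral admits Fatou and the exchange of sum and integral before the limit
  is known to be integrable.\<close>

lemma norm_L2_nn_integral:
  "ennreal ((norm u)\<^sup>2) = (\<integral>\<^sup>+x. ennreal ((rep_L2 u x)\<^sup>2) \<partial>lebesgue)"
proof -
  have "(norm u)\<^sup>2 = (\<integral>x. (rep_L2 u x)\<^sup>2 \<partial>lebesgue)"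
    by (simp add: power2_norm_eq_inner inner_L2_rep flip: power2_eq_square)
  then show ?thesis
    using sq_integrable_rep_L2[of u] by (simp add: sq_integrable_def nn_integral_eq_integral)
qed

lemma borel_measurable_rep_L2 [measurable]: "rep_L2 u \<in> borel_measurable lebesgue"
  using sq_integrable_rep_L2[of u] by (simp add: sq_integrable_def)

lemma sq_integrable_iff_nn_integral:
  assumes "f \<in> borel_measurable lebesgue"
  shows "sq_integrable f \<longleftrightarrow> (\<integral>\<^sup>+x. ennreal ((f x)\<^sup>2) \<partial>lebesgue) < \<infinity>"
  using assms by (auto simp: sq_integrable_def integrable_iff_bounded)

text \<open>Almost everywhere convergence comes from \<open>d \<le> 2^-k + 2^k d\<^sup>2\<close>, which reduces the
  summability of the increments to that of the integrals of their weighted squares.\<close>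

lemma L2_fast_Cauchy_convergent:
  fixes U :: "nat \<Rightarrow> ('n::finite) L2"
  assumes U: "\<And>k m. k \<le> m \<Longrightarrow> norm (U m - U k) \<le> (1/2)^k"
  shows "\<exists>u. U \<longlonglongrightarrow> u"
proof -
  define f where "f k = rep_L2 (U k)" for k
  have [measurable]: "f k \<in> borel_measurable lebesgue" for k
    by (simp add: f_def)
  have int: "(\<integral>\<^sup>+x. ennreal ((f m x - f k x)\<^sup>2) \<partial>lebesgue) = ennreal ((norm (U m - U k))\<^sup>2)" for m k
    unfolding norm_L2_nn_integral f_def
  proof (rule nn_integral_cong_AE)
    show "AE x in lebesgue. ennreal ((rep_L2 (U m) x - rep_L2 (U k) x)\<^sup>2) = ennreal ((rep_L2 (U m - U k) x)\<^sup>2)"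
      using rep_L2_diff[of "U m" "U k"] by eventually_elim simp
  qed
  \<comment> \<open>The bound \<open>(1/2)^k\<close> on the norms enters squared, so after weighting
    by \<open>2^k\<close> the integrals are still at most \<open>(1/2)^k\<close>.\<close>
  define w where "w k x = 2^k * (f (Suc k) x - f k x)\<^sup>2" for k x
  have [measurable]: "w k \<in> borel_measurable lebesgue" for k
    by (simp add: w_def[abs_def])
  have "(\<integral>\<^sup>+x. ennreal (w k x) \<partial>lebesgue) \<le> ennreal ((1/2)^k)" for k
  proof -
    have "(\<integral>\<^sup>+x. ennreal (w k x) \<partial>lebesgue) = ennreal (2^k) * (\<integral>\<^sup>+x. ennreal ((f (Suc k) x - f k x)\<^sup>2) \<partial>lebesgue)"
      by (subst nn_integral_cmult[symmetric]) (simp_all add: w_def ennreal_mult)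
    also have "\<dots> = ennreal (2^k * (norm (U (Suc k) - U k))\<^sup>2)"
      by (simp add: int ennreal_mult)
    also have "\<dots> \<le> ennreal (2^k * ((1/2)^k)\<^sup>2)"
      by (intro ennreal_leI mult_left_mono power_mono U) auto
    also have "2^k * ((1/2)^k)\<^sup>2 = (1/2::real)^k"
      by (simp add: power2_eq_square power_one_over field_simps)
    finally show ?thesis .
  qed
  then have "(\<Sum>k. \<integral>\<^sup>+x. ennreal (w k x) \<partial>lebesgue) \<le> (\<Sum>k. ennreal ((1/2)^k))"
    by (intro suminf_le) auto
  also have "\<dots> = ennreal (\<Sum>k. (1/2)^k)"
    by (intro suminf_ennreal2) (auto simp: summable_geometric)
  also have "\<dots> < \<infinity>" by simp
  finally have "(\<integral>\<^sup>+x. (\<Sum>k. ennreal (w k x)) \<partial>lebesgue) \<noteq> \<infinity>"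
    by (subst nn_integral_suminf) auto
  then have "AE x in lebesgue. (\<Sum>k. ennreal (w k x)) \<noteq> \<infinity>"
    by (intro nn_integral_PInf_AE) auto
  then have conv: "AE x in lebesgue. (\<lambda>k. f k x) \<longlonglongrightarrow> lim (\<lambda>k. f k x)"
  proof eventually_elim
    case (elim x)
    have "summable (\<lambda>k. w k x)"
      using elim by (intro summable_suminf_not_top) (auto simp: w_def)
    then have s: "summable (\<lambda>k. (1/2)^k + w k x)"
      by (intro summable_add) (auto simp: summable_geometric)
    have "\<bar>d\<bar> \<le> (1/2)^k + 2^k * d\<^sup>2" for d :: real and k :: nat
    proof -
      define a where "a = 2^k * \<bar>d\<bar>"
      have "0 \<le> a" "0 \<le> (a - 1)\<^sup>2" by (auto simp: a_def)
      then have "a \<le> 1 + a\<^sup>2"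
        by (simp add: power2_eq_square algebra_simps)
      moreover have "a\<^sup>2 = 2^k * (2^k * d\<^sup>2)"
        unfolding a_def power_mult_distrib power2_abs by (simp add: power2_eq_square)
      ultimately have "2^k * \<bar>d\<bar> \<le> 1 + 2^k * (2^k * d\<^sup>2)"
        by (simp add: a_def)
      then have "2^k * \<bar>d\<bar> \<le> 2^k * ((1/2)^k + 2^k * d\<^sup>2)"
        by (simp add: distrib_left power_one_over)
      then show ?thesis by (rule mult_left_le_imp_le) simp
    qed
    then have "summable (\<lambda>k. f (Suc k) x - f k x)"
      by (intro summable_comparison_test'[OF s]) (simp add: w_def)
    then have "convergent (\<lambda>n. \<Sum>k<n. f (Suc k) x - f k x)"
      by (simp only: summable_iff_convergent)
    then have "convergent (\<lambda>n. f n x - f 0 x)"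
      by (simp only: sum_lessThan_telescope[of "\<lambda>k. f k x"])
    then obtain l where "(\<lambda>n. f n x - f 0 x) \<longlonglongrightarrow> l"
      by (auto simp: convergent_def)
    then have "(\<lambda>n. f n x - f 0 x + f 0 x) \<longlonglongrightarrow> l + f 0 x"
      by (intro tendsto_intros)
    then have "convergent (\<lambda>n. f n x)" by (auto simp: convergent_def)
    then show ?case by (simp add: convergent_LIMSEQ_iff)
  qed
  define g where "g x = lim (\<lambda>k. f k x)" for x
  have g [measurable]: "g \<in> borel_measurable lebesgue"
    unfolding g_def[abs_def] by measurable
  \<comment> \<open>The Cauchy bound passes to the limit in \<open>m\<close> by Fatou.\<close>
  have dist: "(\<integral>\<^sup>+x. ennreal ((g x - f k x)\<^sup>2) \<partial>lebesgue) \<le> ennreal (((1/2)^k)\<^sup>2)" for k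
  proof -
    have "(\<integral>\<^sup>+x. ennreal ((g x - f k x)\<^sup>2) \<partial>lebesgue)
        = (\<integral>\<^sup>+x. liminf (\<lambda>m. ennreal ((f m x - f k x)\<^sup>2)) \<partial>lebesgue)"
    proof (rule nn_integral_cong_AE)
      show "AE x in lebesgue. ennreal ((g x - f k x)\<^sup>2) = liminf (\<lambda>m. ennreal ((f m x - f k x)\<^sup>2))"
        using conv
      proof eventually_elim
        case (elim x)
        then have "(\<lambda>m. ennreal ((f m x - f k x)\<^sup>2)) \<longlonglongrightarrow> ennreal ((g x - f k x)\<^sup>2)"
          unfolding g_def by (intro tendsto_intros)
        then show ?case using lim_imp_Liminf[OF sequentially_bot] by force
      qed
    qed
    also have "\<dots> \<le> liminf (\<lambda>m. \<integral>\<^sup>+x. ennreal ((f m x - f k x)\<^sup>2) \<partial>lebesgue)"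
      by (rule nn_integral_liminf) measurable
    also have "\<dots> \<le> liminf (\<lambda>m::nat. ennreal (((1/2)^k)\<^sup>2))"
      unfolding int
      by (intro Liminf_mono eventually_sequentiallyI[of k] ennreal_leI power_mono U) auto
    also have "\<dots> = ennreal (((1/2)^k)\<^sup>2)" by (simp add: Liminf_const)
    finally show ?thesis .
  qed
  \<comment> \<open>Only differences are controlled so far; square-integrability of \<open>g\<close>
    is recovered through \<open>f 0\<close>.\<close>
  have "sq_integrable (\<lambda>x. g x - f 0 x)"
    using dist[of 0] by (subst sq_integrable_iff_nn_integral) (auto intro: le_less_trans)
  then have "sq_integrable (\<lambda>x. (g x - f 0 x) + f 0 x)"
    by (rule sq_integrable_add) (simp add: f_def sq_integrable_rep_L2)
  then have sg: "sq_integrable g" by simp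
  define u where "u = abs_L2 g"
  have "norm (U k - u) \<le> (1/2)^k" for k
  proof -
    have "ennreal ((norm (u - U k))\<^sup>2) = (\<integral>\<^sup>+x. ennreal ((g x - f k x)\<^sup>2) \<partial>lebesgue)"
      unfolding norm_L2_nn_integral
    proof (rule nn_integral_cong_AE)
      show "AE x in lebesgue. ennreal ((rep_L2 (u - U k) x)\<^sup>2) = ennreal ((g x - f k x)\<^sup>2)"
        using rep_L2_diff[of u "U k"] rep_abs_L2[OF sg]
        by eventually_elim (simp add: f_def u_def)
    qed
    also have "\<dots> \<le> ennreal (((1/2)^k)\<^sup>2)" by (rule dist)
    finally have "(norm (u - U k))\<^sup>2 \<le> ((1/2)^k)\<^sup>2" by simp
    then show ?thesis by (subst norm_minus_commute) (rule power2_le_imp_le, auto)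
  qed
  then have "(\<lambda>k. U k - u) \<longlonglongrightarrow> 0"
    by (intro Lim_null_comparison[OF _ LIMSEQ_power_zero[of "1/2::real"]]) auto
  then have "U \<longlonglongrightarrow> u" by (simp add: LIM_zero_iff)
  then show ?thesis ..
qed

instance L2 :: (finite) banach
proof
  fix U :: "nat \<Rightarrow> 'a L2" assume U: "Cauchy U"
  \<comment> \<open>The exponent is \<open>Suc k\<close> because two later terms are compared
    through \<open>U (N k)\<close>, and the two halves add up to \<open>(1/2)^k\<close>.\<close>
  have "\<exists>N. \<forall>m\<ge>N. norm (U m - U N) < (1/2)^Suc k" for k
  proof -
    have "(1/2::real)^Suc k > 0" by simp
    then show ?thesis using U unfolding Cauchy_altdef2 dist_norm by blast
  qed
  then obtain N where N: "\<And>k m. m \<ge> N k \<Longrightarrow> norm (U m - U (N k)) < (1/2)^Suc k"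
    by metis
  \<comment> \<open>The sum makes \<open>r\<close> monotone and at least \<open>N k\<close>; the
    added \<open>k\<close> makes it strictly monotone.\<close>
  define r where "r k = (\<Sum>j\<le>k. N j) + k" for k
  have r: "strict_mono r" by (simp add: strict_mono_Suc_iff r_def)
  have rN: "r k \<ge> N k" for k
    using member_le_sum[of k "{..k}" N] by (simp add: r_def)
  have "norm (U (r m) - U (r k)) \<le> (1/2)^k" if "k \<le> m" for k m
  proof -
    have "r m \<ge> N k" using rN[of k] strict_mono_mono[OF r] that by (meson le_trans monoD)
    then have "norm (U (r m) - U (N k)) + norm (U (r k) - U (N k)) < (1/2)^Suc k + (1/2)^Suc k"
      by (intro add_strict_mono N rN)
    moreover have "norm (U (r m) - U (r k)) \<le> norm (U (r m) - U (N k)) + norm (U (r k) - U (N k))"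
      using norm_triangle_ineq4[of "U (r m) - U (N k)" "U (r k) - U (N k)"] by simp
    ultimately show ?thesis by simp
  qed
  then obtain u where "(\<lambda>k. U (r k)) \<longlonglongrightarrow> u"
    using L2_fast_Cauchy_convergent[of "\<lambda>k. U (r k)"] by auto
  then have "U \<longlonglongrightarrow> u"
    using Cauchy_converges_subseq[OF U r] by (simp add: comp_def)
  then show "convergent U" by (auto simp: convergent_def)
qed

section \<open>The functions on a domain as a closed subspace\<close>

lemma subspace_L2_on: "subspace (L2_on \<Omega>)"
proof (rule subspaceI)
  show "0 \<in> L2_on \<Omega>"
    using rep_L2_zero by (auto simp: L2_on_def elim!: eventually_mono)
  show "u + v \<in> L2_on \<Omega>" if "u \<in> L2_on \<Omega>" "v \<in> L2_on \<Omega>" for u v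
    using that rep_L2_add[of u v] unfolding L2_on_def mem_Collect_eq by eventually_elim auto
  show "r *\<^sub>R u \<in> L2_on \<Omega>" if "u \<in> L2_on \<Omega>" for r u
    using that rep_L2_scale[of r u] unfolding L2_on_def mem_Collect_eq by eventually_elim auto
qed

text \<open>A limit \<open>u\<close> is orthogonal to its own restriction to the complement of \<open>\<Omega>\<close>.\<close>

lemma closed_L2_on:
  assumes "open \<Omega>"
  shows "closed (L2_on \<Omega>)"
  unfolding closed_sequential_limits
proof (intro allI impI, elim conjE)
  fix U u assume U: "\<forall>n. U n \<in> L2_on \<Omega>" and lim: "U \<longlonglongrightarrow> u"
  define h where "h x = indicator (- \<Omega>) x * rep_L2 u x" for x
  have [measurable]: "- \<Omega> \<in> sets lebesgue"
    using sets_completionI_sets[of "- \<Omega>" lborel] assms by auto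
  have [measurable]: "h \<in> borel_measurable lebesgue"
    unfolding h_def[abs_def] by measurable
  have "integrable lebesgue (\<lambda>x. (h x)\<^sup>2)"
  proof (rule Bochner_Integration.integrable_bound)
    show "integrable lebesgue (\<lambda>x. (rep_L2 u x)\<^sup>2)"
      using sq_integrable_rep_L2 by (auto simp: sq_integrable_def)
    show "(\<lambda>x. (h x)\<^sup>2) \<in> borel_measurable lebesgue" by measurable
  qed (auto simp: h_def indicator_def)
  then have h: "sq_integrable h" by (simp add: sq_integrable_def)
  define v where "v = abs_L2 h"
  have v: "AE x in lebesgue. rep_L2 v x = h x"
    unfolding v_def by (rule rep_abs_L2[OF h])
  have "U n \<bullet> v = 0" for n
  proof -
    have "AE x in lebesgue. x \<notin> \<Omega> \<longrightarrow> rep_L2 (U n) x = 0" using U by (simp add: L2_on_def)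
    then have "AE x in lebesgue. rep_L2 (U n) x * rep_L2 v x = 0"
      using v by eventually_elim (auto simp: h_def indicator_def)
    then show ?thesis by (simp add: inner_L2_rep integral_eq_zero_AE)
  qed
  then have "u \<bullet> v = 0"
    using tendsto_inner[OF lim tendsto_const, of v] by (simp add: LIMSEQ_const_iff)
  moreover have "u \<bullet> v = v \<bullet> v"
    unfolding inner_L2_rep
    by (rule integral_cong_AE) (use v in \<open>auto simp: h_def indicator_def elim!: eventually_mono\<close>)
  ultimately have "v = 0" by simp
  then have "AE x in lebesgue. h x = 0"
    using v rep_L2_zero by (auto elim: eventually_elim2)
  then show "u \<in> L2_on \<Omega>"
    unfolding L2_on_def mem_Collect_eq by eventually_elim (auto simp: h_def)
qed

section \<open>Linear differential equations\<close>

text \<open>The solution is the exponential series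
  \<open>(\<Sum>n. (t ^ n / fact n) *\<^sub>R a n)\<close> with \<open>a n\<close> the iterates of
  \<open>G\<close> at \<open>x\<close>. Termwise differentiation is a fact on scalar power series,
  so it is applied to \<open>\<phi> (y t)\<close> for bounded linear functionals
  \<open>\<phi>\<close>, and the coordinate functionals reassemble the vector derivative.\<close>

lemma linear_ode_exists:
  fixes G :: "'a::euclidean_space \<Rightarrow> 'a"
  assumes G: "bounded_linear G"
  shows "\<exists>y. y 0 = x \<and> (\<forall>t. (y has_vector_derivative G (y t)) (at t))"
proof -
  interpret G: bounded_linear G by fact
  obtain K where K: "K > 0" "\<And>v. norm (G v) \<le> norm v * K"
    using G.pos_bounded by blast
  define a where "a n = (G ^^ n) x" for n
  have a_Suc: "a (Suc n) = G (a n)" for n by (simp add: a_def)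
  have a_le: "norm (a n) \<le> K ^ n * norm x" for n
  proof (induction n)
    case (Suc n)
    have "norm (a (Suc n)) \<le> norm (a n) * K" unfolding a_Suc by (rule K)
    also have "\<dots> \<le> K ^ n * norm x * K" using Suc K by (intro mult_right_mono) auto
    finally show ?case by (simp add: mult_ac)
  qed (simp add: a_def)
  have summ: "summable (\<lambda>n. (t ^ n / fact n) *\<^sub>R a n)" for t :: real
  proof (rule summable_norm_cancel, rule summable_comparison_test')
    show "summable (\<lambda>n. norm x * (inverse (fact n) * (K * \<bar>t\<bar>) ^ n))"
      by (intro summable_mult summable_exp)
    show "norm (norm ((t ^ n / fact n) *\<^sub>R a n)) \<le> norm x * (inverse (fact n) * (K * \<bar>t\<bar>) ^ n)" for n
      using mult_left_mono[OF a_le[of n], of "\<bar>t\<bar> ^ n / fact n"]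
      by (simp add: power_abs power_mult_distrib field_simps)
  qed
  define y where "y t = (\<Sum>n. (t ^ n / fact n) *\<^sub>R a n)" for t :: real
  have lin: "(\<lambda>n. \<phi> (a n) / fact n * t ^ n) sums \<phi> (y t)" if "bounded_linear \<phi>" for \<phi> :: "'a \<Rightarrow> real" and t
  proof -
    interpret \<phi>: bounded_linear \<phi> by fact
    have "(\<lambda>n. \<phi> ((t ^ n / fact n) *\<^sub>R a n)) sums \<phi> (y t)"
      unfolding y_def by (intro \<phi>.sums summable_sums summ)
    then show ?thesis by (simp add: \<phi>.scaleR mult.commute)
  qed
  have der: "((\<lambda>t. \<phi> (y t)) has_real_derivative \<phi> (G (y t))) (at t)" if \<phi>: "bounded_linear \<phi>" for \<phi> t
  proof -
    have "((\<lambda>t. \<Sum>n. \<phi> (a n) / fact n * t ^ n) has_real_derivative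
        (\<Sum>n. diffs (\<lambda>n. \<phi> (a n) / fact n) n * t ^ n)) (at t)"
      using lin[OF \<phi>] by (intro termdiffs_strong_converges_everywhere) (auto simp: sums_iff)
    moreover have "diffs (\<lambda>n. \<phi> (a n) / fact n) n = \<phi> (G (a n)) / fact n" for n
      by (simp add: diffs_def a_Suc del: of_nat_Suc)
    moreover have "(\<Sum>n. \<phi> (a n) / fact n * t ^ n) = \<phi> (y t)" for t
      using lin[OF \<phi>] by (simp add: sums_iff)
    moreover have "(\<Sum>n. \<phi> (G (a n)) / fact n * t ^ n) = \<phi> (G (y t))"
      using lin[OF bounded_linear_compose[OF \<phi> G]] by (simp add: sums_iff)
    ultimately show ?thesis by simp
  qed
  have "(y has_vector_derivative G (y t)) (at t)" for t
    unfolding has_vector_derivative_def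
    using der[OF bounded_linear_inner_left]
    by (subst has_derivative_componentwise_within)
      (auto simp: has_real_derivative_iff_has_vector_derivative has_vector_derivative_def)
  moreover have "y 0 = x"
  proof -
    have "y 0 = (\<Sum>n\<in>{0}. (0 ^ n / fact n) *\<^sub>R a n)"
      unfolding y_def by (rule suminf_finite) auto
    then show ?thesis by (simp add: a_def)
  qed
  ultimately show ?thesis by blast
qed

section \<open>Exponential bounds from differential inequalities\<close>

lemma gronwall:
  fixes f f' :: "real \<Rightarrow> real"
  assumes f: "\<And>t. (f has_real_derivative f' t) (at t)" and le: "\<And>t. f' t \<le> k * f t" and t: "0 \<le> t"
  shows "f t \<le> exp (k * t) * f 0"
proof -
  \<comment> \<open>The integrating factor turns the inequality into monotonicity. The rate
    \<open>k\<close> will be nonnegative for growth and negative for decay.\<close>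
  define g where "g t = exp (- k * t) * f t" for t
  have "(g has_real_derivative exp (- k * t) * (f' t - k * f t)) (at t)" for t
    unfolding g_def by (rule derivative_eq_intros refl f)+ (simp add: algebra_simps)
  moreover have "exp (- k * t) * (f' t - k * f t) \<le> 0" for t
    using le[of t] by (intro mult_nonneg_nonpos) auto
  ultimately have "g t \<le> g 0"
    using t by (intro DERIV_nonpos_imp_nonincreasing[of 0 t g]) blast+
  then show ?thesis by (simp add: g_def exp_minus field_simps)
qed

text \<open>A bound on the absolute value of the derivative is invariant under time reversal, which
  reduces negative times to positive ones.\<close>

lemma gronwall_abs:
  fixes f f' :: "real \<Rightarrow> real"
  assumes f: "\<And>t. (f has_real_derivative f' t) (at t)" and le: "\<And>t. \<bar>f' t\<bar> \<le> k * f t"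
  shows "f t \<le> exp (k * \<bar>t\<bar>) * f 0"
proof (cases "0 \<le> t")
  case True
  have "f' t \<le> k * f t" for t using le[of t] by linarith
  then show ?thesis using gronwall[OF f _ True] True by simp
next
  case False
  have "((\<lambda>t. f (- t)) has_real_derivative - f' (- t)) (at t)" for t
    using DERIV_mirror[of f "f' (- t)" t] f by simp
  moreover have "- f' (- t) \<le> k * f (- t)" for t using le[of "- t"] by linarith
  ultimately show ?thesis using gronwall[of "\<lambda>t. f (- t)" "\<lambda>t. - f' (- t)" k "- t"] False by simp
qed

section \<open>A single mode of the third-order equation\<close>

text \<open>For an eigenvector of \<open>A\<close> with eigenvalue \<open>s\<^sup>2\<close>, the unknowns are \<open>p = s\<^sup>2 u\<close>, \<open>q = s v\<close> and
  \<open>r = w\<close>, so that the Euclidean norm of \<open>(p, q, r)\<close> is the phase space norm.\<close>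

definition mgt_mode :: "real \<Rightarrow> real \<Rightarrow> real \<Rightarrow> real \<Rightarrow> real \<Rightarrow> real \<times> real \<times> real \<Rightarrow> real \<times> real \<times> real" where
  "mgt_mode \<alpha> c b \<tau> s = (\<lambda>(p, q, r). (s * q, s * r, - (c\<^sup>2 * p + b * s * q + \<alpha> * r) / \<tau>))"

lemma bounded_linear_mgt_mode: "bounded_linear (mgt_mode \<alpha> c b \<tau> s)"
  unfolding mgt_mode_def
  by (rule linear_conv_bounded_linear[THEN iffD1])
    (auto intro!: linearI simp: algebra_simps divide_simps)

text \<open>The share of one mode in the square of \<open>phase_norm_tau\<close>; the value
  \<open>\<tau> = 1\<close> belongs to \<open>phase_norm\<close>.\<close>

definition energy :: "real \<Rightarrow> real \<times> real \<times> real \<Rightarrow> real" where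
  "energy \<tau> = (\<lambda>(p, q, r). p\<^sup>2 + q\<^sup>2 + \<tau> * r\<^sup>2)"

lemma energy_1: "energy 1 y = (norm y)\<^sup>2"
  by (cases y) (simp add: energy_def norm_Pair)

lemma mgt_mode_components:
  assumes "(y has_vector_derivative mgt_mode \<alpha> c b \<tau> s (y t)) (at t)"
  shows "((\<lambda>t. fst (y t)) has_real_derivative s * fst (snd (y t))) (at t)"
    and "((\<lambda>t. fst (snd (y t))) has_real_derivative s * snd (snd (y t))) (at t)"
    and "((\<lambda>t. snd (snd (y t))) has_real_derivative
      - (c\<^sup>2 * fst (y t) + b * s * fst (snd (y t)) + \<alpha> * snd (snd (y t))) / \<tau>) (at t)"
proof -
  note snd = bounded_linear.has_vector_derivative[OF bounded_linear_snd]
    and fst = bounded_linear.has_vector_derivative[OF bounded_linear_fst]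
  show "((\<lambda>t. fst (y t)) has_real_derivative s * fst (snd (y t))) (at t)"
    using fst[OF assms]
    by (simp add: has_real_derivative_iff_has_vector_derivative mgt_mode_def case_prod_beta)
  show "((\<lambda>t. fst (snd (y t))) has_real_derivative s * snd (snd (y t))) (at t)"
    using fst[OF snd[OF assms]]
    by (simp add: has_real_derivative_iff_has_vector_derivative mgt_mode_def case_prod_beta)
  show "((\<lambda>t. snd (snd (y t))) has_real_derivative
      - (c\<^sup>2 * fst (y t) + b * s * fst (snd (y t)) + \<alpha> * snd (snd (y t))) / \<tau>) (at t)"
    using snd[OF snd[OF assms]]
    by (simp add: has_real_derivative_iff_has_vector_derivative mgt_mode_def case_prod_beta)
qed

text \<open>Up to a perturbation that is bounded independently of \<open>s\<close>, the mode is skew-adjoint with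
  respect to the quadratic form \<open>(p + (\<tau> / b) r)\<^sup>2 + (b / \<tau>) q\<^sup>2 + r\<^sup>2\<close>.\<close>

lemma mgt_mode_growth:
  assumes pos: "b > 0" "\<tau> > 0"
  shows "\<exists>M>0. \<exists>\<omega>\<ge>0. \<forall>s y. (\<forall>t. (y has_vector_derivative mgt_mode \<alpha> c b \<tau> s (y t)) (at t)) \<longrightarrow>
    (\<forall>t. norm (y t) \<le> M * exp (\<omega> * \<bar>t\<bar>) * norm (y 0))"
proof -
  \<comment> \<open>With this \<open>\<theta>\<close> the derivative of
    \<open>P = p + \<theta> * r\<close> contains no \<open>s\<close>, and the weight
    \<open>1 / \<theta>\<close> on \<open>q\<^sup>2\<close> cancels the \<open>s\<close>-terms
    coming from \<open>q\<^sup>2\<close> and \<open>r\<^sup>2\<close>. Written in \<open>P\<close>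
    and \<open>r\<close>, the remainder \<open>c\<^sup>2 * p + \<alpha> * r\<close> has coefficient
    \<open>\<beta>\<close> at \<open>r\<close>.\<close>
  define \<theta> where "\<theta> = \<tau> / b"
  define \<beta> where "\<beta> = \<alpha> - c\<^sup>2 * \<theta>"
  \<comment> \<open>The 4 is a 2 from differentiating squares times a 2 from \<open>(\<bar>P\<bar> +
    \<bar>r\<bar>)\<^sup>2 \<le> 2 * (P * P + r * r)\<close>.\<close>
  define \<omega> where "\<omega> = 4 * (c\<^sup>2 + \<bar>\<beta>\<bar>) * (1 / b + 1 / \<tau>)"
  define Q where "Q p q r = (p + \<theta> * r) * (p + \<theta> * r) + q * q / \<theta> + r * r" for p q r :: real
  have \<theta>: "\<theta> > 0" using pos by (simp add: \<theta>_def)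
  have \<omega>: "\<omega> \<ge> 0" using pos by (auto simp: \<omega>_def intro!: mult_nonneg_nonneg add_nonneg_nonneg)
  define m where "m = 3 + 2 * \<theta>\<^sup>2 + \<theta>"
  define M where "M = 3 + 2 * \<theta>\<^sup>2 + 1 / \<theta>"
  have M: "m > 0" "M > 0" using \<theta> by (auto simp: m_def M_def intro!: add_pos_nonneg)
  have lower: "p\<^sup>2 + q\<^sup>2 + r\<^sup>2 \<le> m * Q p q r" for p q r
  proof -
    have "p\<^sup>2 \<le> 2 * ((p + \<theta> * r) * (p + \<theta> * r)) + 2 * \<theta>\<^sup>2 * (r * r)"
      using zero_le_square[of "p + 2 * \<theta> * r"] by (simp add: power2_eq_square algebra_simps)
    moreover have "q\<^sup>2 = \<theta> * (q * q / \<theta>)" using \<theta> by (simp add: power2_eq_square)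
    moreover have "m * Q p q r = (2 + 2 * \<theta>\<^sup>2 + 1 + \<theta>) * ((p + \<theta> * r) * (p + \<theta> * r))
        + (3 + 2 * \<theta>\<^sup>2 + \<theta>) * (q * q / \<theta>) + (2 * \<theta>\<^sup>2 + 1 + 2 + \<theta>) * (r * r)"
      by (simp add: m_def Q_def algebra_simps)
    moreover have "(2 + 2 * \<theta>\<^sup>2 + 1 + \<theta>) * ((p + \<theta> * r) * (p + \<theta> * r)) \<ge> 2 * ((p + \<theta> * r) * (p + \<theta> * r))"
      using \<theta> by (intro mult_right_mono) auto
    moreover have "(3 + 2 * \<theta>\<^sup>2 + \<theta>) * (q * q / \<theta>) \<ge> \<theta> * (q * q / \<theta>)"
      using \<theta> by (intro mult_right_mono) auto
    moreover have "(2 * \<theta>\<^sup>2 + 1 + 2 + \<theta>) * (r * r) \<ge> (2 * \<theta>\<^sup>2 + 1) * (r * r)"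
      using \<theta> by (intro mult_right_mono) auto
    moreover have "(2 * \<theta>\<^sup>2 + 1) * (r * r) = 2 * \<theta>\<^sup>2 * (r * r) + r\<^sup>2"
      by (simp add: power2_eq_square algebra_simps)
    ultimately show ?thesis by linarith
  qed
  have upper: "Q p q r \<le> M * (p\<^sup>2 + q\<^sup>2 + r\<^sup>2)" for p q r
  proof -
    have "(p + \<theta> * r) * (p + \<theta> * r) \<le> 2 * p\<^sup>2 + 2 * \<theta>\<^sup>2 * r\<^sup>2"
      using zero_le_square[of "p - \<theta> * r"] by (simp add: power2_eq_square algebra_simps)
    moreover have "M * (p\<^sup>2 + q\<^sup>2 + r\<^sup>2) = M * p\<^sup>2 + M * q\<^sup>2 + M * r\<^sup>2"
      by (simp add: algebra_simps)
    moreover have "2 * p\<^sup>2 \<le> M * p\<^sup>2"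
      using \<theta> by (intro mult_right_mono) (auto simp: M_def intro!: add_nonneg_nonneg)
    moreover have "(1 / \<theta>) * q\<^sup>2 \<le> M * q\<^sup>2"
      using \<theta> by (intro mult_right_mono) (auto simp: M_def intro!: add_nonneg_nonneg)
    moreover have "(1 / \<theta>) * q\<^sup>2 = q * q / \<theta>" by (simp add: power2_eq_square)
    moreover have "(2 * \<theta>\<^sup>2 + 1) * r\<^sup>2 \<le> M * r\<^sup>2"
      using \<theta> by (intro mult_right_mono) (auto simp: M_def intro!: add_nonneg_nonneg)
    moreover have "(2 * \<theta>\<^sup>2 + 1) * r\<^sup>2 = 2 * \<theta>\<^sup>2 * r\<^sup>2 + r * r"
      by (simp add: power2_eq_square algebra_simps)
    ultimately show ?thesis unfolding Q_def by linarith
  qed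
  have bound: "\<bar>2 * (c\<^sup>2 * P + \<beta> * r) * (P / b + r / \<tau>)\<bar> \<le> \<omega> * (P * P + r * r)" for P r :: real
  proof -
    have "\<bar>c\<^sup>2 * P + \<beta> * r\<bar> \<le> (c\<^sup>2 + \<bar>\<beta>\<bar>) * (\<bar>P\<bar> + \<bar>r\<bar>)"
      by (rule order_trans[OF abs_triangle_ineq]) (simp add: abs_mult algebra_simps)
    moreover have "\<bar>P / b + r / \<tau>\<bar> \<le> (1 / b + 1 / \<tau>) * (\<bar>P\<bar> + \<bar>r\<bar>)"
      using pos by (intro order_trans[OF abs_triangle_ineq]) (simp add: abs_mult algebra_simps)
    ultimately have "\<bar>c\<^sup>2 * P + \<beta> * r\<bar> * \<bar>P / b + r / \<tau>\<bar>
        \<le> ((c\<^sup>2 + \<bar>\<beta>\<bar>) * (\<bar>P\<bar> + \<bar>r\<bar>)) * ((1 / b + 1 / \<tau>) * (\<bar>P\<bar> + \<bar>r\<bar>))"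
      by (intro mult_mono) auto
    also have "\<dots> = (\<omega> / 4) * (\<bar>P\<bar> + \<bar>r\<bar>)\<^sup>2"
      by (simp add: \<omega>_def power2_eq_square algebra_simps)
    also have "\<dots> \<le> (\<omega> / 4) * (2 * (P * P + r * r))"
    proof (intro mult_left_mono)
      show "(\<bar>P\<bar> + \<bar>r\<bar>)\<^sup>2 \<le> 2 * (P * P + r * r)"
        using zero_le_square[of "\<bar>P\<bar> - \<bar>r\<bar>"] by (simp add: power2_eq_square algebra_simps)
    qed (use \<omega> in simp)
    also have "\<dots> = (\<omega> * (P * P + r * r)) / 2" by simp
    finally have "2 * (\<bar>c\<^sup>2 * P + \<beta> * r\<bar> * \<bar>P / b + r / \<tau>\<bar>) \<le> \<omega> * (P * P + r * r)"
      by linarith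
    then show ?thesis by (simp only: abs_mult abs_numeral mult.assoc)
  qed
  have "norm (y t) \<le> sqrt (m * M) * exp ((\<omega> / 2) * \<bar>t\<bar>) * norm (y 0)"
    if y: "\<And>t. (y has_vector_derivative mgt_mode \<alpha> c b \<tau> s (y t)) (at t)" for s y t
  proof -
    define p q r where "p t = fst (y t)" and "q t = fst (snd (y t))" and "r t = snd (snd (y t))" for t
    define f where "f t = Q (p t) (q t) (r t)" for t
    define f' where "f' t = - (2 * (c\<^sup>2 * (p t + \<theta> * r t) + \<beta> * r t) * ((p t + \<theta> * r t) / b + r t / \<tau>))" for t
    have d: "(p has_real_derivative s * q t) (at t)" "(q has_real_derivative s * r t) (at t)"
      "(r has_real_derivative - (c\<^sup>2 * p t + b * s * q t + \<alpha> * r t) / \<tau>) (at t)" for t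
      using mgt_mode_components[OF y] unfolding p_def q_def r_def by auto
    define \<iota> where "\<iota> = 1 / \<theta>"
    have "f = (\<lambda>t. (p t + \<theta> * r t) * (p t + \<theta> * r t) + \<iota> * (q t * q t) + r t * r t)"
      by (simp add: f_def Q_def \<iota>_def fun_eq_iff)
    then have "(f has_real_derivative f' t) (at t)" for t
      unfolding f'_def
      apply (simp only:)
      apply (rule derivative_eq_intros refl d)+
      using pos by (simp add: \<theta>_def \<beta>_def \<iota>_def field_simps)
    moreover have "\<bar>f' t\<bar> \<le> \<omega> * f t" for t
    proof -
      have "\<bar>f' t\<bar> \<le> \<omega> * ((p t + \<theta> * r t) * (p t + \<theta> * r t) + r t * r t)"
        unfolding f'_def using bound[of "p t + \<theta> * r t" "r t"] by simp
      also have "\<dots> \<le> \<omega> * f t"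
        using \<omega> \<theta> unfolding f_def Q_def by (intro mult_left_mono) auto
      finally show ?thesis .
    qed
    ultimately have "f t \<le> exp (\<omega> * \<bar>t\<bar>) * f 0"
      by (rule gronwall_abs)
    have n: "(norm (y t))\<^sup>2 = (p t)\<^sup>2 + (q t)\<^sup>2 + (r t)\<^sup>2" for t
      unfolding energy_1[symmetric] energy_def p_def q_def r_def by (simp add: case_prod_beta)
    have "(norm (y t))\<^sup>2 \<le> m * f t" unfolding n f_def by (rule lower)
    also have "\<dots> \<le> m * (exp (\<omega> * \<bar>t\<bar>) * (M * (norm (y 0))\<^sup>2))"
    proof -
      have "f 0 \<le> M * (norm (y 0))\<^sup>2" unfolding n f_def by (rule upper)
      then have "exp (\<omega> * \<bar>t\<bar>) * f 0 \<le> exp (\<omega> * \<bar>t\<bar>) * (M * (norm (y 0))\<^sup>2)"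
        by (intro mult_left_mono) auto
      with \<open>f t \<le> exp (\<omega> * \<bar>t\<bar>) * f 0\<close> have "f t \<le> exp (\<omega> * \<bar>t\<bar>) * (M * (norm (y 0))\<^sup>2)"
        by (rule order_trans)
      then show ?thesis using M by (intro mult_left_mono) auto
    qed
    also have "\<dots> = (sqrt (m * M) * exp ((\<omega> / 2) * \<bar>t\<bar>) * norm (y 0))\<^sup>2"
    proof -
      have "(exp ((\<omega> / 2) * \<bar>t\<bar>))\<^sup>2 = exp (\<omega> * \<bar>t\<bar>)"
        by (simp add: power2_eq_square flip: exp_add)
      then show ?thesis using M by (simp add: power_mult_distrib)
    qed
    finally show ?thesis by (rule power2_le_imp_le) (use M in simp)
  qed
  moreover have "sqrt (m * M) > 0" using M by simp
  moreover have "\<omega> / 2 \<ge> 0" using \<omega> by simp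
  ultimately show ?thesis by blast
qed

text \<open>Here \<open>\<sigma> = 1 / s\<close> and \<open>\<kappa> = c\<^sup>2 / b\<close>. The three brackets of \<open>L\<close> come from multiplying the equation by
  \<open>w + \<kappa> v\<close>, \<open>v\<close> and \<open>A u\<close>; they dissipate \<open>\<gamma> w\<^sup>2\<close>, \<open>b q\<^sup>2\<close> and \<open>c\<^sup>2 p\<^sup>2\<close>, and \<open>L'\<close> is the derivative of
  \<open>L\<close> along a solution.\<close>

lemma mgt_lyapunov_bounds:
  assumes pos: "\<alpha> > 0" "c > 0" "\<delta> > 0" "\<gamma>0 > 0" "s0 > 0"
  shows "\<exists>k1 k2 c1 c2 c3 :: real. c1 > 0 \<and> c2 > 0 \<and> c3 > 0 \<and>
    (\<forall>\<tau> b \<kappa> \<gamma> \<sigma> p q r. 0 < \<tau> \<and> \<tau> \<le> 1 \<and> b = \<delta> + \<tau> * c\<^sup>2 \<and> \<kappa> * b = c\<^sup>2 \<and> \<gamma> = \<alpha> - \<kappa> * \<tau> \<and> \<gamma>0 < \<gamma> \<and>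
        0 < \<sigma> \<and> \<sigma> \<le> 1 / s0 \<longrightarrow>
      (let L = k1 * (b * (q + \<kappa> * \<sigma> * p)\<^sup>2 + \<tau> * (r + \<kappa> * \<sigma> * q)\<^sup>2 + \<kappa> * \<gamma> * \<sigma>\<^sup>2 * q\<^sup>2)
             + k2 * (c\<^sup>2 * \<sigma>\<^sup>2 * p\<^sup>2 / 2 + \<alpha> * \<sigma>\<^sup>2 * q\<^sup>2 / 2 + \<tau> * \<sigma> * r * q)
             + (b * p\<^sup>2 + 2 * \<alpha> * \<sigma> * p * q + 2 * \<tau> * p * r - \<tau> * q\<^sup>2);
           L' = k1 * (- 2 * \<gamma> * r\<^sup>2) + k2 * (- b * q\<^sup>2 + \<tau> * r\<^sup>2) + (- 2 * c\<^sup>2 * p\<^sup>2 + 2 * \<alpha> * q\<^sup>2)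
       in c1 * (p\<^sup>2 + q\<^sup>2 + \<tau> * r\<^sup>2) \<le> L \<and> L \<le> c2 * (p\<^sup>2 + q\<^sup>2 + \<tau> * r\<^sup>2) \<and> L' \<le> - c3 * (p\<^sup>2 + q\<^sup>2 + \<tau> * r\<^sup>2)))"
proof -
  \<comment> \<open>\<open>B\<close>, \<open>\<kappa>1\<close> and \<open>\<sigma>1\<close> bound
    \<open>b\<close>, \<open>\<kappa>\<close> and \<open>\<sigma>\<close> for all
    \<open>\<tau> \<le> 1\<close>. Together with \<open>\<delta> \<le> b\<close> and
    \<open>\<gamma>0 < \<gamma> \<le> \<alpha>\<close> they free every constant below from
    \<open>\<tau>\<close> and \<open>\<sigma>\<close>.\<close>
  define B where "B = \<delta> + c\<^sup>2"
  define \<kappa>1 where "\<kappa>1 = c\<^sup>2 / \<delta>"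
  define \<sigma>1 where "\<sigma>1 = 1 / s0"
  \<comment> \<open>This gives \<open>k2 * b \<ge> 2 * \<alpha> + 1\<close>, so the dissipation of
    the second bracket beats the term \<open>2 * \<alpha> * q\<^sup>2\<close> of the third with
    \<open>q\<^sup>2\<close> to spare.\<close>
  define k2 where "k2 = (2 * \<alpha> + 1) / \<delta>"
  \<comment> \<open>\<open>C1\<close> and \<open>C2\<close> are the amounts of
    \<open>q\<^sup>2\<close> and \<open>\<tau> * r\<^sup>2\<close> that the last two brackets may
    consume, plus a final 1 that survives in the lower bound.\<close>
  define C1 where "C1 = 4 * \<alpha>\<^sup>2 * \<sigma>1\<^sup>2 / \<delta> + 1 + k2 * \<sigma>1\<^sup>2 / 2 + 1"
  define C2 where "C2 = 4 / \<delta> + k2 / 2 + 1"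
  \<comment> \<open>Recovering \<open>q\<^sup>2\<close> borrows
    \<open>C1 * \<epsilon> = \<delta> / 4\<close> of \<open>p\<^sup>2\<close>, half of what the
    third bracket can offer.\<close>
  define \<epsilon> where "\<epsilon> = \<delta> / (4 * C1)"
  \<comment> \<open>One summand for each demand on the first bracket: its two shifted squares must
    cover \<open>C1\<close> and \<open>2 * C2\<close> of themselves, its last term must pay for
    undoing the shifts, and the dissipation of \<open>r\<^sup>2\<close> must exceed
    \<open>(k2 + 1) * r\<^sup>2\<close>.\<close>
  define k1 where "k1 = C1 / \<delta> + 2 * C2 + \<kappa>1 * (C1 / \<epsilon> + 2 * C2) / \<gamma>0 + (k2 + 1) / (2 * \<gamma>0)"
  define c2 where "c2 = k1 * (2 * B + 2 * B * \<kappa>1\<^sup>2 * \<sigma>1\<^sup>2 + 2 + 2 * \<kappa>1\<^sup>2 * \<sigma>1\<^sup>2 + \<kappa>1 * \<alpha> * \<sigma>1\<^sup>2)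
    + k2 * (c\<^sup>2 * \<sigma>1\<^sup>2 / 2 + \<alpha> * \<sigma>1\<^sup>2 / 2 + 1 / 2 + \<sigma>1\<^sup>2 / 2) + (B + \<alpha> * \<sigma>1 + 1)"
  have k: "\<kappa>1 > 0" "\<sigma>1 > 0" "k2 > 0" "B > 0"
    using pos by (auto simp: \<kappa>1_def \<sigma>1_def k2_def B_def add_pos_pos)
  have C: "C1 > 0" "C2 > 0"
    using k pos by (auto simp: C1_def C2_def intro!: add_pos_pos add_nonneg_pos)
  have \<epsilon>: "\<epsilon> > 0" using C pos by (simp add: \<epsilon>_def)
  have parts: "C1 / \<delta> > 0" "\<kappa>1 * (C1 / \<epsilon> + 2 * C2) / \<gamma>0 > 0" "(k2 + 1) / (2 * \<gamma>0) > 0"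
    using k C pos \<epsilon> by (auto intro!: divide_pos_pos mult_pos_pos add_pos_pos)
  then have k1: "k1 > 0" "k1 \<ge> C1 / \<delta>" "k1 \<ge> 2 * C2" "k1 \<ge> \<kappa>1 * (C1 / \<epsilon> + 2 * C2) / \<gamma>0" "k1 \<ge> (k2 + 1) / (2 * \<gamma>0)"
    using C unfolding k1_def by linarith+
  have c2: "c2 > 0"
    unfolding c2_def using k1 k pos by (intro add_pos_pos mult_pos_pos) (auto intro!: add_nonneg_pos add_pos_nonneg)
  show ?thesis
  proof (rule exI[of _ k1], rule exI[of _ k2], rule exI[of _ "min (\<delta> / 4) 1"], rule exI[of _ c2],
      rule exI[of _ "min (2 * c\<^sup>2) 1"], intro conjI allI impI)
    show "min (\<delta> / 4) 1 > 0" "c2 > 0" "min (2 * c\<^sup>2) 1 > 0" using pos c2 by auto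
    fix \<tau> b \<kappa> \<gamma> \<sigma> p q r :: real
    assume "0 < \<tau> \<and> \<tau> \<le> 1 \<and> b = \<delta> + \<tau> * c\<^sup>2 \<and> \<kappa> * b = c\<^sup>2 \<and> \<gamma> = \<alpha> - \<kappa> * \<tau> \<and> \<gamma>0 < \<gamma> \<and> 0 < \<sigma> \<and> \<sigma> \<le> 1 / s0"
    then have \<tau>: "0 < \<tau>" "\<tau> \<le> 1" and b_def: "b = \<delta> + \<tau> * c\<^sup>2" and \<kappa>b: "\<kappa> * b = c\<^sup>2"
      and \<gamma>_def: "\<gamma> = \<alpha> - \<kappa> * \<tau>" and \<gamma>: "\<gamma>0 < \<gamma>" and \<sigma>: "0 < \<sigma>" "\<sigma> \<le> \<sigma>1"
      by (auto simp: \<sigma>1_def)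
    have b: "\<delta> \<le> b" "b \<le> B" "b > 0"
      using \<tau> pos mult_right_mono[of \<tau> 1 "c\<^sup>2"] by (auto simp: b_def B_def intro: add_pos_nonneg)
    have \<kappa>: "\<kappa> > 0" "\<kappa> \<le> \<kappa>1"
    proof -
      have e: "\<kappa> = c\<^sup>2 / b" using \<kappa>b b by (simp add: field_simps)
      show "\<kappa> > 0" unfolding e using b pos by simp
      show "\<kappa> \<le> \<kappa>1" unfolding e \<kappa>1_def using b pos by (intro divide_left_mono) auto
    qed
    have \<gamma>le: "\<gamma> \<le> \<alpha>" using \<kappa> \<tau> by (simp add: \<gamma>_def)
    have \<sigma>2: "\<sigma>\<^sup>2 \<le> \<sigma>1\<^sup>2" using \<sigma> by (intro power_mono) auto
    have \<kappa>2: "\<kappa>\<^sup>2 \<le> \<kappa>1\<^sup>2" using \<kappa> by (intro power_mono) auto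
    define Y where "Y = q + \<kappa> * \<sigma> * p"
    define Z where "Z = r + \<kappa> * \<sigma> * q"
    define E where "E = b * Y\<^sup>2 + \<tau> * Z\<^sup>2 + \<kappa> * \<gamma> * \<sigma>\<^sup>2 * q\<^sup>2"
    define D where "D = c\<^sup>2 * \<sigma>\<^sup>2 * p\<^sup>2 / 2 + \<alpha> * \<sigma>\<^sup>2 * q\<^sup>2 / 2 + \<tau> * \<sigma> * r * q"
    define F where "F = b * p\<^sup>2 + 2 * \<alpha> * \<sigma> * p * q + 2 * \<tau> * p * r - \<tau> * q\<^sup>2"
    define L where "L = k1 * E + k2 * D + F"
    define L' where "L' = k1 * (- 2 * \<gamma> * r\<^sup>2) + k2 * (- b * q\<^sup>2 + \<tau> * r\<^sup>2) + (- 2 * c\<^sup>2 * p\<^sup>2 + 2 * \<alpha> * q\<^sup>2)"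
    define N where "N = p\<^sup>2 + q\<^sup>2 + \<tau> * r\<^sup>2"
    have \<tau>\<tau>: "\<tau> * \<tau> \<le> \<tau>" using \<tau> mult_left_mono[of \<tau> 1 \<tau>] by simp
    have rr: "\<tau> * r\<^sup>2 \<le> r\<^sup>2" using \<tau> mult_right_mono[of \<tau> 1 "r\<^sup>2"] by simp
    have decay: "L' \<le> - min (2 * c\<^sup>2) 1 * N"
    proof -
      have "k2 + 1 \<le> k1 * (2 * \<gamma>0)" using k1(5) pos by (simp add: divide_le_eq)
      also have "\<dots> \<le> k1 * (2 * \<gamma>)" using k1(1) \<gamma> by (intro mult_left_mono) auto
      finally have "(k2 + 1) * r\<^sup>2 \<le> k1 * (2 * \<gamma>) * r\<^sup>2" by (intro mult_right_mono) auto
      moreover have "k2 * (\<tau> * r\<^sup>2) \<le> k2 * r\<^sup>2" using rr k by (intro mult_left_mono) auto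
      moreover have "(2 * \<alpha> + 1) * q\<^sup>2 \<le> k2 * b * q\<^sup>2"
      proof (intro mult_right_mono)
        have "2 * \<alpha> + 1 = k2 * \<delta>" using pos by (simp add: k2_def)
        also have "\<dots> \<le> k2 * b" using k b by (intro mult_left_mono) auto
        finally show "2 * \<alpha> + 1 \<le> k2 * b" .
      qed simp
      ultimately have "L' \<le> - (2 * c\<^sup>2 * p\<^sup>2 + q\<^sup>2 + r\<^sup>2)"
        unfolding L'_def by (simp add: algebra_simps)
      moreover have "min (2 * c\<^sup>2) 1 * p\<^sup>2 \<le> 2 * c\<^sup>2 * p\<^sup>2" by (intro mult_right_mono) auto
      moreover have "min (2 * c\<^sup>2) 1 * q\<^sup>2 \<le> 1 * q\<^sup>2" by (intro mult_right_mono) auto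
      moreover have "min (2 * c\<^sup>2) 1 * (\<tau> * r\<^sup>2) \<le> 1 * (\<tau> * r\<^sup>2)" using \<tau> by (intro mult_right_mono) auto
      moreover have "min (2 * c\<^sup>2) 1 * N = min (2 * c\<^sup>2) 1 * p\<^sup>2 + min (2 * c\<^sup>2) 1 * q\<^sup>2 + min (2 * c\<^sup>2) 1 * (\<tau> * r\<^sup>2)"
        unfolding N_def by (simp only: distrib_left)
      ultimately show ?thesis using rr by simp
    qed
    have lower: "min (\<delta> / 4) 1 * N \<le> L"
    proof -
      \<comment> \<open>Half of \<open>b * p\<^sup>2\<close> is spent in two quarters, one completed
        square for each cross term containing \<open>p\<close>; the other half is kept.\<close>
      have F: "b / 2 * p\<^sup>2 - (4 * \<alpha>\<^sup>2 * \<sigma>1\<^sup>2 / \<delta> + 1) * q\<^sup>2 - 4 / \<delta> * (\<tau> * r\<^sup>2) \<le> F"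
      proof -
        have "0 \<le> b * (p / 2 + 2 * \<alpha> * \<sigma> * q / b)\<^sup>2" "0 \<le> b * (p / 2 + 2 * \<tau> * r / b)\<^sup>2"
          using b by auto
        moreover have "b * (p / 2 + 2 * \<alpha> * \<sigma> * q / b)\<^sup>2
            = b / 4 * p\<^sup>2 + 2 * \<alpha> * \<sigma> * p * q + 4 * \<alpha>\<^sup>2 * \<sigma>\<^sup>2 / b * q\<^sup>2"
          "b * (p / 2 + 2 * \<tau> * r / b)\<^sup>2 = b / 4 * p\<^sup>2 + 2 * \<tau> * p * r + 4 / b * (\<tau> * \<tau> * r\<^sup>2)"
          using b by (simp_all add: power2_eq_square field_simps)
        ultimately have "- (b / 4 * p\<^sup>2) - 4 * \<alpha>\<^sup>2 * \<sigma>\<^sup>2 / b * q\<^sup>2 \<le> 2 * \<alpha> * \<sigma> * p * q"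
          "- (b / 4 * p\<^sup>2) - 4 / b * (\<tau> * \<tau> * r\<^sup>2) \<le> 2 * \<tau> * p * r"
          by linarith+
        moreover have "4 * \<alpha>\<^sup>2 * \<sigma>\<^sup>2 / b * q\<^sup>2 \<le> 4 * \<alpha>\<^sup>2 * \<sigma>1\<^sup>2 / \<delta> * q\<^sup>2"
          using b pos \<sigma>2 by (intro mult_right_mono frac_le mult_left_mono) auto
        moreover have "4 / b * (\<tau> * \<tau> * r\<^sup>2) \<le> 4 / \<delta> * (\<tau> * r\<^sup>2)"
          using b pos \<tau> \<tau>\<tau> by (intro mult_mono frac_le mult_right_mono) auto
        moreover have "\<tau> * q\<^sup>2 \<le> 1 * q\<^sup>2" using \<tau> by (intro mult_right_mono) auto
        ultimately show ?thesis unfolding F_def by (simp add: algebra_simps)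
      qed
      have D: "- (\<sigma>1\<^sup>2 / 2 * q\<^sup>2) - \<tau> * r\<^sup>2 / 2 \<le> D"
      proof -
        have "0 \<le> \<tau> * (r + \<sigma> * q)\<^sup>2" using \<tau> by simp
        then have "- (\<tau> * (\<sigma>\<^sup>2 * q\<^sup>2)) / 2 - \<tau> * r\<^sup>2 / 2 \<le> \<tau> * \<sigma> * r * q"
          by (simp add: power2_eq_square algebra_simps)
        moreover have "\<tau> * (\<sigma>\<^sup>2 * q\<^sup>2) \<le> 1 * (\<sigma>1\<^sup>2 * q\<^sup>2)"
          using \<tau> \<sigma>2 by (intro mult_mono) auto
        moreover have "0 \<le> c\<^sup>2 * \<sigma>\<^sup>2 * p\<^sup>2 / 2" "0 \<le> \<alpha> * \<sigma>\<^sup>2 * q\<^sup>2 / 2" using pos by auto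
        ultimately show ?thesis unfolding D_def by linarith
      qed
      have kD: "k2 * (- (\<sigma>1\<^sup>2 / 2 * q\<^sup>2) - \<tau> * r\<^sup>2 / 2) \<le> k2 * D"
        using D k by (intro mult_left_mono) auto
      \<comment> \<open>Young's inequality undoes the shift in \<open>Y\<close>. The
        \<open>q\<^sup>2\<close> on the right carries the factor
        \<open>\<kappa>\<^sup>2 * \<sigma>\<^sup>2\<close> and is paid for by the last term of
        \<open>E\<close> rather than absorbed on the left.\<close>
      have q2: "q\<^sup>2 \<le> Y\<^sup>2 + \<epsilon> * p\<^sup>2 + \<kappa>\<^sup>2 * \<sigma>\<^sup>2 / \<epsilon> * q\<^sup>2"
      proof -
        have "0 \<le> \<epsilon> * (p + \<kappa> * \<sigma> * q / \<epsilon>)\<^sup>2" "0 \<le> (Y - q)\<^sup>2" using \<epsilon> by auto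
        moreover have "\<epsilon> * (p + \<kappa> * \<sigma> * q / \<epsilon>)\<^sup>2 = \<epsilon> * p\<^sup>2 + 2 * \<kappa> * \<sigma> * p * q + \<kappa>\<^sup>2 * \<sigma>\<^sup>2 / \<epsilon> * q\<^sup>2"
          using \<epsilon> by (simp add: power2_eq_square field_simps)
        moreover have "(Y - q)\<^sup>2 = Y\<^sup>2 + q\<^sup>2 - 2 * Y * q"
          by (simp add: power2_eq_square algebra_simps)
        moreover have "2 * Y * q = 2 * q\<^sup>2 + 2 * \<kappa> * \<sigma> * p * q"
          by (simp add: Y_def power2_eq_square algebra_simps)
        ultimately show ?thesis by linarith
      qed
      have r2: "\<tau> * r\<^sup>2 \<le> 2 * (\<tau> * Z\<^sup>2) + 2 * (\<kappa>\<^sup>2 * \<sigma>\<^sup>2 * q\<^sup>2)"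
      proof -
        have "0 \<le> (r + 2 * \<kappa> * \<sigma> * q)\<^sup>2" by simp
        then have "r\<^sup>2 \<le> 2 * Z\<^sup>2 + 2 * (\<kappa>\<^sup>2 * \<sigma>\<^sup>2 * q\<^sup>2)"
          by (simp add: Z_def power2_eq_square algebra_simps)
        then have "\<tau> * r\<^sup>2 \<le> \<tau> * (2 * Z\<^sup>2 + 2 * (\<kappa>\<^sup>2 * \<sigma>\<^sup>2 * q\<^sup>2))" using \<tau> by (intro mult_left_mono) auto
        also have "\<tau> * (2 * (\<kappa>\<^sup>2 * \<sigma>\<^sup>2 * q\<^sup>2)) \<le> 1 * (2 * (\<kappa>\<^sup>2 * \<sigma>\<^sup>2 * q\<^sup>2))"
          using \<tau> by (intro mult_right_mono) auto
        then have "\<tau> * (2 * Z\<^sup>2 + 2 * (\<kappa>\<^sup>2 * \<sigma>\<^sup>2 * q\<^sup>2)) \<le> 2 * (\<tau> * Z\<^sup>2) + 2 * (\<kappa>\<^sup>2 * \<sigma>\<^sup>2 * q\<^sup>2)"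
          by (simp add: algebra_simps)
        finally show ?thesis .
      qed
      have "C1 * q\<^sup>2 \<le> C1 * (Y\<^sup>2 + \<epsilon> * p\<^sup>2 + \<kappa>\<^sup>2 * \<sigma>\<^sup>2 / \<epsilon> * q\<^sup>2)"
        "C2 * (\<tau> * r\<^sup>2) \<le> C2 * (2 * (\<tau> * Z\<^sup>2) + 2 * (\<kappa>\<^sup>2 * \<sigma>\<^sup>2 * q\<^sup>2))"
        using q2 r2 C by (auto intro!: mult_left_mono)
      moreover have "C1 * (\<epsilon> * p\<^sup>2) = \<delta> / 4 * p\<^sup>2" using C by (simp add: \<epsilon>_def)
      moreover have "C1 * Y\<^sup>2 \<le> k1 * (b * Y\<^sup>2)"
      proof -
        have "C1 \<le> k1 * \<delta>" using k1(2) pos by (simp add: divide_le_eq)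
        also have "\<dots> \<le> k1 * b" using k1 b by (intro mult_left_mono) auto
        finally have "C1 * Y\<^sup>2 \<le> k1 * b * Y\<^sup>2" by (intro mult_right_mono) auto
        then show ?thesis by (simp add: mult.assoc)
      qed
      moreover have "2 * C2 * (\<tau> * Z\<^sup>2) \<le> k1 * (\<tau> * Z\<^sup>2)"
        using k1(3) \<tau> by (intro mult_right_mono) auto
      \<comment> \<open>The error has two factors \<open>\<kappa>\<close>, while \<open>E\<close>
        offers \<open>\<kappa> * \<gamma>\<close>: one \<open>\<kappa>\<close> is bounded by
        \<open>\<kappa>1\<close> and traded for \<open>\<gamma>\<close>, which is possible because
        \<open>\<gamma>\<close> stays above \<open>\<gamma>0\<close>.\<close>
      moreover have "(C1 / \<epsilon> + 2 * C2) * (\<kappa>\<^sup>2 * \<sigma>\<^sup>2 * q\<^sup>2) \<le> k1 * (\<kappa> * \<gamma> * \<sigma>\<^sup>2 * q\<^sup>2)"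
      proof -
        have "\<kappa> * (C1 / \<epsilon> + 2 * C2) \<le> \<kappa>1 * (C1 / \<epsilon> + 2 * C2)"
          using \<kappa> C \<epsilon> by (intro mult_right_mono) auto
        also have "\<dots> \<le> k1 * \<gamma>0" using k1(4) pos by (simp add: divide_le_eq)
        also have "\<dots> \<le> k1 * \<gamma>" using k1 \<gamma> by (intro mult_left_mono) auto
        finally have "\<kappa> * (C1 / \<epsilon> + 2 * C2) * (\<kappa> * \<sigma>\<^sup>2 * q\<^sup>2) \<le> k1 * \<gamma> * (\<kappa> * \<sigma>\<^sup>2 * q\<^sup>2)"
          using \<kappa> by (intro mult_right_mono) auto
        then show ?thesis by (simp add: power2_eq_square mult_ac)
      qed
      moreover have "k1 * E = k1 * (b * Y\<^sup>2) + k1 * (\<tau> * Z\<^sup>2) + k1 * (\<kappa> * \<gamma> * \<sigma>\<^sup>2 * q\<^sup>2)"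
        by (simp add: E_def algebra_simps)
      moreover have "(C1 / \<epsilon> + 2 * C2) * (\<kappa>\<^sup>2 * \<sigma>\<^sup>2 * q\<^sup>2)
          = C1 * (\<kappa>\<^sup>2 * \<sigma>\<^sup>2 / \<epsilon> * q\<^sup>2) + C2 * (2 * (\<kappa>\<^sup>2 * \<sigma>\<^sup>2 * q\<^sup>2))"
        by (simp add: algebra_simps)
      ultimately have "C1 * q\<^sup>2 + C2 * (\<tau> * r\<^sup>2) \<le> k1 * E + \<delta> / 4 * p\<^sup>2"
        by (simp add: distrib_left)
      moreover have "C1 * q\<^sup>2 = (4 * \<alpha>\<^sup>2 * \<sigma>1\<^sup>2 / \<delta> + 1) * q\<^sup>2 + k2 * (\<sigma>1\<^sup>2 / 2 * q\<^sup>2) + q\<^sup>2"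
        "C2 * (\<tau> * r\<^sup>2) = 4 / \<delta> * (\<tau> * r\<^sup>2) + k2 * (\<tau> * r\<^sup>2 / 2) + \<tau> * r\<^sup>2"
        by (simp_all add: C1_def C2_def algebra_simps)
      moreover have "\<delta> / 2 * p\<^sup>2 \<le> b / 2 * p\<^sup>2" using b by (intro mult_right_mono) auto
      moreover have "k2 * (- (\<sigma>1\<^sup>2 / 2 * q\<^sup>2) - \<tau> * r\<^sup>2 / 2) = - (k2 * (\<sigma>1\<^sup>2 / 2 * q\<^sup>2)) - k2 * (\<tau> * r\<^sup>2 / 2)"
        by (simp add: algebra_simps)
      moreover have "\<delta> / 2 * p\<^sup>2 = \<delta> / 4 * p\<^sup>2 + \<delta> / 4 * p\<^sup>2" by simp
      ultimately have "\<delta> / 4 * p\<^sup>2 + q\<^sup>2 + \<tau> * r\<^sup>2 \<le> L"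
        using F kD unfolding L_def by linarith
      moreover have "min (\<delta> / 4) 1 * p\<^sup>2 \<le> \<delta> / 4 * p\<^sup>2" by (intro mult_right_mono) auto
      moreover have "min (\<delta> / 4) 1 * q\<^sup>2 \<le> 1 * q\<^sup>2" by (intro mult_right_mono) auto
      moreover have "min (\<delta> / 4) 1 * (\<tau> * r\<^sup>2) \<le> 1 * (\<tau> * r\<^sup>2)" using \<tau> by (intro mult_right_mono) auto
      moreover have "min (\<delta> / 4) 1 * N = min (\<delta> / 4) 1 * p\<^sup>2 + min (\<delta> / 4) 1 * q\<^sup>2 + min (\<delta> / 4) 1 * (\<tau> * r\<^sup>2)"
        unfolding N_def by (simp only: distrib_left)
      ultimately show ?thesis by linarith
    qed
    have upper: "L \<le> c2 * N"
    proof -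
      have N: "0 \<le> N" "p\<^sup>2 \<le> N" "q\<^sup>2 \<le> N" "\<tau> * r\<^sup>2 \<le> N" using \<tau> by (auto simp: N_def)
      have bd: "a * x \<le> a' * N" if "0 \<le> a" "a \<le> a'" "0 \<le> x" "x \<le> N" for a a' x
        using that by (intro mult_mono) auto
      have "E \<le> (2 * B + 2 * B * \<kappa>1\<^sup>2 * \<sigma>1\<^sup>2 + 2 + 2 * \<kappa>1\<^sup>2 * \<sigma>1\<^sup>2 + \<kappa>1 * \<alpha> * \<sigma>1\<^sup>2) * N"
      proof -
        have "0 \<le> b * (q - \<kappa> * \<sigma> * p)\<^sup>2" "0 \<le> \<tau> * (r - \<kappa> * \<sigma> * q)\<^sup>2" using b \<tau> by auto
        then have "b * Y\<^sup>2 \<le> (2 * b) * q\<^sup>2 + (2 * b * (\<kappa>\<^sup>2 * \<sigma>\<^sup>2)) * p\<^sup>2"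
          "\<tau> * Z\<^sup>2 \<le> 2 * (\<tau> * r\<^sup>2) + (2 * \<tau> * (\<kappa>\<^sup>2 * \<sigma>\<^sup>2)) * q\<^sup>2"
          by (simp_all add: Y_def Z_def power2_eq_square algebra_simps)
        moreover have "(2 * b) * q\<^sup>2 \<le> (2 * B) * N" using b N by (intro bd) auto
        moreover have "(2 * b * (\<kappa>\<^sup>2 * \<sigma>\<^sup>2)) * p\<^sup>2 \<le> (2 * B * (\<kappa>1\<^sup>2 * \<sigma>1\<^sup>2)) * N"
          using b N \<kappa>2 \<sigma>2 by (intro bd mult_mono) auto
        moreover have "2 * (\<tau> * r\<^sup>2) \<le> 2 * N" using N by simp
        moreover have "(2 * \<tau> * (\<kappa>\<^sup>2 * \<sigma>\<^sup>2)) * q\<^sup>2 \<le> (2 * 1 * (\<kappa>1\<^sup>2 * \<sigma>1\<^sup>2)) * N"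
          using \<tau> N \<kappa>2 \<sigma>2 by (intro bd mult_mono) auto
        moreover have "(\<kappa> * \<gamma> * \<sigma>\<^sup>2) * q\<^sup>2 \<le> (\<kappa>1 * \<alpha> * \<sigma>1\<^sup>2) * N"
          using \<kappa> \<gamma> pos \<gamma>le \<sigma>2 N by (intro bd mult_mono) auto
        ultimately show ?thesis unfolding E_def by (simp add: algebra_simps)
      qed
      then have "k1 * E \<le> k1 * ((2 * B + 2 * B * \<kappa>1\<^sup>2 * \<sigma>1\<^sup>2 + 2 + 2 * \<kappa>1\<^sup>2 * \<sigma>1\<^sup>2 + \<kappa>1 * \<alpha> * \<sigma>1\<^sup>2) * N)"
        using k1 by (intro mult_left_mono) auto
      moreover have "D \<le> (c\<^sup>2 * \<sigma>1\<^sup>2 / 2 + \<alpha> * \<sigma>1\<^sup>2 / 2 + 1 / 2 + \<sigma>1\<^sup>2 / 2) * N"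
      proof -
        have "0 \<le> \<tau> * (r - \<sigma> * q)\<^sup>2" using \<tau> by simp
        then have "\<tau> * \<sigma> * r * q \<le> (1 / 2) * (\<tau> * r\<^sup>2) + (\<tau> * \<sigma>\<^sup>2 / 2) * q\<^sup>2"
          by (simp add: power2_eq_square algebra_simps)
        moreover have "(1 / 2) * (\<tau> * r\<^sup>2) \<le> (1 / 2) * N" using N by simp
        moreover have "(\<tau> * \<sigma>\<^sup>2 / 2) * q\<^sup>2 \<le> (1 * \<sigma>1\<^sup>2 / 2) * N"
          using \<tau> N \<sigma>2 by (intro bd divide_right_mono mult_mono) auto
        moreover have "(c\<^sup>2 * \<sigma>\<^sup>2 / 2) * p\<^sup>2 \<le> (c\<^sup>2 * \<sigma>1\<^sup>2 / 2) * N"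
          using N \<sigma>2 by (intro bd divide_right_mono mult_mono) auto
        moreover have "(\<alpha> * \<sigma>\<^sup>2 / 2) * q\<^sup>2 \<le> (\<alpha> * \<sigma>1\<^sup>2 / 2) * N"
          using N \<sigma>2 pos by (intro bd divide_right_mono mult_mono) auto
        ultimately show ?thesis unfolding D_def by (simp add: algebra_simps)
      qed
      then have "k2 * D \<le> k2 * ((c\<^sup>2 * \<sigma>1\<^sup>2 / 2 + \<alpha> * \<sigma>1\<^sup>2 / 2 + 1 / 2 + \<sigma>1\<^sup>2 / 2) * N)"
        using k by (intro mult_left_mono) auto
      moreover have "F \<le> (B + \<alpha> * \<sigma>1 + 1) * N"
      proof -
        have "0 \<le> \<alpha> * \<sigma> * (p - q)\<^sup>2" "0 \<le> \<tau> * (p - r)\<^sup>2" using pos \<sigma> \<tau> by auto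
        then have "2 * \<alpha> * \<sigma> * p * q \<le> (\<alpha> * \<sigma>) * (p\<^sup>2 + q\<^sup>2)" "2 * \<tau> * p * r \<le> \<tau> * p\<^sup>2 + \<tau> * r\<^sup>2"
          by (simp_all add: power2_eq_square algebra_simps)
        moreover have "(\<alpha> * \<sigma>) * (p\<^sup>2 + q\<^sup>2) \<le> (\<alpha> * \<sigma>1) * N"
          using pos \<sigma> \<tau> by (intro bd mult_mono) (auto simp: N_def)
        moreover have "\<tau> * p\<^sup>2 \<le> 1 * p\<^sup>2" using \<tau> by (intro mult_right_mono) auto
        moreover have "p\<^sup>2 + \<tau> * r\<^sup>2 \<le> N" by (simp add: N_def)
        moreover have "b * p\<^sup>2 \<le> B * N" using b N by (intro bd) auto
        moreover have "0 \<le> \<tau> * q\<^sup>2" using \<tau> by simp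
        ultimately show ?thesis unfolding F_def by (simp add: algebra_simps)
      qed
      ultimately show ?thesis unfolding L_def c2_def by (simp add: distrib_right mult.assoc)
    qed
    show "let L = k1 * (b * (q + \<kappa> * \<sigma> * p)\<^sup>2 + \<tau> * (r + \<kappa> * \<sigma> * q)\<^sup>2 + \<kappa> * \<gamma> * \<sigma>\<^sup>2 * q\<^sup>2)
             + k2 * (c\<^sup>2 * \<sigma>\<^sup>2 * p\<^sup>2 / 2 + \<alpha> * \<sigma>\<^sup>2 * q\<^sup>2 / 2 + \<tau> * \<sigma> * r * q)
             + (b * p\<^sup>2 + 2 * \<alpha> * \<sigma> * p * q + 2 * \<tau> * p * r - \<tau> * q\<^sup>2);
           L' = k1 * (- 2 * \<gamma> * r\<^sup>2) + k2 * (- b * q\<^sup>2 + \<tau> * r\<^sup>2) + (- 2 * c\<^sup>2 * p\<^sup>2 + 2 * \<alpha> * q\<^sup>2)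
       in min (\<delta> / 4) 1 * (p\<^sup>2 + q\<^sup>2 + \<tau> * r\<^sup>2) \<le> L \<and> L \<le> c2 * (p\<^sup>2 + q\<^sup>2 + \<tau> * r\<^sup>2) \<and>
          L' \<le> - min (2 * c\<^sup>2) 1 * (p\<^sup>2 + q\<^sup>2 + \<tau> * r\<^sup>2)"
      using lower upper decay by (simp only: Let_def L_def E_def D_def F_def L'_def N_def Y_def Z_def)
  qed
qed

text \<open>The Lyapunov function lies between \<open>c1\<close> and \<open>c2\<close> times the
  energy, so Gronwall gives the rate \<open>c3 / c2\<close> at the cost of the factor
  \<open>c2 / c1\<close>. Frequencies stay above \<open>s0\<close> because the function contains
  weights \<open>1 / s\<close>.\<close>

lemma mgt_mode_decay:
  assumes pos: "\<alpha> > 0" "c > 0" "\<delta> > 0" "\<gamma>0 > 0" "s0 > 0"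
  shows "\<exists>M>0. \<exists>\<omega>>0. \<forall>\<tau> s y t. 0 < \<tau> \<and> \<tau> \<le> 1 \<and> \<gamma>0 < gamma_coeff \<alpha> c \<delta> \<tau> \<and> s0 \<le> s \<and> 0 \<le> t \<and>
      (\<forall>t. (y has_vector_derivative mgt_mode \<alpha> c (b_coeff c \<delta> \<tau>) \<tau> s (y t)) (at t)) \<longrightarrow>
      energy \<tau> (y t) \<le> M * exp (- \<omega> * t) * energy \<tau> (y 0)"
proof -
  obtain k1 k2 c1 c2 c3 :: real where c: "c1 > 0" "c2 > 0" "c3 > 0" and bounds:
    "\<forall>\<tau> b \<kappa> \<gamma> \<sigma> p q r. 0 < \<tau> \<and> \<tau> \<le> 1 \<and> b = \<delta> + \<tau> * c\<^sup>2 \<and> \<kappa> * b = c\<^sup>2 \<and> \<gamma> = \<alpha> - \<kappa> * \<tau> \<and> \<gamma>0 < \<gamma> \<and>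
        0 < \<sigma> \<and> \<sigma> \<le> 1 / s0 \<longrightarrow>
      (let L = k1 * (b * (q + \<kappa> * \<sigma> * p)\<^sup>2 + \<tau> * (r + \<kappa> * \<sigma> * q)\<^sup>2 + \<kappa> * \<gamma> * \<sigma>\<^sup>2 * q\<^sup>2)
             + k2 * (c\<^sup>2 * \<sigma>\<^sup>2 * p\<^sup>2 / 2 + \<alpha> * \<sigma>\<^sup>2 * q\<^sup>2 / 2 + \<tau> * \<sigma> * r * q)
             + (b * p\<^sup>2 + 2 * \<alpha> * \<sigma> * p * q + 2 * \<tau> * p * r - \<tau> * q\<^sup>2);
           L' = k1 * (- 2 * \<gamma> * r\<^sup>2) + k2 * (- b * q\<^sup>2 + \<tau> * r\<^sup>2) + (- 2 * c\<^sup>2 * p\<^sup>2 + 2 * \<alpha> * q\<^sup>2)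
       in c1 * (p\<^sup>2 + q\<^sup>2 + \<tau> * r\<^sup>2) \<le> L \<and> L \<le> c2 * (p\<^sup>2 + q\<^sup>2 + \<tau> * r\<^sup>2) \<and> L' \<le> - c3 * (p\<^sup>2 + q\<^sup>2 + \<tau> * r\<^sup>2))"
    using mgt_lyapunov_bounds[OF pos] by auto
  have "energy \<tau> (y t) \<le> c2 / c1 * exp (- (c3 / c2) * t) * energy \<tau> (y 0)"
    if \<tau>: "0 < \<tau>" "\<tau> \<le> 1" and \<gamma>0: "\<gamma>0 < gamma_coeff \<alpha> c \<delta> \<tau>" and s: "s0 \<le> s" and t: "0 \<le> t"
      and y: "\<forall>t. (y has_vector_derivative mgt_mode \<alpha> c (b_coeff c \<delta> \<tau>) \<tau> s (y t)) (at t)"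
    for \<tau> s y t
  proof -
    define p q r where "p t = fst (y t)" and "q t = fst (snd (y t))" and "r t = snd (snd (y t))" for t
    define b where "b = b_coeff c \<delta> \<tau>"
    define \<kappa> where "\<kappa> = c\<^sup>2 / b"
    define \<gamma> where "\<gamma> = \<alpha> - \<kappa> * \<tau>"
    define \<sigma> where "\<sigma> = 1 / s"
    define r' where "r' t = - (c\<^sup>2 * p t + b * s * q t + \<alpha> * r t) / \<tau>" for t
    have d: "(p has_real_derivative s * q t) (at t)" "(q has_real_derivative s * r t) (at t)"
      "(r has_real_derivative r' t) (at t)" for t
      using mgt_mode_components[OF y[rule_format]] unfolding p_def q_def r_def r'_def b_def by auto
    have b: "b > 0" "b = \<delta> + \<tau> * c\<^sup>2" using \<tau> pos by (auto simp: b_def b_coeff_def intro: add_pos_nonneg)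
    have \<kappa>: "\<kappa> * b = c\<^sup>2" using b by (simp add: \<kappa>_def)
    have \<gamma>: "\<gamma>0 < \<gamma>"
      using \<gamma>0 by (simp add: gamma_coeff_def \<gamma>_def \<kappa>_def b_def divide_inverse mult_ac)
    have \<sigma>: "0 < \<sigma>" "\<sigma> \<le> 1 / s0" "\<sigma> * s = 1"
      using s pos unfolding \<sigma>_def by (auto intro!: divide_left_mono)
    \<comment> \<open>Clearing the denominator and substituting
      \<open>c\<^sup>2 = \<kappa> * b\<close> and
      \<open>\<alpha> = \<gamma> + \<kappa> * \<tau>\<close> makes the derivative identities
      polynomial consequences of \<open>\<sigma> * s = 1\<close>.\<close>
    have r': "\<tau> * r' t = - (\<kappa> * b * p t + b * s * q t + (\<gamma> + \<kappa> * \<tau>) * r t)" for t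
      using \<tau> unfolding r'_def \<kappa> \<gamma>_def by simp
    define E where "E t = b * (q t + \<kappa> * \<sigma> * p t)\<^sup>2 + \<tau> * (r t + \<kappa> * \<sigma> * q t)\<^sup>2 + \<kappa> * \<gamma> * \<sigma>\<^sup>2 * (q t)\<^sup>2" for t
    define D where "D t = c\<^sup>2 * \<sigma>\<^sup>2 * (p t)\<^sup>2 / 2 + \<alpha> * \<sigma>\<^sup>2 * (q t)\<^sup>2 / 2 + \<tau> * \<sigma> * r t * q t" for t
    define F where "F t = b * (p t)\<^sup>2 + 2 * \<alpha> * \<sigma> * p t * q t + 2 * \<tau> * p t * r t - \<tau> * (q t)\<^sup>2" for t
    \<comment> \<open>As \<open>\<kappa> * b = c\<^sup>2\<close>, the force
      \<open>c\<^sup>2 * p + b * s * q\<close> equals \<open>b * s\<close> times the shifted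
      variable \<open>q + \<kappa> * \<sigma> * p\<close>; all mixed terms then cancel and only
      \<open>- 2 * \<gamma> * r\<^sup>2\<close> remains.\<close>
    have E: "(E has_real_derivative - 2 * \<gamma> * (r t)\<^sup>2) (at t)" for t
    proof -
      have "(E has_real_derivative
          2 * b * (q t + \<kappa> * \<sigma> * p t) * (s * r t + \<kappa> * \<sigma> * (s * q t))
          + 2 * \<tau> * (r t + \<kappa> * \<sigma> * q t) * (r' t + \<kappa> * \<sigma> * (s * r t))
          + 2 * \<kappa> * \<gamma> * \<sigma>\<^sup>2 * q t * (s * r t)) (at t)"
        unfolding E_def[abs_def] by (rule derivative_eq_intros refl d)+ (simp add: algebra_simps)
      moreover have "2 * b * (q t + \<kappa> * \<sigma> * p t) * (s * r t + \<kappa> * \<sigma> * (s * q t))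
          + 2 * \<tau> * (r t + \<kappa> * \<sigma> * q t) * (r' t + \<kappa> * \<sigma> * (s * r t))
          + 2 * \<kappa> * \<gamma> * \<sigma>\<^sup>2 * q t * (s * r t) = - 2 * \<gamma> * (r t)\<^sup>2"
        using \<sigma>(3) r'[of t] by algebra
      ultimately show ?thesis by simp
    qed
    have D: "(D has_real_derivative - b * (q t)\<^sup>2 + \<tau> * (r t)\<^sup>2) (at t)" for t
    proof -
      define k3 k4 where "k3 = c\<^sup>2 * \<sigma>\<^sup>2 / 2" and "k4 = \<alpha> * \<sigma>\<^sup>2 / 2"
      have "D = (\<lambda>t. k3 * (p t)\<^sup>2 + k4 * (q t)\<^sup>2 + \<tau> * \<sigma> * r t * q t)"
        by (simp add: D_def k3_def k4_def fun_eq_iff)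
      then have "(D has_real_derivative
          2 * k3 * p t * (s * q t) + 2 * k4 * q t * (s * r t)
          + \<tau> * \<sigma> * (r' t * q t + r t * (s * r t))) (at t)"
        apply (simp only:)
        by (rule derivative_eq_intros refl d)+ (simp add: algebra_simps)
      moreover have "2 * k3 = c\<^sup>2 * \<sigma>\<^sup>2" "2 * k4 = \<alpha> * \<sigma>\<^sup>2" by (auto simp: k3_def k4_def)
      moreover have "c\<^sup>2 * \<sigma>\<^sup>2 * p t * (s * q t) + \<alpha> * \<sigma>\<^sup>2 * q t * (s * r t)
          + \<tau> * \<sigma> * (r' t * q t + r t * (s * r t)) = - b * (q t)\<^sup>2 + \<tau> * (r t)\<^sup>2"
        using \<sigma>(3) r'[of t] \<kappa> \<gamma>_def by algebra
      ultimately show ?thesis by simp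
    qed
    have F: "(F has_real_derivative - 2 * c\<^sup>2 * (p t)\<^sup>2 + 2 * \<alpha> * (q t)\<^sup>2) (at t)" for t
    proof -
      have "(F has_real_derivative
          2 * b * p t * (s * q t) + 2 * \<alpha> * \<sigma> * (s * q t * q t + p t * (s * r t))
          + 2 * \<tau> * (s * q t * r t + p t * r' t) - 2 * \<tau> * q t * (s * r t)) (at t)"
        unfolding F_def[abs_def] by (rule derivative_eq_intros refl d)+ (simp add: algebra_simps)
      moreover have "2 * b * p t * (s * q t) + 2 * \<alpha> * \<sigma> * (s * q t * q t + p t * (s * r t))
          + 2 * \<tau> * (s * q t * r t + p t * r' t) - 2 * \<tau> * q t * (s * r t)
          = - 2 * c\<^sup>2 * (p t)\<^sup>2 + 2 * \<alpha> * (q t)\<^sup>2"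
        using \<sigma>(3) r'[of t] \<kappa> \<gamma>_def by algebra
      ultimately show ?thesis by simp
    qed
    define L where "L t = k1 * E t + k2 * D t + F t" for t
    define L' where "L' t = k1 * (- 2 * \<gamma> * (r t)\<^sup>2) + k2 * (- b * (q t)\<^sup>2 + \<tau> * (r t)\<^sup>2)
      + (- 2 * c\<^sup>2 * (p t)\<^sup>2 + 2 * \<alpha> * (q t)\<^sup>2)" for t
    have L: "(L has_real_derivative L' t) (at t)" for t
      unfolding L_def[abs_def] L'_def by (intro DERIV_add DERIV_cmult E D F)
    have en: "energy \<tau> (y t) = (p t)\<^sup>2 + (q t)\<^sup>2 + \<tau> * (r t)\<^sup>2" for t
      by (simp add: energy_def case_prod_beta p_def q_def r_def)
    have b3: "c1 * energy \<tau> (y t) \<le> L t" "L t \<le> c2 * energy \<tau> (y t)" "L' t \<le> - c3 * energy \<tau> (y t)" for t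
      using bounds[rule_format, of \<tau> b \<kappa> \<gamma> \<sigma> "q t" "p t" "r t"] \<tau> b \<kappa> \<gamma>_def \<gamma> \<sigma>
      unfolding Let_def L_def L'_def E_def D_def F_def en by blast+
    have "L' t \<le> - (c3 / c2) * L t" for t
    proof -
      have "(c3 / c2) * L t \<le> (c3 / c2) * (c2 * energy \<tau> (y t))"
        using b3(2) c by (intro mult_left_mono) auto
      then show ?thesis using b3(3)[of t] c by simp
    qed
    from gronwall[OF L this t]
    have Lt: "L t \<le> exp (- (c3 / c2) * t) * L 0" .
    have "c1 * energy \<tau> (y t) \<le> L t" by (rule b3)
    also note Lt
    also have "exp (- (c3 / c2) * t) * L 0 \<le> exp (- (c3 / c2) * t) * (c2 * energy \<tau> (y 0))"
      using b3(2) by (intro mult_left_mono) auto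
    finally show ?thesis using c by (simp add: field_simps)
  qed
  then show ?thesis
    using c by (intro exI[of _ "c2 / c1"] exI[of _ "c3 / c2"] conjI) (auto simp del: minus_divide_left)
qed

section \<open>Groups that act mode by mode\<close>

text \<open>The quotient form matches the limit in the definition of a generator.\<close>

lemma has_vector_derivative_iff_quotient:
  "(f has_vector_derivative D) (at x) \<longleftrightarrow> ((\<lambda>h. (1 / h) *\<^sub>R (f (x + h) - f x)) \<longlongrightarrow> D) (at 0)"
proof -
  have eq: "norm (f (x + h) - f x - h *\<^sub>R D) / norm h = norm ((1 / h) *\<^sub>R (f (x + h) - f x) - D)"
    if "h \<noteq> 0" for h
  proof -
    have "(1 / h) *\<^sub>R (f (x + h) - f x) - D = (1 / h) *\<^sub>R (f (x + h) - f x - h *\<^sub>R D)"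
      using that by (simp add: scaleR_diff_right)
    then show ?thesis by simp
  qed
  have "(f has_vector_derivative D) (at x) \<longleftrightarrow> ((\<lambda>h. norm (f (x + h) - f x - h *\<^sub>R D) / norm h) \<longlongrightarrow> 0) (at 0)"
    by (simp add: has_vector_derivative_def has_derivative_at bounded_linear_scaleR_left)
  also have "\<dots> \<longleftrightarrow> ((\<lambda>h. norm ((1 / h) *\<^sub>R (f (x + h) - f x) - D)) \<longlongrightarrow> 0) (at 0)"
    by (intro filterlim_cong refl) (use eq in \<open>auto simp: eventually_at_filter\<close>)
  finally show ?thesis by (simp add: tendsto_norm_zero_iff LIM_zero_iff)
qed

text \<open>Dominated convergence along a filter: a finite \<open>J\<close> carries all but
  \<open>\<epsilon> / 2\<close> of the majorant, and on \<open>J\<close> the pointwise limits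
  suffice.\<close>

lemma has_sum_tendsto_0_dominated:
  fixes f :: "'b \<Rightarrow> 'i \<Rightarrow> real"
  assumes lim: "\<And>i. i \<in> I \<Longrightarrow> ((\<lambda>h. f h i) \<longlongrightarrow> 0) F"
    and bound: "\<forall>\<^sub>F h in F. (\<forall>i\<in>I. 0 \<le> f h i \<and> f h i \<le> g i) \<and> (f h has_sum S h) I"
    and g: "g summable_on I"
  shows "(S \<longlongrightarrow> 0) F"
proof (rule tendstoI)
  fix \<epsilon> :: real assume \<epsilon>: "\<epsilon> > 0"
  obtain G where G: "(g has_sum G) I" using g by (auto simp: summable_on_def)
  obtain J where J: "finite J" "J \<subseteq> I" "dist (\<Sum>i\<in>J. g i) G \<le> \<epsilon> / 2"
    using has_sum_finite_approximation[OF G, of "\<epsilon> / 2"] \<epsilon> by auto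
  have "((\<lambda>h. \<Sum>i\<in>J. f h i) \<longlongrightarrow> (\<Sum>i\<in>J. 0)) F"
    using J lim by (intro tendsto_sum) auto
  then have "\<forall>\<^sub>F h in F. (\<Sum>i\<in>J. f h i) < \<epsilon> / 2"
    using \<epsilon> by (intro order_tendstoD(2)) auto
  with bound show "\<forall>\<^sub>F h in F. dist (S h) 0 < \<epsilon>"
  proof eventually_elim
    case (elim h)
    then have fg: "0 \<le> f h i" "f h i \<le> g i" if "i \<in> I" for i
      using that by auto
    have g0: "0 \<le> g i" if "i \<in> I" for i using fg[OF that] by linarith
    have "S h \<ge> 0" using elim fg by (auto intro: has_sum_nonneg)
    moreover have "S h \<le> (\<Sum>i\<in>J. f h i) + (G - (\<Sum>i\<in>J. g i))"
    proof (rule has_sum_le_finite_sums)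
      show "(f h has_sum S h) I" using elim by blast
      fix K assume K: "finite K" "K \<subseteq> I"
      have "sum (f h) K \<le> sum (f h) (J \<union> (K - J))"
        using K J fg by (intro sum_mono2) auto
      also have "\<dots> = sum (f h) J + sum (f h) (K - J)"
        using K J by (intro sum.union_disjoint) auto
      also have "sum (f h) (K - J) \<le> sum g (K - J)"
        using K fg by (intro sum_mono) auto
      also have "sum g (K - J) = sum g (J \<union> (K - J)) - sum g J"
        using K J by (subst sum.union_disjoint) auto
      also have "sum g (J \<union> (K - J)) \<le> G"
        using K J g0 by (intro finite_sum_le_has_sum[OF G]) auto
      finally show "sum (f h) K \<le> (\<Sum>i\<in>J. f h i) + (G - (\<Sum>i\<in>J. g i))" by simp
    qed
    moreover have "G - (\<Sum>i\<in>J. g i) \<le> \<epsilon> / 2"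
      using J(3) unfolding dist_real_def by linarith
    ultimately show ?case using elim by (simp add: dist_real_def)
  qed
qed

text \<open>\<open>\<Phi>\<close> is an isometric isomorphism onto the square-summable families in
  \<open>'a\<close>; surjectivity, \<open>coord_exists\<close>, stands in for completeness. The norm
  \<open>N\<close> is independent of any topology on the type.\<close>

locale l2_coordinates =
  fixes X :: "'v::real_vector set" and N :: "'v \<Rightarrow> real"
    and I :: "'i set" and \<Phi> :: "'v \<Rightarrow> 'i \<Rightarrow> 'a::euclidean_space"
  assumes subspace_X: "subspace X"
    and coord_add: "\<lbrakk>x \<in> X; y \<in> X; i \<in> I\<rbrakk> \<Longrightarrow> \<Phi> (x + y) i = \<Phi> x i + \<Phi> y i"
    and coord_scale: "\<lbrakk>x \<in> X; i \<in> I\<rbrakk> \<Longrightarrow> \<Phi> (a *\<^sub>R x) i = a *\<^sub>R \<Phi> x i"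
    and coord_zeroD: "\<lbrakk>x \<in> X; \<And>i. i \<in> I \<Longrightarrow> \<Phi> x i = 0\<rbrakk> \<Longrightarrow> x = 0"
    and N_nonneg: "x \<in> X \<Longrightarrow> 0 \<le> N x"
    and N_has_sum: "x \<in> X \<Longrightarrow> ((\<lambda>i. (norm (\<Phi> x i))\<^sup>2) has_sum (N x)\<^sup>2) I"
    and coord_exists: "(\<lambda>i. (norm (f i))\<^sup>2) summable_on I \<Longrightarrow> \<exists>x\<in>X. \<forall>i\<in>I. \<Phi> x i = f i"
begin

lemma coord_diff: "\<lbrakk>x \<in> X; y \<in> X; i \<in> I\<rbrakk> \<Longrightarrow> \<Phi> (x - y) i = \<Phi> x i - \<Phi> y i"
  using coord_add[of x "(-1) *\<^sub>R y" i] coord_scale[of y i "-1"] subspace_scale[OF subspace_X, of y "-1"]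
  by simp

lemma coord_eqI:
  assumes "x \<in> X" "y \<in> X" "\<And>i. i \<in> I \<Longrightarrow> \<Phi> x i = \<Phi> y i"
  shows "x = y"
  using coord_zeroD[of "x - y"] coord_diff subspace_diff[OF subspace_X] assms by simp

lemma norm_coord_le: 
  assumes "x \<in> X" "i \<in> I"
  shows "norm (\<Phi> x i) \<le> N x"
proof -
  have "(\<Sum>j\<in>{i}. (norm (\<Phi> x j))\<^sup>2) \<le> (N x)\<^sup>2"
    using assms by (intro finite_sum_le_has_sum[OF N_has_sum]) auto
  then show ?thesis using N_nonneg[OF assms(1)] by (auto intro: power2_le_imp_le)
qed

lemma N_le:
  assumes "x \<in> X" "y \<in> X" "K \<ge> 0" "\<And>i. i \<in> I \<Longrightarrow> norm (\<Phi> x i) \<le> K * norm (\<Phi> y i)"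
  shows "N x \<le> K * N y"
proof (rule power2_le_imp_le)
  have "((\<lambda>i. K\<^sup>2 * (norm (\<Phi> y i))\<^sup>2) has_sum K\<^sup>2 * (N y)\<^sup>2) I"
    by (intro has_sum_cmult_right N_has_sum assms)
  then have "(N x)\<^sup>2 \<le> K\<^sup>2 * (N y)\<^sup>2"
    using power_mono[OF assms(4) norm_ge_zero, of _ 2]
    by (intro has_sum_mono[OF N_has_sum[OF assms(1)]]) (auto simp: power_mult_distrib)
  then show "(N x)\<^sup>2 \<le> (K * N y)\<^sup>2" by (simp add: power_mult_distrib)
  show "0 \<le> K * N y" using assms N_nonneg by auto
qed

text \<open>A fixed vector \<open>z\<close> supplies the square-summable majorant that turns
  coordinatewise limits into a limit in \<open>N\<close>.\<close>

lemma N_tendsto_0: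
  assumes "\<And>h. u h \<in> X" "z \<in> X"
    and lim: "\<And>i. i \<in> I \<Longrightarrow> ((\<lambda>h. \<Phi> (u h) i) \<longlongrightarrow> 0) F"
    and bound: "\<forall>\<^sub>F h in F. \<forall>i\<in>I. norm (\<Phi> (u h) i) \<le> K * norm (\<Phi> z i)"
  shows "((\<lambda>h. N (u h)) \<longlongrightarrow> 0) F"
proof -
  have "((\<lambda>h. (N (u h))\<^sup>2) \<longlongrightarrow> 0) F"
  proof (rule has_sum_tendsto_0_dominated)
    show "((\<lambda>h. (norm (\<Phi> (u h) i))\<^sup>2) \<longlongrightarrow> 0) F" if "i \<in> I" for i
      using tendsto_power[OF tendsto_norm[OF lim[OF that]], of 2] by simp
    show "(\<lambda>i. K\<^sup>2 * (norm (\<Phi> z i))\<^sup>2) summable_on I"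
      using N_has_sum[OF assms(2)] by (intro summable_on_cmult_right) (auto simp: summable_on_def)
    show "\<forall>\<^sub>F h in F. (\<forall>i\<in>I. 0 \<le> (norm (\<Phi> (u h) i))\<^sup>2 \<and> (norm (\<Phi> (u h) i))\<^sup>2 \<le> K\<^sup>2 * (norm (\<Phi> z i))\<^sup>2) \<and>
        ((\<lambda>i. (norm (\<Phi> (u h) i))\<^sup>2) has_sum (N (u h))\<^sup>2) I"
      using bound
    proof eventually_elim
      case (elim h)
      have "(norm (\<Phi> (u h) i))\<^sup>2 \<le> K\<^sup>2 * (norm (\<Phi> z i))\<^sup>2" if "i \<in> I" for i
        using power_mono[of "norm (\<Phi> (u h) i)" "K * norm (\<Phi> z i)" 2] elim that
        by (simp add: power_mult_distrib)
      then show ?case using N_has_sum assms(1) by simp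
    qed
  qed
  then have "((\<lambda>h. sqrt ((N (u h))\<^sup>2)) \<longlongrightarrow> sqrt 0) F"
    by (rule tendsto_real_sqrt)
  then show ?thesis using N_nonneg assms(1) by simp
qed

lemma truncation_exists:
  assumes "finite J"
  shows "\<exists>x\<in>X. \<forall>i\<in>I. \<Phi> x i = (if i \<in> J then f i else 0)"
proof (rule coord_exists, rule finite_nonzero_values_imp_summable_on)
  show "finite {i \<in> I. (norm (if i \<in> J then f i else 0))\<^sup>2 \<noteq> 0}"
    by (rule finite_subset[OF _ assms]) auto
qed

text \<open>Forcing a given \<open>i\<close> into \<open>J\<close> keeps that coordinate intact
  while the truncation approaches \<open>x\<close> in \<open>N\<close>.\<close>

lemma truncation_approximates:
  assumes x: "x \<in> X" and "\<epsilon> > 0" "i \<in> I"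
  shows "\<exists>J. finite J \<and> i \<in> J \<and>
    (\<forall>z\<in>X. (\<forall>i\<in>I. \<Phi> z i = (if i \<in> J then \<Phi> x i else 0)) \<longrightarrow> N (x - z) \<le> \<epsilon>)"
proof -
  let ?f = "\<lambda>i. (norm (\<Phi> x i))\<^sup>2"
  obtain J0 where J0: "finite J0" "J0 \<subseteq> I" "dist (sum ?f J0) ((N x)\<^sup>2) \<le> \<epsilon>\<^sup>2"
    using has_sum_finite_approximation[OF N_has_sum[OF x], of "\<epsilon>\<^sup>2"] assms by auto
  define J where "J = insert i J0"
  have J: "finite J" "J \<subseteq> I" "i \<in> J" using J0 assms by (auto simp: J_def)
  have "sum ?f J0 \<le> sum ?f J" using J0 by (intro sum_mono2) (auto simp: J_def)
  then have tail: "(N x)\<^sup>2 - sum ?f J \<le> \<epsilon>\<^sup>2" using J0(3) by (simp add: dist_real_def)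
  have "N (x - z) \<le> \<epsilon>" if z: "z \<in> X" "\<forall>i\<in>I. \<Phi> z i = (if i \<in> J then \<Phi> x i else 0)" for z
  proof (rule power2_le_imp_le)
    have xz: "x - z \<in> X" by (intro subspace_diff[OF subspace_X] x z)
    have "(N (x - z))\<^sup>2 \<le> (N x)\<^sup>2 - sum ?f J"
    proof (rule has_sum_le_finite_sums[OF N_has_sum[OF xz]])
      fix K assume K: "finite K" "K \<subseteq> I"
      have "(\<Sum>i\<in>K. (norm (\<Phi> (x - z) i))\<^sup>2) = sum ?f (K - J)"
        using K z x by (intro sum.mono_neutral_cong_right) (auto simp: coord_diff)
      also have "\<dots> = sum ?f (J \<union> (K - J)) - sum ?f J"
        using K J by (subst sum.union_disjoint) auto
      also have "sum ?f (J \<union> (K - J)) \<le> (N x)\<^sup>2"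
        using K J by (intro finite_sum_le_has_sum[OF N_has_sum[OF x]]) auto
      finally show "(\<Sum>i\<in>K. (norm (\<Phi> (x - z) i))\<^sup>2) \<le> (N x)\<^sup>2 - sum ?f J" by simp
    qed
    then show "(N (x - z))\<^sup>2 \<le> \<epsilon>\<^sup>2" using tail by linarith
  qed (use assms in simp)
  then show ?thesis using J by blast
qed

end

text \<open>\<open>op_iff\<close> gives \<open>A\<close> the maximal domain allowed by the
  coordinates. The maps \<open>G i\<close> need no common bound, as for an unbounded operator; only
  the growth of their solutions is uniform in \<open>i\<close>.\<close>

locale mode_system = l2_coordinates X N I \<Phi>
  for X :: "'v::real_vector set" and N I and \<Phi> :: "'v \<Rightarrow> 'i \<Rightarrow> 'a::euclidean_space" +
  fixes A :: "'v lop" and G :: "'i \<Rightarrow> 'a \<Rightarrow> 'a" and M \<omega> :: real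
  assumes op_iff: "x \<in> dom_op A \<and> y = app_op A x \<longleftrightarrow> x \<in> X \<and> y \<in> X \<and> (\<forall>i\<in>I. \<Phi> y i = G i (\<Phi> x i))"
    and bounded_linear_G: "bounded_linear (G i)"
    and M_nonneg: "0 \<le> M" and \<omega>_nonneg: "0 \<le> \<omega>"
    and growth: "\<lbrakk>i \<in> I; \<And>t. (g has_vector_derivative G i (g t)) (at t)\<rbrakk>
      \<Longrightarrow> norm (g t) \<le> M * exp (\<omega> * \<bar>t\<bar>) * norm (g 0)"
begin

section \<open>Flows of the single modes\<close>

definition flow :: "'i \<Rightarrow> real \<Rightarrow> 'a \<Rightarrow> 'a" where
  "flow i t x = (SOME y. y 0 = x \<and> (\<forall>t. (y has_vector_derivative G i (y t)) (at t))) t"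

lemma flow_0 [simp]: "flow i 0 x = x"
  and flow_derivative: "((\<lambda>t. flow i t x) has_vector_derivative G i (flow i t x)) (at t)"
  using someI_ex[OF linear_ode_exists[OF bounded_linear_G[of i], of x]]
  unfolding flow_def by auto

text \<open>The growth bound applied to the difference of two solutions, which starts at 0, is a
  uniqueness statement. Linearity, the group law and commutation with \<open>G i\<close> all follow
  from it.\<close>

lemma solution_eq_flow:
  assumes i: "i \<in> I" and y: "\<And>t. (y has_vector_derivative G i (y t)) (at t)"
  shows "y t = flow i t (y 0)"
proof -
  interpret G: bounded_linear "G i" by (rule bounded_linear_G)
  have "((\<lambda>t. y t - flow i t (y 0)) has_vector_derivative G i (y t - flow i t (y 0))) (at t)" for t
    using has_vector_derivative_diff[OF y flow_derivative] by (simp add: G.diff)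
  from growth[OF i this, of t] show ?thesis by simp
qed

lemma flow_add: "i \<in> I \<Longrightarrow> flow i t (x + y) = flow i t x + flow i t y"
  using solution_eq_flow[of i "\<lambda>t. flow i t x + flow i t y" t]
    has_vector_derivative_add[OF flow_derivative flow_derivative]
  by (simp add: linear_add[OF bounded_linear.linear[OF bounded_linear_G]])

lemma flow_scale: "i \<in> I \<Longrightarrow> flow i t (a *\<^sub>R x) = a *\<^sub>R flow i t x"
  using solution_eq_flow[of i "\<lambda>t. a *\<^sub>R flow i t x" t]
    bounded_linear.has_vector_derivative[OF bounded_linear_scaleR_right flow_derivative]
  by (simp add: linear_scale[OF bounded_linear.linear[OF bounded_linear_G]])

lemma flow_G: "i \<in> I \<Longrightarrow> flow i t (G i x) = G i (flow i t x)"
  using solution_eq_flow[of i "\<lambda>t. G i (flow i t x)" t]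
    bounded_linear.has_vector_derivative[OF bounded_linear_G flow_derivative]
  by simp

lemma flow_group: 
  assumes "i \<in> I"
  shows "flow i (s + t) x = flow i s (flow i t x)"
proof -
  have "((\<lambda>s. flow i (s + t) x) has_vector_derivative G i (flow i (s + t) x)) (at s)" for s
  proof -
    have "((\<lambda>s. s + t) has_vector_derivative 1) (at s)"
      by (auto intro!: derivative_eq_intros)
    from vector_diff_chain_at[OF this flow_derivative]
    show ?thesis by (simp add: comp_def)
  qed
  from solution_eq_flow[OF assms this] show ?thesis by simp
qed

lemma flow_bound: "i \<in> I \<Longrightarrow> norm (flow i t x) \<le> M * exp (\<omega> * \<bar>t\<bar>) * norm x"
  using growth[of i "\<lambda>t. flow i t x" t] flow_derivative by simp

lemma flow_bound_unit:
  assumes "i \<in> I" "\<bar>t\<bar> \<le> 1"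
  shows "norm (flow i t x) \<le> M * exp \<omega> * norm x"
proof -
  have "M * exp (\<omega> * \<bar>t\<bar>) * norm x \<le> M * exp (\<omega> * 1) * norm x"
    using assms M_nonneg \<omega>_nonneg by (intro mult_right_mono mult_left_mono) (auto intro: mult_left_le)
  then show ?thesis using flow_bound[OF assms(1), of t x] by simp
qed

text \<open>The bound is in terms of \<open>G i x\<close>, so that difference quotients are
  dominated by the coordinates of the image under the generator, uniformly in \<open>i\<close>. It
  is the mean value inequality, since the flow commutes with \<open>G i\<close>.\<close>

lemma flow_diff_bound:
  assumes i: "i \<in> I" and t: "\<bar>t\<bar> \<le> 1"
  shows "norm (flow i t x - x) \<le> M * exp \<omega> * norm (G i x) * \<bar>t\<bar>"
proof -
  have "norm (flow i t x - flow i 0 x) \<le> M * exp \<omega> * norm (G i x) * norm (t - 0)"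
  proof (rule differentiable_bound)
    show "((\<lambda>t. flow i t x) has_derivative (\<lambda>h. h *\<^sub>R G i (flow i s x))) (at s within {-1..1})" for s
      using has_vector_derivative_at_within[OF flow_derivative] by (simp add: has_vector_derivative_def)
    fix s :: real assume "s \<in> {-1..1}"
    then have "norm (G i (flow i s x)) \<le> M * exp \<omega> * norm (G i x)"
      using flow_bound_unit[OF i, of s "G i x"] by (auto simp: flow_G[OF i])
    then show "onorm (\<lambda>h. h *\<^sub>R G i (flow i s x)) \<le> M * exp \<omega> * norm (G i x)"
      by (intro onorm_le) (simp add: mult.commute[of "\<bar>_\<bar>"] mult_right_mono)
  qed (use t in auto)
  then show ?thesis by simp
qed

section \<open>The group assembled from the flows\<close>

definition group :: "real \<Rightarrow> 'v \<Rightarrow> 'v" where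
  "group t x = (SOME z. z \<in> X \<and> (\<forall>i\<in>I. \<Phi> z i = flow i t (\<Phi> x i)))"

lemma
  assumes x: "x \<in> X"
  shows group_in: "group t x \<in> X"
    and coord_group: "i \<in> I \<Longrightarrow> \<Phi> (group t x) i = flow i t (\<Phi> x i)"
proof -
  have "(\<lambda>i. (norm (flow i t (\<Phi> x i)))\<^sup>2) summable_on I"
  proof (rule summable_on_comparison_test)
    show "(\<lambda>i. (M * exp (\<omega> * \<bar>t\<bar>))\<^sup>2 * (norm (\<Phi> x i))\<^sup>2) summable_on I"
      using N_has_sum[OF x] by (intro summable_on_cmult_right) (auto simp: summable_on_def)
    show "(norm (flow i t (\<Phi> x i)))\<^sup>2 \<le> (M * exp (\<omega> * \<bar>t\<bar>))\<^sup>2 * (norm (\<Phi> x i))\<^sup>2" if "i \<in> I" for i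
      using power_mono[OF flow_bound[OF that], of t "\<Phi> x i" 2] by (simp add: power_mult_distrib)
  qed auto
  then have "\<exists>z. z \<in> X \<and> (\<forall>i\<in>I. \<Phi> z i = flow i t (\<Phi> x i))"
    using coord_exists[of "\<lambda>i. flow i t (\<Phi> x i)"] by blast
  from someI_ex[OF this]
  show "group t x \<in> X" "i \<in> I \<Longrightarrow> \<Phi> (group t x) i = flow i t (\<Phi> x i)"
    unfolding group_def by auto
qed

lemma eventually_at_0_abs_le_1: "\<forall>\<^sub>F h::real in at 0. \<bar>h\<bar> \<le> 1 \<and> h \<noteq> 0"
  unfolding eventually_at by (intro exI[of _ 1]) (auto simp: dist_real_def)

lemma flow_difference_quotient:
  "((\<lambda>h. (1 / h) *\<^sub>R (flow i h x - x)) \<longlongrightarrow> G i x) (at 0)"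
  using flow_derivative[of i x 0]
  by (simp add: has_vector_derivative_iff_quotient)

lemma C0_group_on_group: "C0_group_on X N group"
  unfolding C0_group_on_def
proof (intro conjI allI ballI)
  fix s t a :: real
  show "group t ` X \<subseteq> X" using group_in by blast
  show "group t (x + y) = group t x + group t y" if "x \<in> X" "y \<in> X" for x y
    using that subspace_add[OF subspace_X]
    by (intro coord_eqI) (auto simp: group_in coord_group coord_add flow_add)
  show "group t (a *\<^sub>R x) = a *\<^sub>R group t x" if "x \<in> X" for x
    using that subspace_scale[OF subspace_X]
    by (intro coord_eqI) (auto simp: group_in coord_group coord_scale flow_scale)
  have "N (group t x) \<le> M * exp (\<omega> * \<bar>t\<bar>) * N x" if "x \<in> X" for x
    using that M_nonneg by (intro N_le) (auto simp: group_in coord_group flow_bound)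
  then show "\<exists>K. \<forall>x\<in>X. N (group t x) \<le> K * N x" by blast
  show "group 0 x = x" if "x \<in> X" for x
    using that by (intro coord_eqI) (auto simp: group_in coord_group)
  show "group (s + t) x = group s (group t x)" if "x \<in> X" for x
    using that by (intro coord_eqI) (auto simp: group_in coord_group flow_group)
  show "((\<lambda>t. N (group t x - x)) \<longlongrightarrow> 0) (at 0)" if x: "x \<in> X" for x
  proof (rule N_tendsto_0[OF _ x])
    show "group h x - x \<in> X" for h by (intro subspace_diff[OF subspace_X] group_in x)
    show "((\<lambda>h. \<Phi> (group h x - x) i) \<longlongrightarrow> 0) (at 0)" if i: "i \<in> I" for i
    proof -
      have "isCont (\<lambda>h. flow i h (\<Phi> x i)) 0"
        using flow_derivative by (rule has_vector_derivative_continuous)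
      then have "((\<lambda>h. flow i h (\<Phi> x i) - \<Phi> x i) \<longlongrightarrow> 0) (at 0)"
        by (simp add: isCont_def LIM_zero_iff)
      then show ?thesis using x i by (simp add: coord_diff group_in coord_group)
    qed
    show "\<forall>\<^sub>F h in at 0. \<forall>i\<in>I. norm (\<Phi> (group h x - x) i) \<le> (M * exp \<omega> + 1) * norm (\<Phi> x i)"
      using eventually_at_0_abs_le_1
    proof eventually_elim
      case (elim h)
      have "norm (flow i h (\<Phi> x i) - \<Phi> x i) \<le> M * exp \<omega> * norm (\<Phi> x i) + norm (\<Phi> x i)" if "i \<in> I" for i
        using norm_triangle_ineq4[of "flow i h (\<Phi> x i)" "\<Phi> x i"] flow_bound_unit[OF that, of h "\<Phi> x i"] elim
        by linarith
      then show ?case using x by (auto simp: coord_diff group_in coord_group algebra_simps)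
    qed
  qed
qed

lemma coord_difference_quotient:
  assumes "x \<in> X" "y \<in> X" "i \<in> I"
  shows "(1 / h) *\<^sub>R (group h x - x) - y \<in> X"
    and "\<Phi> ((1 / h) *\<^sub>R (group h x - x) - y) i = (1 / h) *\<^sub>R (flow i h (\<Phi> x i) - \<Phi> x i) - \<Phi> y i"
proof -
  have *: "group h x - x \<in> X" "(1 / h) *\<^sub>R (group h x - x) \<in> X"
    by (intro subspace_diff[OF subspace_X] subspace_scale[OF subspace_X] group_in assms)+
  then show "(1 / h) *\<^sub>R (group h x - x) - y \<in> X"
    by (intro subspace_diff[OF subspace_X] assms(2))
  show "\<Phi> ((1 / h) *\<^sub>R (group h x - x) - y) i = (1 / h) *\<^sub>R (flow i h (\<Phi> x i) - \<Phi> x i) - \<Phi> y i"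
    using assms * by (simp only: coord_diff coord_scale coord_group group_in)
qed

text \<open>A limit in \<open>N\<close> is a limit of every coordinate, which puts \<open>x\<close>
  into the maximal domain. Conversely the image \<open>y\<close> itself dominates the difference
  quotients.\<close>

theorem generates_group: "generates_C0_group X N A group"
  unfolding generates_C0_group_def
proof (intro conjI ballI)
  show "C0_group_on X N group" by (rule C0_group_on_group)
  show "dom_op A \<subseteq> X" "app_op A ` dom_op A \<subseteq> X" using op_iff by blast+
  fix x y assume xy: "x \<in> X" "y \<in> X"
  let ?u = "\<lambda>h. (1 / h) *\<^sub>R (group h x - x) - y"
  have uX: "?u h \<in> X" for h
    by (intro subspace_diff[OF subspace_X] subspace_scale[OF subspace_X] group_in xy)
  show "((\<lambda>h. N (?u h)) \<longlongrightarrow> 0) (at 0) \<longleftrightarrow> x \<in> dom_op A \<and> y = app_op A x"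
  proof
    assume lim: "((\<lambda>h. N (?u h)) \<longlongrightarrow> 0) (at 0)"
    have "\<Phi> y i = G i (\<Phi> x i)" if i: "i \<in> I" for i
    proof -
      have "((\<lambda>h. \<Phi> (?u h) i) \<longlongrightarrow> 0) (at 0)"
        by (rule Lim_null_comparison[OF _ lim]) (simp add: norm_coord_le uX i)
      then have "((\<lambda>h. (1 / h) *\<^sub>R (flow i h (\<Phi> x i) - \<Phi> x i) - \<Phi> y i) \<longlongrightarrow> 0) (at 0)"
        by (simp only: coord_difference_quotient(2)[OF xy i])
      then have "((\<lambda>h. (1 / h) *\<^sub>R (flow i h (\<Phi> x i) - \<Phi> x i)) \<longlongrightarrow> \<Phi> y i) (at 0)"
        by (simp add: LIM_zero_iff)
      then show ?thesis
        using flow_difference_quotient[of i "\<Phi> x i"] by (intro tendsto_unique[OF _ _ ]) auto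
    qed
    then show "x \<in> dom_op A \<and> y = app_op A x" using op_iff xy by blast
  next
    assume "x \<in> dom_op A \<and> y = app_op A x"
    then have y: "\<Phi> y i = G i (\<Phi> x i)" if "i \<in> I" for i using op_iff that by blast
    show "((\<lambda>h. N (?u h)) \<longlongrightarrow> 0) (at 0)"
    proof (rule N_tendsto_0[OF uX xy(2)])
      show "((\<lambda>h. \<Phi> (?u h) i) \<longlongrightarrow> 0) (at 0)" if i: "i \<in> I" for i
        using flow_difference_quotient[of i "\<Phi> x i"]
        unfolding coord_difference_quotient(2)[OF xy i] y[OF i] by (simp add: LIM_zero_iff)
      show "\<forall>\<^sub>F h in at 0. \<forall>i\<in>I. norm (\<Phi> (?u h) i) \<le> (M * exp \<omega> + 1) * norm (\<Phi> y i)"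
        using eventually_at_0_abs_le_1
      proof eventually_elim
        case (elim h)
        show ?case
        proof
          fix i assume i: "i \<in> I"
          have "norm ((1 / h) *\<^sub>R (flow i h (\<Phi> x i) - \<Phi> x i)) \<le> M * exp \<omega> * norm (\<Phi> y i)"
            using flow_diff_bound[OF i, of h "\<Phi> x i"] elim by (simp add: y[OF i] divide_le_eq)
          then show "norm (\<Phi> (?u h) i) \<le> (M * exp \<omega> + 1) * norm (\<Phi> y i)"
            unfolding coord_difference_quotient(2)[OF xy i]
            using norm_triangle_ineq4[of "(1 / h) *\<^sub>R (flow i h (\<Phi> x i) - \<Phi> x i)" "\<Phi> y i"]
            by (simp add: distrib_right)
        qed
      qed
    qed
  qed
qed

text \<open>On the domain the generator commutes with \<open>T t\<close>, so each coordinate of an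
  orbit solves its mode equation. Finite truncations lie in the domain, and boundedness of
  \<open>T t\<close> carries the identity over to all of \<open>X\<close>.\<close>

theorem coord_generated_group:
  assumes T: "generates_C0_group X N A T" and x: "x \<in> X" and i: "i \<in> I"
  shows "\<Phi> (T t x) i = flow i t (\<Phi> x i)"
proof -
  have gen: "((\<lambda>h. N ((1 / h) *\<^sub>R (T h x - x) - y)) \<longlongrightarrow> 0) (at 0) \<longleftrightarrow> x \<in> dom_op A \<and> y = app_op A x"
    if "x \<in> X" "y \<in> X" for x y
    using T that by (simp add: generates_C0_group_def)
  have C0: "C0_group_on X N T" using T by (simp add: generates_C0_group_def)
  then have "T t ` X \<subseteq> X" for t
    by (simp add: C0_group_on_def)
  then have TX: "T t x \<in> X" if "x \<in> X" for t x
    using that by blast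
  have Tadd: "T t (x + y) = T t x + T t y" if "x \<in> X" "y \<in> X" for t x y
    using C0 that by (simp_all add: C0_group_on_def)
  have Tscale: "T t (a *\<^sub>R x) = a *\<^sub>R T t x" if "x \<in> X" for t a x
    using C0 that by (simp_all add: C0_group_on_def)
  have T0: "T 0 x = x" and Tgroup: "T (s + t) x = T s (T t x)" if "x \<in> X" for s t x
    using C0 that by (simp_all add: C0_group_on_def)
  have Tdiff: "T t (x - y) = T t x - T t y" if "x \<in> X" "y \<in> X" for t x y
    using Tadd[of x "(-1) *\<^sub>R y" t] Tscale[of y t "-1"] that subspace_scale[OF subspace_X, of y "-1"] by simp
  have Tbound: "\<exists>K\<ge>0. \<forall>x\<in>X. N (T t x) \<le> K * N x" for t
  proof -
    obtain K where K: "\<forall>x\<in>X. N (T t x) \<le> K * N x"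
      using C0 unfolding C0_group_on_def by meson
    have "N (T t x) \<le> max K 0 * N x" if "x \<in> X" for x
      using K that N_nonneg[OF that] mult_right_mono[of K "max K 0" "N x"] by force
    then show ?thesis by (intro exI[of _ "max K 0"]) auto
  qed
  have dom_case: "\<Phi> (T t x) i = flow i t (\<Phi> x i)" if x: "x \<in> dom_op A" for x t
  proof -
    define y where "y = app_op A x"
    have xy: "x \<in> X" "y \<in> X" using op_iff[of x y] x by (auto simp: y_def)
    have "((\<lambda>s. \<Phi> (T s x) i) has_vector_derivative G i (\<Phi> (T t x) i)) (at t)" for t
    proof -
      let ?u = "\<lambda>h. (1 / h) *\<^sub>R (T h x - x) - y"
      have uX: "?u h \<in> X" for h
        by (intro subspace_diff[OF subspace_X] subspace_scale[OF subspace_X] TX xy)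
      have Tu: "T t (?u h) = (1 / h) *\<^sub>R (T h (T t x) - T t x) - T t y" for h
      proof -
        have d: "T h x - x \<in> X" by (intro subspace_diff[OF subspace_X] TX xy)
        have "T t (T h x) = T h (T t x)"
          using Tgroup[OF xy(1), of t h] Tgroup[OF xy(1), of h t] by (simp add: add.commute)
        then show ?thesis
          using xy TX d subspace_scale[OF subspace_X d] by (simp add: Tdiff Tscale)
      qed
      obtain K where K: "K \<ge> 0" "\<And>x. x \<in> X \<Longrightarrow> N (T t x) \<le> K * N x" using Tbound by blast
      have "((\<lambda>h. N (?u h)) \<longlongrightarrow> 0) (at 0)" using gen[OF xy] x by (simp add: y_def)
      then have "((\<lambda>h. K * N (?u h)) \<longlongrightarrow> K * 0) (at 0)" by (intro tendsto_intros)
      then have lim0: "((\<lambda>h. K * N (?u h)) \<longlongrightarrow> 0) (at 0)" by simp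
      \<comment> \<open>Applying the bounded \<open>T t\<close> to the quotient at 0 yields two
        things: \<open>T t x\<close> stays in the domain with image \<open>T t y\<close>, and the
        orbit is differentiable at time \<open>t\<close>.\<close>
      have lim: "((\<lambda>h. N ((1 / h) *\<^sub>R (T h (T t x) - T t x) - T t y)) \<longlongrightarrow> 0) (at 0)"
        unfolding Tu[symmetric]
        by (rule Lim_null_comparison[OF _ lim0]) (simp add: K uX TX N_nonneg)
      then have "\<Phi> (T t y) i = G i (\<Phi> (T t x) i)"
        using gen[of "T t x" "T t y"] op_iff[of "T t x" "T t y"] TX xy i by blast
      moreover have "((\<lambda>h. (1 / h) *\<^sub>R (\<Phi> (T (t + h) x) i - \<Phi> (T t x) i)) \<longlongrightarrow> \<Phi> (T t y) i) (at 0)"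
      proof -
        have *: "T h (T t x) - T t x \<in> X" "(1 / h) *\<^sub>R (T h (T t x) - T t x) \<in> X" for h
          by (intro subspace_diff[OF subspace_X] subspace_scale[OF subspace_X] TX xy)+
        have eq: "\<Phi> ((1 / h) *\<^sub>R (T h (T t x) - T t x) - T t y) i
            = (1 / h) *\<^sub>R (\<Phi> (T (t + h) x) i - \<Phi> (T t x) i) - \<Phi> (T t y) i" for h
          using *[of h] TX xy i Tgroup[OF xy(1), of h t] by (simp add: coord_diff coord_scale add.commute)
        have "((\<lambda>h. \<Phi> ((1 / h) *\<^sub>R (T h (T t x) - T t x) - T t y) i) \<longlongrightarrow> 0) (at 0)"
          using * TX xy i subspace_diff[OF subspace_X]
          by (intro Lim_null_comparison[OF _ lim]) (simp add: norm_coord_le)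
        then show ?thesis unfolding eq by (simp add: LIM_zero_iff)
      qed
      ultimately show ?thesis
        by (simp add: has_vector_derivative_iff_quotient)
    qed
    from solution_eq_flow[OF i this] show ?thesis using T0 xy by simp
  qed
  obtain K where K: "K \<ge> 0" "\<And>x. x \<in> X \<Longrightarrow> N (T t x) \<le> K * N x" using Tbound by blast
  have "norm (\<Phi> (T t x) i - flow i t (\<Phi> x i)) \<le> 0 + \<epsilon>" if "\<epsilon> > 0" for \<epsilon>
  proof -
    \<comment> \<open>Dividing by \<open>K + 1\<close> also covers \<open>K = 0\<close>.\<close>
    have "\<epsilon> / (K + 1) > 0" using that K by simp
    then obtain J where J: "finite J" "i \<in> J"
      "\<And>z. z \<in> X \<Longrightarrow> \<forall>i\<in>I. \<Phi> z i = (if i \<in> J then \<Phi> x i else 0) \<Longrightarrow> N (x - z) \<le> \<epsilon> / (K + 1)"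
      using truncation_approximates[OF x _ i, of "\<epsilon> / (K + 1)"] by blast
    obtain z where z: "z \<in> X" "\<forall>i\<in>I. \<Phi> z i = (if i \<in> J then \<Phi> x i else 0)"
      using truncation_exists[OF J(1), of "\<Phi> x"] by blast
    \<comment> \<open>The mode images of a truncation have finite support, so they are the
      coordinates of a vector \<open>w\<close> in \<open>X\<close>; this is why \<open>z\<close>
      lies in the domain.\<close>
    obtain w where w: "w \<in> X" "\<forall>i\<in>I. \<Phi> w i = (if i \<in> J then G i (\<Phi> x i) else 0)"
      using truncation_exists[OF J(1), of "\<lambda>i. G i (\<Phi> x i)"] by blast
    have "\<forall>i\<in>I. \<Phi> w i = G i (\<Phi> z i)"
      using z w by (simp add: linear_0[OF bounded_linear.linear[OF bounded_linear_G]])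
    then have "z \<in> dom_op A" using op_iff z w by blast
    then have "\<Phi> (T t z) i = flow i t (\<Phi> x i)" using dom_case z J(2) i by simp
    then have "\<Phi> (T t x) i - flow i t (\<Phi> x i) = \<Phi> (T t (x - z)) i"
      using x z(1) TX i by (simp add: Tdiff coord_diff)
    also have "norm \<dots> \<le> K * N (x - z)"
      using norm_coord_le[of "T t (x - z)" i] K(2)[of "x - z"] TX x z(1) i subspace_diff[OF subspace_X]
      by (meson order_trans)
    also have "\<dots> \<le> K * (\<epsilon> / (K + 1))" using J(3)[OF z] K by (intro mult_left_mono) auto
    also have "\<dots> \<le> \<epsilon>" using K that by (simp add: field_simps)
    finally show ?thesis by simp
  qed
  then have "norm (\<Phi> (T t x) i - flow i t (\<Phi> x i)) \<le> 0" by (rule field_le_epsilon)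
  then show ?thesis by simp
qed

end

section \<open>The third-order equation in an eigenbasis\<close>

locale mgt_setting =
  fixes X :: "'h::{real_inner,banach} set" and A :: "'h lop" and E :: "'h set" and m :: "'h \<Rightarrow> real"
    and l \<alpha> c \<delta> :: real
  assumes X: "subspace X" "closed X" and basis: "orthonormal_basis_of X E"
    and A: "self_adjoint_on X A"
    and eig: "\<And>e. e \<in> E \<Longrightarrow> e \<in> dom_op A \<and> app_op A e = m e *\<^sub>R e"
    and l: "l > 0" "\<And>e. e \<in> E \<Longrightarrow> l \<le> m e"
    and params: "\<alpha> > 0" "c > 0" "\<delta> > 0"
begin

abbreviation S where "S \<equiv> op_sqrt X A"
abbreviation s where "s e \<equiv> sqrt (m e)"

definition coord :: "'h \<times> 'h \<times> 'h \<Rightarrow> 'h \<Rightarrow> real \<times> real \<times> real" where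
  "coord = (\<lambda>(u, v, w) e. (m e * (u \<bullet> e), s e * (v \<bullet> e), w \<bullet> e))"

lemma m_pos: "e \<in> E \<Longrightarrow> m e > 0"
  using l by force

lemma A_iff: "x \<in> dom_op A \<and> y = app_op A x \<longleftrightarrow> diag_rel X E m x y"
  by (rule self_adjoint_eq_diag_rel[OF X basis A eig])

lemma S_iff: "x \<in> dom_op S \<and> y = app_op S x \<longleftrightarrow> diag_rel X E s x y"
  by (rule op_sqrt_diag_rel[OF X basis A eig m_pos])

lemma A_app: "x \<in> dom_op A \<Longrightarrow> diag_rel X E m x (app_op A x)"
  using A_iff by blast

lemma S_app: "x \<in> dom_op S \<Longrightarrow> diag_rel X E s x (app_op S x)"
  using S_iff by blast

lemma dom_A_sub: "x \<in> dom_op A \<Longrightarrow> x \<in> X" and app_A_in: "x \<in> dom_op A \<Longrightarrow> app_op A x \<in> X"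
  and A_coord: "x \<in> dom_op A \<Longrightarrow> e \<in> E \<Longrightarrow> app_op A x \<bullet> e = m e * (x \<bullet> e)"
  using A_app by (auto simp: diag_rel_def[OF X basis])

lemma dom_S_sub: "x \<in> dom_op S \<Longrightarrow> x \<in> X" and app_S_in: "x \<in> dom_op S \<Longrightarrow> app_op S x \<in> X"
  and S_coord: "x \<in> dom_op S \<Longrightarrow> e \<in> E \<Longrightarrow> app_op S x \<bullet> e = s e * (x \<bullet> e)"
  using S_app by (auto simp: diag_rel_def[OF X basis])

lemma subspace_dom_A: "subspace (dom_op A)"
  using A by (simp add: self_adjoint_on_def linear_op_on_def)

lemma subspace_dom_S: "subspace (dom_op S)"
proof -
  have "dom_op S = {x. \<exists>y. diag_rel X E s x y}" using S_iff by blast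
  then show ?thesis
    by (auto intro!: subspaceI intro: diag_rel_zero[OF X basis] diag_rel_add[OF X basis] diag_rel_scale[OF X basis])
qed

text \<open>The spectral gap gives \<open>m e \<le> (1 / l) * (m e)\<^sup>2\<close>. The inclusion
  makes the values of \<open>MGT_op\<close> on its domain land in the phase space.\<close>

lemma dom_A_sub_dom_S: 
  assumes "x \<in> dom_op A"
  shows "x \<in> dom_op S"
proof -
  have sA: "(\<lambda>e. (m e * (x \<bullet> e))\<^sup>2) summable_on E"
    using diag_rel_iff_summable[OF X basis, of m x] A_app[OF assms] by blast
  have "(\<lambda>e. (s e * (x \<bullet> e))\<^sup>2) summable_on E"
  proof (rule summable_on_comparison_test)
    show "(\<lambda>e. (1 / l) * (m e * (x \<bullet> e))\<^sup>2) summable_on E"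
      by (intro summable_on_cmult_right sA)
    fix e assume e: "e \<in> E"
    have "(s e * (x \<bullet> e))\<^sup>2 = m e * (x \<bullet> e)\<^sup>2"
      using m_pos[OF e] by (simp add: power_mult_distrib)
    also have "\<dots> \<le> (1 / l) * (m e * m e) * (x \<bullet> e)\<^sup>2"
      using l(1) l(2)[OF e] m_pos[OF e] by (intro mult_right_mono) (auto simp: field_simps)
    finally show "(s e * (x \<bullet> e))\<^sup>2 \<le> (1 / l) * (m e * (x \<bullet> e))\<^sup>2"
      by (simp add: power_mult_distrib power2_eq_square mult_ac)
  qed auto
  then have "\<exists>y. diag_rel X E s x y"
    using diag_rel_iff_summable[OF X basis, of s x] dom_A_sub[OF assms] by blast
  then show ?thesis using S_iff by blast
qed

lemma energy_has_sum:
  assumes "U \<in> phase_space X A" "\<tau> \<ge> 0"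
  shows "((\<lambda>e. energy \<tau> (coord U e)) has_sum (phase_norm_tau X A \<tau> U)\<^sup>2) E"
proof -
  obtain u v w where U: "U = (u, v, w)" "u \<in> dom_op A" "v \<in> dom_op S" "w \<in> X"
    using assms by (auto simp: phase_space_def)
  have "((\<lambda>e. (app_op A u \<bullet> e)\<^sup>2 + (app_op S v \<bullet> e)\<^sup>2 + \<tau> * (w \<bullet> e)\<^sup>2) has_sum
      ((norm (app_op A u))\<^sup>2 + (norm (app_op S v))\<^sup>2 + \<tau> * (norm w)\<^sup>2)) E"
    using U by (intro has_sum_add has_sum_cmult_right parseval[OF X basis] app_A_in app_S_in)
  moreover have "energy \<tau> (coord U e) = (app_op A u \<bullet> e)\<^sup>2 + (app_op S v \<bullet> e)\<^sup>2 + \<tau> * (w \<bullet> e)\<^sup>2"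
    if "e \<in> E" for e
    using U that by (simp add: energy_def coord_def A_coord S_coord)
  ultimately have "((\<lambda>e. energy \<tau> (coord U e)) has_sum
      ((norm (app_op A u))\<^sup>2 + (norm (app_op S v))\<^sup>2 + \<tau> * (norm w)\<^sup>2)) E"
    by (simp cong: has_sum_cong)
  then show ?thesis using assms(2) by (simp add: phase_norm_tau_def U(1))
qed

lemma phase_norm_eq: "phase_norm X A = phase_norm_tau X A 1"
  by (simp add: phase_norm_def phase_norm_tau_def)

text \<open>Dividing the coefficients by multipliers bounded below keeps them square-summable; this
  is what makes the phase space coordinates surjective.\<close>

lemma diag_rel_surj:
  assumes a: "(\<lambda>e. (a e)\<^sup>2) summable_on E" and k: "k > 0" "\<And>e. e \<in> E \<Longrightarrow> k \<le> n e"
  shows "\<exists>x y. diag_rel X E n x y \<and> (\<forall>e\<in>E. n e * (x \<bullet> e) = a e)"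
proof -
  have "(\<lambda>e. (a e / n e)\<^sup>2) summable_on E"
  proof (rule summable_on_comparison_test)
    show "(\<lambda>e. (1 / k)\<^sup>2 * (a e)\<^sup>2) summable_on E" by (intro summable_on_cmult_right a)
    show "(a e / n e)\<^sup>2 \<le> (1 / k)\<^sup>2 * (a e)\<^sup>2" if e: "e \<in> E" for e
    proof -
      have "\<bar>a e\<bar> / n e \<le> \<bar>a e\<bar> / k" using k(1) k(2)[OF e] by (intro divide_left_mono) auto
      then have "(\<bar>a e\<bar> / n e)\<^sup>2 \<le> (\<bar>a e\<bar> / k)\<^sup>2" using k(1) k(2)[OF e] by (intro power_mono) auto
      then show ?thesis by (simp add: power_divide)
    qed
  qed auto
  then obtain x where x: "x \<in> X" "\<forall>e\<in>E. x \<bullet> e = a e / n e"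
    using riesz_fischer[OF X basis, of "\<lambda>e. a e / n e"] by blast
  obtain y where y: "y \<in> X" "\<forall>e\<in>E. y \<bullet> e = a e" using riesz_fischer[OF X basis a] by blast
  have nx: "\<forall>e\<in>E. n e * (x \<bullet> e) = a e"
  proof
    fix e assume "e \<in> E"
    then show "n e * (x \<bullet> e) = a e" using x(2) k(1) k(2)[of e] by simp
  qed
  then have "diag_rel X E n x y" using x(1) y by (simp add: diag_rel_def[OF X basis])
  then show ?thesis using nx by blast
qed

lemma l2_coordinates: "l2_coordinates (phase_space X A) (phase_norm X A) E coord"
proof
  show "subspace (phase_space X A)"
    unfolding phase_space_def by (intro subspace_Times subspace_dom_A subspace_dom_S X)
  show "coord (x + y) e = coord x e + coord y e" for x y e
    by (cases x; cases y) (simp add: coord_def inner_add_left algebra_simps)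
  show "coord (a *\<^sub>R x) e = a *\<^sub>R coord x e" for a x e
    by (cases x) (simp add: coord_def)
  show "x = 0" if xX: "x \<in> phase_space X A" and "\<And>e. e \<in> E \<Longrightarrow> coord x e = 0" for x
  proof -
    obtain u v w where x: "x = (u, v, w)" "u \<in> X" "v \<in> X" "w \<in> X"
      using xX dom_A_sub dom_S_sub by (auto simp: phase_space_def)
    have "u \<bullet> e = 0 \<and> v \<bullet> e = 0 \<and> w \<bullet> e = 0" if "e \<in> E" for e
      using \<open>\<And>e. e \<in> E \<Longrightarrow> coord x e = 0\<close>[OF that] m_pos[OF that] by (simp add: x(1) coord_def zero_prod_def)
    then have "u = 0" "v = 0" "w = 0"
      using basis_total[OF X basis] x by blast+
    then show ?thesis by (simp add: x(1) zero_prod_def)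
  qed
  show "0 \<le> phase_norm X A x" for x
    by (cases x) (simp add: phase_norm_def)
  show "((\<lambda>e. (norm (coord x e))\<^sup>2) has_sum (phase_norm X A x)\<^sup>2) E" if "x \<in> phase_space X A" for x
    using energy_has_sum[OF that, of 1] by (simp add: energy_1 phase_norm_eq)
  show "\<exists>x\<in>phase_space X A. \<forall>e\<in>E. coord x e = f e" if f: "(\<lambda>e. (norm (f e))\<^sup>2) summable_on E" for f
  proof -
    have f2: "(norm (f e))\<^sup>2 = (fst (f e))\<^sup>2 + (fst (snd (f e)))\<^sup>2 + (snd (snd (f e)))\<^sup>2" for e
      using energy_1[of "f e"] by (simp add: energy_def case_prod_beta)
    have "(\<lambda>e. (fst (f e))\<^sup>2) summable_on E" "(\<lambda>e. (fst (snd (f e)))\<^sup>2) summable_on E"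
      "(\<lambda>e. (snd (snd (f e)))\<^sup>2) summable_on E"
      by (rule summable_on_comparison_test[OF f]; simp add: f2)+
    note summ = this
    obtain u u' where u: "diag_rel X E m u u'" "\<forall>e\<in>E. m e * (u \<bullet> e) = fst (f e)"
      using diag_rel_surj[OF summ(1) l(1), of m] l(2) by blast
    have "sqrt l \<le> s e" if "e \<in> E" for e using l(2)[OF that] by simp
    then obtain v v' where v: "diag_rel X E s v v'" "\<forall>e\<in>E. s e * (v \<bullet> e) = fst (snd (f e))"
      using diag_rel_surj[OF summ(2), of "sqrt l" s] l(1) by auto
    obtain w where w: "w \<in> X" "\<forall>e\<in>E. w \<bullet> e = snd (snd (f e))"
      using riesz_fischer[OF X basis summ(3)] by blast
    have "u \<in> dom_op A" "v \<in> dom_op S" using u v A_iff S_iff by blast+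
    then have "(u, v, w) \<in> phase_space X A" using w by (simp add: phase_space_def)
    moreover have "\<forall>e\<in>E. coord (u, v, w) e = f e"
      using u v w by (simp add: coord_def)
    ultimately show ?thesis by blast
  qed
qed

text \<open>The domain of \<open>MGT_op\<close> is the maximal one: if the coordinates of
  \<open>V\<close> are the mode images of those of \<open>U\<close>, then \<open>v1 = v\<close> and
  \<open>v2 = w\<close>, and membership of \<open>V\<close> in the phase space forces
  \<open>v\<close> into \<open>dom_op A\<close> and \<open>w\<close> into
  \<open>dom_op S\<close>.\<close>

lemma MGT_op_iff:
  assumes "\<tau> > 0"
  shows "U \<in> dom_op (MGT_op X A \<alpha> c \<delta> \<tau>) \<and> V = app_op (MGT_op X A \<alpha> c \<delta> \<tau>) U \<longleftrightarrow>
    U \<in> phase_space X A \<and> V \<in> phase_space X A \<and>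
    (\<forall>e\<in>E. coord V e = mgt_mode \<alpha> c (b_coeff c \<delta> \<tau>) \<tau> (s e) (coord U e))"
proof -
  obtain u v w where U: "U = (u, v, w)" by (cases U)
  obtain v1 v2 v3 where V: "V = (v1, v2, v3)" by (cases V)
  define b where "b = b_coeff c \<delta> \<tau>"
  define z where "z = - ((1 / \<tau>) *\<^sub>R app_op A (c\<^sup>2 *\<^sub>R u + b *\<^sub>R v)) - (1 / \<tau>) *\<^sub>R \<alpha> *\<^sub>R w"
  have z: "z \<in> X" "\<forall>e\<in>E. z \<bullet> e = - (c\<^sup>2 * (m e * (u \<bullet> e)) + b * s e * (s e * (v \<bullet> e)) + \<alpha> * (w \<bullet> e)) / \<tau>"
    if "u \<in> dom_op A" "v \<in> dom_op A" "w \<in> X"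
  proof -
    have d: "c\<^sup>2 *\<^sub>R u + b *\<^sub>R v \<in> dom_op A"
      using that by (intro subspace_add[OF subspace_dom_A] subspace_scale[OF subspace_dom_A])
    show "z \<in> X"
      unfolding z_def
      by (intro subspace_diff[OF X(1)] subspace_neg[OF X(1)] subspace_scale[OF X(1)] app_A_in d that)
    show "\<forall>e\<in>E. z \<bullet> e = - (c\<^sup>2 * (m e * (u \<bullet> e)) + b * s e * (s e * (v \<bullet> e)) + \<alpha> * (w \<bullet> e)) / \<tau>"
    proof
      fix e assume e: "e \<in> E"
      have "s e * (s e * (v \<bullet> e)) = m e * (v \<bullet> e)"
        using m_pos[OF e] by (simp flip: mult.assoc)
      then show "z \<bullet> e = - (c\<^sup>2 * (m e * (u \<bullet> e)) + b * s e * (s e * (v \<bullet> e)) + \<alpha> * (w \<bullet> e)) / \<tau>"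
        using A_coord[OF d e] assms
        by (simp add: z_def inner_diff_left inner_add_left mult.assoc field_simps)
    qed
  qed
  have ss: "m e * x = s e * (s e * x)" if "e \<in> E" for e x
    using m_pos[OF that] by (simp flip: mult.assoc)
  have mode: "coord V e = mgt_mode \<alpha> c b \<tau> (s e) (coord U e) \<longleftrightarrow>
      v1 \<bullet> e = v \<bullet> e \<and> v2 \<bullet> e = w \<bullet> e \<and>
      v3 \<bullet> e = - (c\<^sup>2 * (m e * (u \<bullet> e)) + b * s e * (s e * (v \<bullet> e)) + \<alpha> * (w \<bullet> e)) / \<tau>" if e: "e \<in> E" for e
    using m_pos[OF e] by (auto simp: U V coord_def mgt_mode_def simp flip: ss[OF e])
  show ?thesis
  proof
    assume "U \<in> dom_op (MGT_op X A \<alpha> c \<delta> \<tau>) \<and> V = app_op (MGT_op X A \<alpha> c \<delta> \<tau>) U"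
    then have d: "u \<in> dom_op A" "v \<in> dom_op A" "w \<in> dom_op S" and V': "v1 = v" "v2 = w" "v3 = z"
      by (auto simp: MGT_op_def U V z_def b_def)
    note z' = z[OF d(1,2) dom_S_sub[OF d(3)]]
    have "U \<in> phase_space X A" "V \<in> phase_space X A"
      using d V' z' dom_A_sub_dom_S dom_S_sub by (auto simp: phase_space_def U V)
    moreover have "\<forall>e\<in>E. coord V e = mgt_mode \<alpha> c b \<tau> (s e) (coord U e)"
      using z' V' by (simp add: mode)
    ultimately show "U \<in> phase_space X A \<and> V \<in> phase_space X A \<and>
      (\<forall>e\<in>E. coord V e = mgt_mode \<alpha> c (b_coeff c \<delta> \<tau>) \<tau> (s e) (coord U e))" by (simp add: b_def)
  next
    assume *: "U \<in> phase_space X A \<and> V \<in> phase_space X A \<and>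
      (\<forall>e\<in>E. coord V e = mgt_mode \<alpha> c (b_coeff c \<delta> \<tau>) \<tau> (s e) (coord U e))"
    then have d: "u \<in> dom_op A" "v \<in> dom_op S" "w \<in> X" "v1 \<in> dom_op A" "v2 \<in> dom_op S" "v3 \<in> X"
      by (auto simp: phase_space_def U V)
    have co: "v1 \<bullet> e = v \<bullet> e" "v2 \<bullet> e = w \<bullet> e"
      "v3 \<bullet> e = - (c\<^sup>2 * (m e * (u \<bullet> e)) + b * s e * (s e * (v \<bullet> e)) + \<alpha> * (w \<bullet> e)) / \<tau>" if "e \<in> E" for e
      using * mode[OF that] that by (auto simp: b_def)
    have "v1 = v" "v2 = w"
      using d co dom_A_sub dom_S_sub by (auto intro!: basis_eqI[OF X basis])
    moreover have "v3 = z"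
      using z[OF d(1) _ d(3)] \<open>v1 = v\<close> d co by (intro basis_eqI[OF X basis]) auto
    ultimately show "U \<in> dom_op (MGT_op X A \<alpha> c \<delta> \<tau>) \<and> V = app_op (MGT_op X A \<alpha> c \<delta> \<tau>) U"
      using d by (auto simp: MGT_op_def U V z_def b_def)
  qed
qed

lemma b_coeff_pos: "\<tau> > 0 \<Longrightarrow> b_coeff c \<delta> \<tau> > 0"
  using params by (auto simp: b_coeff_def intro: add_pos_nonneg)

section \<open>Generation and uniform decay on the phase space\<close>

lemma mode_system:
  assumes "\<tau> > 0"
  shows "\<exists>M \<omega>. mode_system (phase_space X A) (phase_norm X A) E coord (MGT_op X A \<alpha> c \<delta> \<tau>)
    (\<lambda>e. mgt_mode \<alpha> c (b_coeff c \<delta> \<tau>) \<tau> (s e)) M \<omega>"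
proof -
  obtain M \<omega> where M: "M > 0" "\<omega> \<ge> 0" and growth:
    "\<forall>s y. (\<forall>t. (y has_vector_derivative mgt_mode \<alpha> c (b_coeff c \<delta> \<tau>) \<tau> s (y t)) (at t)) \<longrightarrow>
      (\<forall>t. norm (y t) \<le> M * exp (\<omega> * \<bar>t\<bar>) * norm (y 0))"
    using mgt_mode_growth[OF b_coeff_pos[OF assms] assms, of \<alpha> c] by blast
  have "mode_system (phase_space X A) (phase_norm X A) E coord (MGT_op X A \<alpha> c \<delta> \<tau>)
    (\<lambda>e. mgt_mode \<alpha> c (b_coeff c \<delta> \<tau>) \<tau> (s e)) M \<omega>"
  proof (intro mode_system.intro mode_system_axioms.intro)
    show "0 \<le> M" "0 \<le> \<omega>" using M by auto
    show "norm (g t) \<le> M * exp (\<omega> * \<bar>t\<bar>) * norm (g 0)"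
      if "\<And>t. (g has_vector_derivative mgt_mode \<alpha> c (b_coeff c \<delta> \<tau>) \<tau> (s e) (g t)) (at t)" for e g t
      using growth that by blast
  qed (rule l2_coordinates MGT_op_iff[OF assms] bounded_linear_mgt_mode)+
  then show ?thesis by blast
qed

lemma MGT_generates_group:
  assumes "\<tau> > 0"
  shows "\<exists>T. generates_C0_group (phase_space X A) (phase_norm X A) (MGT_op X A \<alpha> c \<delta> \<tau>) T"
  using mode_system[OF assms] mode_system.generates_group by blast

text \<open>Generation refers to \<open>phase_norm\<close>, decay to \<open>phase_norm_tau\<close>;
  both are sums over the same modes, so the decay of each \<open>energy \<tau>\<close> is summed
  directly. Taking square roots turns \<open>M\<close> and \<open>\<omega>\<close> into
  \<open>sqrt M\<close> and \<open>\<omega> / 2\<close>.\<close>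

lemma MGT_uniform_decay:
  assumes "\<gamma>0 > 0"
  shows "\<exists>M>0. \<exists>\<omega>>0. \<forall>\<tau> T t. 0 < \<tau> \<and> \<tau> \<le> 1 \<and> 0 \<le> t \<and> \<gamma>0 < gamma_coeff \<alpha> c \<delta> \<tau> \<and>
      generates_C0_group (phase_space X A) (phase_norm X A) (MGT_op X A \<alpha> c \<delta> \<tau>) T \<longrightarrow>
      opnorm_on (phase_space X A) (phase_norm_tau X A \<tau>) (T t) \<le> M * exp (- \<omega> * t)"
proof -
  have "sqrt l > 0" using l by simp
  from mgt_mode_decay[OF params assms this] obtain M \<omega> where M: "M > 0" "\<omega> > 0" and decay:
    "\<forall>\<tau> s y t. 0 < \<tau> \<and> \<tau> \<le> 1 \<and> \<gamma>0 < gamma_coeff \<alpha> c \<delta> \<tau> \<and> sqrt l \<le> s \<and> 0 \<le> t \<and>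
      (\<forall>t. (y has_vector_derivative mgt_mode \<alpha> c (b_coeff c \<delta> \<tau>) \<tau> s (y t)) (at t)) \<longrightarrow>
      energy \<tau> (y t) \<le> M * exp (- \<omega> * t) * energy \<tau> (y 0)"
    by auto
  have "opnorm_on (phase_space X A) (phase_norm_tau X A \<tau>) (T t) \<le> sqrt M * exp (- (\<omega> / 2) * t)"
    if \<tau>: "0 < \<tau>" "\<tau> \<le> 1" and t: "0 \<le> t" and \<gamma>: "\<gamma>0 < gamma_coeff \<alpha> c \<delta> \<tau>"
      and T: "generates_C0_group (phase_space X A) (phase_norm X A) (MGT_op X A \<alpha> c \<delta> \<tau>) T" for \<tau> T t
  proof -
    obtain M' \<omega>' where sys: "mode_system (phase_space X A) (phase_norm X A) E coord (MGT_op X A \<alpha> c \<delta> \<tau>)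
      (\<lambda>e. mgt_mode \<alpha> c (b_coeff c \<delta> \<tau>) \<tau> (s e)) M' \<omega>'"
      using mode_system[OF \<tau>(1)] by blast
    interpret mode_system "phase_space X A" "phase_norm X A" E coord "MGT_op X A \<alpha> c \<delta> \<tau>"
      "\<lambda>e. mgt_mode \<alpha> c (b_coeff c \<delta> \<tau>) \<tau> (s e)" M' \<omega>'
      by (rule sys)
    let ?N = "phase_norm_tau X A \<tau>"
    let ?K = "sqrt M * exp (- (\<omega> / 2) * t)"
    have N0: "0 \<le> ?N x" for x using \<tau> by (cases x) (simp add: phase_norm_tau_def)
    have bound: "?N (T t x) \<le> ?K * ?N x" if x: "x \<in> phase_space X A" for x
    proof (rule power2_le_imp_le)
      have "T t ` phase_space X A \<subseteq> phase_space X A"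
        using T by (simp add: generates_C0_group_def C0_group_on_def)
      then have Tx: "T t x \<in> phase_space X A" using x by blast
      have "(?N (T t x))\<^sup>2 \<le> M * exp (- \<omega> * t) * (?N x)\<^sup>2"
      proof (rule has_sum_mono)
        show "((\<lambda>e. energy \<tau> (coord (T t x) e)) has_sum (?N (T t x))\<^sup>2) E"
          using Tx \<tau> by (intro energy_has_sum) auto
        show "((\<lambda>e. M * exp (- \<omega> * t) * energy \<tau> (coord x e)) has_sum (M * exp (- \<omega> * t) * (?N x)\<^sup>2)) E"
          using x \<tau> by (intro has_sum_cmult_right energy_has_sum) auto
        fix e assume e: "e \<in> E"
        have "sqrt l \<le> s e" using l(2)[OF e] by simp
        then show "energy \<tau> (coord (T t x) e) \<le> M * exp (- \<omega> * t) * energy \<tau> (coord x e)"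
          using decay[rule_format, of \<tau> "s e" t "\<lambda>t. flow e t (coord x e)"] \<tau> t \<gamma> flow_derivative
          by (simp add: coord_generated_group[OF T x e])
      qed
      also have "\<dots> = (?K * ?N x)\<^sup>2"
      proof -
        have "(exp (- (\<omega> / 2) * t))\<^sup>2 = exp (- \<omega> * t)"
          by (simp add: power2_eq_square flip: exp_add)
        then show ?thesis using M by (simp add: power_mult_distrib)
      qed
      finally show "(?N (T t x))\<^sup>2 \<le> (?K * ?N x)\<^sup>2" .
      show "0 \<le> ?K * ?N x" using M N0 by simp
    qed
    show ?thesis
      unfolding opnorm_on_def
    proof (rule cSUP_least)
      show "phase_space X A \<noteq> {}" using subspace_0[OF subspace_X] by blast
      fix x assume x: "x \<in> phase_space X A"
      show "?N (T t x) / ?N x \<le> ?K"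
      proof (cases "?N x = 0")
        \<comment> \<open>Here the quotient in \<open>opnorm_on\<close> is 0 by the convention on
          division by zero.\<close>
        case True
        then show ?thesis using M by simp
      next
        case False
        then have "?N x > 0" using N0[of x] by simp
        then show ?thesis using bound[OF x] by (simp add: divide_le_eq)
      qed
    qed
  qed
  moreover have "sqrt M > 0" "\<omega> / 2 > 0" using M by auto
  ultimately show ?thesis by blast
qed

end

section \<open>Application to the Dirichlet Laplacian\<close>

theorem theorem2p3:
  fixes \<Omega> :: "(real^'n) set" and \<alpha> c \<delta> :: real
  assumes "CARD('n) = 2 \<or> CARD('n) = 3"
    and "open \<Omega>" and "connected \<Omega>" and "\<Omega> \<noteq> {}" and "bounded \<Omega>" and "C2_boundary \<Omega>"
    and "self_adjoint_on (L2_on \<Omega>) (dirichlet_laplacian \<Omega>)" and "positive_op (dirichlet_laplacian \<Omega>)" and "compact_resolvent_on (L2_on \<Omega>) (dirichlet_laplacian \<Omega>)"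
    and "\<alpha> > 0" and "c > 0" and "\<delta> > 0"
  shows "let X = L2_on \<Omega>; A = dirichlet_laplacian \<Omega> in
    (\<forall>\<tau>>0. \<exists>T. generates_C0_group (phase_space X A) (phase_norm X A) (MGT_op X A \<alpha> c \<delta> \<tau>) T) \<and>
    (\<forall>T.
      (\<forall>\<tau>>0. generates_C0_group (phase_space X A) (phase_norm X A) (MGT_op X A \<alpha> c \<delta> \<tau>) (T \<tau>)) \<longrightarrow>
      (\<exists>\<gamma>0>0. \<forall>\<tau>>0. gamma_coeff \<alpha> c \<delta> \<tau> > \<gamma>0) \<longrightarrow>
      (\<exists>\<tau>0>0. \<exists>M>0. \<exists>\<omega>>0. \<forall>\<tau>. 0 < \<tau> \<and> \<tau> \<le> \<tau>0 \<longrightarrow>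
         (\<forall>t\<ge>0. opnorm_on (phase_space X A) (phase_norm_tau X A \<tau>) (T \<tau> t) \<le> M * exp (- \<omega> * t))))"
proof -
  let ?X = "L2_on \<Omega>" and ?A = "dirichlet_laplacian \<Omega>"
  have X: "subspace ?X" "closed ?X"
    using subspace_L2_on closed_L2_on[OF assms(2)] by auto
  obtain E m l where E: "orthonormal_basis_of ?X E" and l: "l > 0"
    and eig: "\<And>e. e \<in> E \<Longrightarrow> e \<in> dom_op ?A \<and> app_op ?A e = m e *\<^sub>R e"
    and ml: "\<And>e. e \<in> E \<Longrightarrow> m e \<ge> l"
    using spectral_theorem_compact_resolvent[OF X assms(7-9)] by metis
  interpret mgt_setting ?X ?A E m l \<alpha> c \<delta>
    by unfold_locales (fact X E eig l ml assms(7,10-12))+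
  show ?thesis
    unfolding Let_def
  proof (intro conjI allI impI)
    show "\<exists>T. generates_C0_group (phase_space ?X ?A) (phase_norm ?X ?A) (MGT_op ?X ?A \<alpha> c \<delta> \<tau>) T"
      if "\<tau> > 0" for \<tau>
      by (rule MGT_generates_group[OF that])
    fix T
    assume T: "\<forall>\<tau>>0. generates_C0_group (phase_space ?X ?A) (phase_norm ?X ?A) (MGT_op ?X ?A \<alpha> c \<delta> \<tau>) (T \<tau>)"
      and "\<exists>\<gamma>0>0. \<forall>\<tau>>0. gamma_coeff \<alpha> c \<delta> \<tau> > \<gamma>0"
    then obtain \<gamma>0 where \<gamma>0: "\<gamma>0 > 0" "\<And>\<tau>. \<tau> > 0 \<Longrightarrow> gamma_coeff \<alpha> c \<delta> \<tau> > \<gamma>0" by blast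
    obtain M \<omega> where "M > 0" "\<omega> > 0" and
      "\<forall>\<tau> T t. 0 < \<tau> \<and> \<tau> \<le> 1 \<and> 0 \<le> t \<and> \<gamma>0 < gamma_coeff \<alpha> c \<delta> \<tau> \<and>
      generates_C0_group (phase_space ?X ?A) (phase_norm ?X ?A) (MGT_op ?X ?A \<alpha> c \<delta> \<tau>) T \<longrightarrow>
      opnorm_on (phase_space ?X ?A) (phase_norm_tau ?X ?A \<tau>) (T t) \<le> M * exp (- \<omega> * t)"
      using MGT_uniform_decay[OF \<gamma>0(1)] by blast
    \<comment> \<open>The threshold is \<open>\<tau>0 = 1\<close>, the range on which the Lyapunov
      constants were made uniform.\<close>
    then show "\<exists>\<tau>0>0. \<exists>M>0. \<exists>\<omega>>0. \<forall>\<tau>. 0 < \<tau> \<and> \<tau> \<le> \<tau>0 \<longrightarrow>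
         (\<forall>t\<ge>0. opnorm_on (phase_space ?X ?A) (phase_norm_tau ?X ?A \<tau>) (T \<tau> t) \<le> M * exp (- \<omega> * t))"
      using T \<gamma>0(2) by (intro exI[of _ 1] exI[of _ M] exI[of _ \<omega>] conjI) auto
  qed
qed

end
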